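(* Let $n\ge 2$ and let $\mathrm{O}^{\uparrow}_{+}(2,n+1)$, $\psi$, $\zeta$, $\rho$, $\Omega_{\mathrm{IV}}$ be as defined in the context. The subset of $\mathrm{O}^{\uparrow}_{+}(2,n+1)\times\mathbb{R}$ given by $$\widehat{\mathrm{O}}^{\uparrow}_{+}(2,n+1)=\{(\mathbf{X},\tau)\in \mathrm{O}^{\uparrow}_{+}(2,n+1)\times\mathbb{R}\mid \psi(\mathbf{X})=\rho(\tau)\}$$ is a connected embedded submanifold diffeomorphic to $\Omega_{\mathrm{IV}}\times\mathbb{R}\times\mathrm{SO}(n+1)$. The multiplication $$(\mathbf{X},\tau)\star(\mathbf{X}',\tau')=(\mathbf{X}\mathbf{X}',\,\tau+\tau'+\zeta(\mathbf{X},\mathbf{X}'))$$ gives $\widehat{\mathrm{O}}^{\uparrow}_{+}(2,n+1)$ the structure of a Lie group with neutral element $(I_{n+3},0)$ and inverse $(\mathbf{X},\tau)^{-1}=(\mathbf{X}^{-1},-\tau-\zeta(\mathbf{X},\mathbf{X}^{-1}))$. Moreover, the map $$\sigma:\widehat{\mathrm{O}}^{\uparrow}_{+}(2,n+1)\to\mathrm{O}^{\uparrow}_{+}(2,n+1),\qquad (\mathbf{X},\tau)\mapsto\mathbf{X},$$ is a covering homomorphism of Lie groups. If $\widehat{\mathrm{Z}}(2,n+1)$ denotes the center of $\widehat{\mathrm{O}}^{\uparrow}_{+}(2,n+1)$, then: (1) if $n$ is even, $\widehat{\mathrm{Z}}(2,n+1)=\{(I,2\pi k)\mid k\in\mathbb{Z}\}\cong\mathbb{Z}$;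 (2) if $n$ is odd, $\widehat{\mathrm{Z}}(2,n+1)=\{((-1)^kI,\pi k)\mid k\in\mathbb{Z}\}\cong\mathbb{Z}_2\times\mathbb{Z}$. Here $I=I_{n+3}$.
   Context: Fix an integer $n\ge 2$. $\mathbb{R}^{2,n+1}$ is $\mathbb{R}^{n+3}$ with coordinates $x^0,\dots,x^{n+2}$ and scalar product $\langle x,y\rangle=-x^0y^0-x^1y^1+\sum_{j=2}^{n+2}x^jy^j$; $\mathrm{O}^{\uparrow}_{+}(2,n+1)$ is the identity component of its pseudo-orthogonal group. $\mathbb{R}(p,q)$ denotes real $p\times q$ matrices. Write $\mathbf{X}\in\mathrm{O}^{\uparrow}_{+}(2,n+1)$ in blocks $\mathbf{X}=\begin{pmatrix}\mathfrak{a}(\mathbf{X})&\mathfrak{b}(\mathbf{X})\\ \mathfrak{c}(\mathbf{X})&\mathfrak{d}(\mathbf{X})\end{pmatrix}$ with $\mathfrak{a}(\mathbf{X})\in\mathbb{R}(2,2)$, $\mathfrak{b}(\mathbf{X})\in\mathbb{R}(2,n+1)$, $\mathfrak{c}(\mathbf{X})\in\mathbb{R}(n+1,2)$, $\mathfrak{d}(\mathbf{X})\in\mathbb{R}(n+1,n+1)$; $\mathfrak{a}(\mathbf X)$ is invertible with positive determinant. Let $\Omega_{\mathrm{IV}}=\{\beta\in\mathbb{R}(n+1,2)\mid I_2-{}^t\beta\beta \text{ is positive definite}\}$, with origin $\mathrm{O}_{\mathrm{IV}}=0_{(n+1)\times 2}$; it is star-shaped about the origin. $\mathrm{O}^{\uparrow}_{+}(2,n+1)$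 acts transitively on $\Omega_{\mathrm{IV}}$ by $L_{\mathbf{X}}(\beta)=(\mathfrak{d}(\mathbf{X})\beta+\mathfrak{c}(\mathbf{X}))(\mathfrak{b}(\mathbf{X})\beta+\mathfrak{a}(\mathbf{X}))^{-1}$, the stabilizer of $\mathrm{O}_{\mathrm{IV}}$ is the group of matrices $\mathbf{S}(\mathrm{r},\mathrm{R})=\begin{pmatrix}\mathrm{r}&0\\0&\mathrm{R}\end{pmatrix}$ with $\mathrm{r}\in\mathrm{SO}(2)$, $\mathrm{R}\in\mathrm{SO}(n+1)$, and the orbit map is $\pi_2^-:\mathrm{O}^{\uparrow}_{+}(2,n+1)\to\Omega_{\mathrm{IV}}$, $\pi_2^-(\mathbf{X})=\mathfrak{c}(\mathbf{X})\mathfrak{a}(\mathbf{X})^{-1}$. For $t\in\mathbb{R}$ put $\rho(t)=\begin{pmatrix}\cos t&-\sin t\\ \sin t&\cos t\end{pmatrix}\in\mathrm{SO}(2)$. Section $\mathrm{P}$. For $\beta=(\mathrm{u}\,\mathrm{v})\in\Omega_{\mathrm{IV}}$ with columns $\mathrm{u}={}^t(u^1,\dots,u^{n+1})$, $\mathrm{v}={}^t(v^1,\dots,v^{n+1})$, let $\mathrm{B}(\beta)$ be the $(n+3)\times(n+3)$ matrix with columns $\mathbf{j}_1(\beta)={}^t(1,0,u^1,\dots,u^{n+1})$, $\mathbf{j}_2(\beta)={}^t(0,1,v^1,\dots,v^{n+1})$, and $\mathrm{B}_j(\beta)={}^t(u^j,v^j,\delta_j^1,\dots,\delta_j^{n+1})$,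 $j=1,\dots,n+1$, where $\delta_j^i$ is the Kronecker symbol. By Gram–Schmidt there is a unique upper triangular matrix $\mathfrak{T}(\beta)$ with positive diagonal entries, depending smoothly on $\beta$, such that $\mathrm{P}(\beta):=\mathrm{B}(\beta)\mathfrak{T}(\beta)\in\mathrm{O}^{\uparrow}_{+}(2,n+1)$. The map $\mathrm{P}$ is a smooth global section of $\pi_2^-$. Let $\widehat{\mathfrak{a}}(\beta)\in\mathrm{GL}_+(2,\mathbb{R})$ be the upper-left $2\times2$ block of $\mathrm{P}(\beta)$. The function $\eta$: for $\beta\in\Omega_{\mathrm{IV}}$, $\mathrm{r}\in\mathrm{SO}(2)$ the matrix $\widehat{\mathfrak{a}}(\beta\mathrm{r}^{-1})^{-1}\,\mathrm{r}\,\widehat{\mathfrak{a}}(\beta)\,\mathrm{r}^{-1}$ lies in $\mathrm{SO}(2)$, and $\eta:\Omega_{\mathrm{IV}}\times\mathrm{SO}(2)\to\mathbb{R}$ is the unique smooth map with $\rho(\eta(\beta,\mathrm{r}))=\widehat{\mathfrak{a}}(\beta\mathrm{r}^{-1})^{-1}\mathrm{r}\,\widehat{\mathfrak{a}}(\beta)\mathrm{r}^{-1}$ and $\eta(\mathrm{O}_{\mathrm{IV}},I_2)=0$. The function $\Theta$: define smooth maps $\mathfrak{m},\mathfrak{r},\mathfrak{R}$ on $\Omega_{\mathrm{IV}}\times\Omega_{\mathrm{IV}}$ with values in $\Omega_{\mathrm{IV}}$, $\mathrm{SO}(2)$, $\mathrm{SO}(n+1)$ by $\mathrm{P}(\beta)\mathrm{P}(\beta')=\mathrm{P}(\mathfrak{m}(\beta,\beta'))\,\mathbf{S}(\mathfrak{r}(\beta,\beta'),\mathfrak{R}(\beta,\beta'))$;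 $\Theta:\Omega_{\mathrm{IV}}\times\Omega_{\mathrm{IV}}\to\mathbb{R}$ is the unique smooth map with $\mathfrak{r}(\beta,\beta')=\rho(\Theta(\beta,\beta'))$ and $\Theta(\mathrm{O}_{\mathrm{IV}},\mathrm{O}_{\mathrm{IV}})=0$. The maps $\psi,\Psi,\zeta$: $\psi:\mathrm{O}^{\uparrow}_{+}(2,n+1)\to\mathrm{SO}(2)$ and $\Psi:\mathrm{O}^{\uparrow}_{+}(2,n+1)\to\mathrm{SO}(n+1)$ are defined by $\mathbf{X}=\mathrm{P}(\pi_2^-(\mathbf{X}))\,\mathbf{S}(\psi(\mathbf{X}),\Psi(\mathbf{X}))$, and $\zeta:\mathrm{O}^{\uparrow}_{+}(2,n+1)\times\mathrm{O}^{\uparrow}_{+}(2,n+1)\to\mathbb{R}$ by $$\zeta(\mathbf{X},\mathbf{X}')=\Theta\big(\pi_2^-(\mathbf{X}),\,\Psi(\mathbf{X})\,\pi_2^-(\mathbf{X}')\,\psi(\mathbf{X})^{-1}\big)+\eta\big(\pi_2^-(\mathbf{X}'),\psi(\mathbf{X})\big).$$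
   Formalization: For odd n the center is proved isomorphic to Z, not to Z_2 x Z as printed, which is false: ((-1)^k I, πk) is the k-th power of (-I, π), so the stated set is an infinite cyclic group with no element of order 2. *)

theory Defs
  imports "HOL-Analysis.Analysis" "HOL-Algebra.Elementary_Groups"
begin

section \<open>Smooth maps, submanifolds and Lie groups in Euclidean spaces\<close>

text \<open>Only meant for open sets \<^term>\<open>U\<close>, where \<open>frechet_derivative f (at x)\<close> is determined by
  the values of \<open>f\<close> on \<^term>\<open>U\<close>.  Quantifying over all directions \<^term>\<open>v\<close> amounts, in finite
  dimension, to asking that all partial derivatives be of class \<open>C\<^sup>k\<close>.\<close>

primrec Ck_on :: "nat \<Rightarrow> ('a::euclidean_space \<Rightarrow> 'b::real_normed_vector) \<Rightarrow> 'a set \<Rightarrow> bool" where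
  "Ck_on 0 f U \<longleftrightarrow> continuous_on U f"
| "Ck_on (Suc k) f U \<longleftrightarrow>
     (\<forall>x\<in>U. f differentiable (at x)) \<and> (\<forall>v. Ck_on k (\<lambda>x. frechet_derivative f (at x) v) U)"

text \<open>Smoothness on an arbitrary subset is local extendability to a smooth map on an open subset
  of the ambient space.  For subsets that are embedded submanifolds this is smoothness in the sense
  of the induced manifold structure.\<close>

definition smooth_on :: "'a::euclidean_space set \<Rightarrow> ('a \<Rightarrow> 'b::real_normed_vector) \<Rightarrow> bool" where
  "smooth_on S f \<longleftrightarrow>
     (\<forall>x\<in>S. \<exists>U g. open U \<and> x \<in> U \<and> (\<forall>k. Ck_on k g U) \<and> (\<forall>y\<in>S \<inter> U. f y = g y))"

definition diffeomorphism ::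
  "'a::euclidean_space set \<Rightarrow> 'b::euclidean_space set \<Rightarrow> ('a \<Rightarrow> 'b) \<Rightarrow> ('b \<Rightarrow> 'a) \<Rightarrow> bool" where
  "diffeomorphism S T f g \<longleftrightarrow>
     smooth_on S f \<and> smooth_on T g \<and> f ` S = T \<and> g ` T = S \<and>
     (\<forall>x\<in>S. g (f x) = x) \<and> (\<forall>y\<in>T. f (g y) = y)"

definition diffeomorphic :: "'a::euclidean_space set \<Rightarrow> 'b::euclidean_space set \<Rightarrow> bool"
    (infix "diffeomorphic" 60) where
  "S diffeomorphic T \<longleftrightarrow> (\<exists>f g. diffeomorphism S T f g)"

text \<open>Charts take values in linear subspaces \<^term>\<open>W\<close> of the ambient space, so that the dimension of
  the manifold need not be reflected in a type.\<close>

definition smooth_manifold :: "'a::euclidean_space set \<Rightarrow> bool" where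
  "smooth_manifold M \<longleftrightarrow>
     (\<exists>k. \<forall>p\<in>M. \<exists>U W V f g.
        p \<in> U \<and> openin (top_of_set M) U \<and>
        subspace (W :: 'a set) \<and> dim W = k \<and> openin (top_of_set W) V \<and>
        diffeomorphism U V f g)"

definition embedded_submanifold :: "'a::euclidean_space set \<Rightarrow> 'a set \<Rightarrow> bool" where
  "embedded_submanifold S M \<longleftrightarrow>
     smooth_manifold M \<and> S \<subseteq> M \<and>
     (\<exists>k. \<forall>p\<in>S. \<exists>U W V L f g.
        p \<in> U \<and> openin (top_of_set M) U \<and>
        subspace (W :: 'a set) \<and> openin (top_of_set W) V \<and>
        diffeomorphism U V f g \<and>
        subspace L \<and> L \<subseteq> W \<and> dim L = k \<and> f ` (S \<inter> U) = L \<inter> V)"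

definition local_diffeomorphism ::
  "'a::euclidean_space set \<Rightarrow> 'b::euclidean_space set \<Rightarrow> ('a \<Rightarrow> 'b) \<Rightarrow> bool" where
  "local_diffeomorphism M N f \<longleftrightarrow>
     (\<forall>p\<in>M. \<exists>U V g. p \<in> U \<and> openin (top_of_set M) U \<and> openin (top_of_set N) V \<and>
        diffeomorphism U V f g)"

definition lie_group :: "'a::euclidean_space monoid \<Rightarrow> bool" where
  "lie_group G \<longleftrightarrow>
     group G \<and> smooth_manifold (carrier G) \<and>
     smooth_on (carrier G \<times> carrier G) (\<lambda>(x, y). x \<otimes>\<^bsub>G\<^esub> y) \<and>
     smooth_on (carrier G) (\<lambda>x. inv\<^bsub>G\<^esub> x)"

definition lie_covering_hom ::
  "'a::euclidean_space monoid \<Rightarrow> 'b::euclidean_space monoid \<Rightarrow> ('a \<Rightarrow> 'b) \<Rightarrow> bool" where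
  "lie_covering_hom G H f \<longleftrightarrow>
     lie_group G \<and> lie_group H \<and> f \<in> hom G H \<and> smooth_on (carrier G) f \<and>
     covering_space (carrier G) f (carrier H) \<and>
     local_diffeomorphism (carrier G) (carrier H) f"

definition group_center :: "('a, 'c) monoid_scheme \<Rightarrow> 'a set" where
  "group_center G = {z \<in> carrier G. \<forall>x\<in>carrier G. z \<otimes>\<^bsub>G\<^esub> x = x \<otimes>\<^bsub>G\<^esub> z}"


section \<open>The pseudo-orthogonal group of signature (2, n+1)\<close>

text \<open>The coordinates \<open>x\<^sup>0, x\<^sup>1\<close> are indexed by the two elements 0 and 1 of the type \<open>2\<close>, the
  remaining ones by a finite linearly ordered type \<open>'m\<close> with \<open>n + 1\<close> elements.  The order on
  \<open>'m\<close> is only used to say what an upper triangular matrix is.  Since \<open>2 = 0\<close> in the type \<open>2\<close>,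
  2-by-2 matrices are described by the indices 0, 1 and not by the library's 1, 2.\<close>

type_synonym 'm pmat = "real^(2 + 'm)^(2 + 'm)"
type_synonym 'm colpair = "((real, 2) vec, 'm) vec"
type_synonym 'm sqmat = "((real, 'm) vec, 'm) vec"

definition block_matrix ::
  "real^2^2 \<Rightarrow> real^'m^2 \<Rightarrow> 'm colpair \<Rightarrow> 'm sqmat \<Rightarrow> 'm::finite pmat" where
  "block_matrix a b c d =
     (\<chi> i j. case i of
        Inl p \<Rightarrow> (case j of Inl q \<Rightarrow> a $ p $ q | Inr q \<Rightarrow> b $ p $ q)
      | Inr p \<Rightarrow> (case j of Inl q \<Rightarrow> c $ p $ q | Inr q \<Rightarrow> d $ p $ q))"

definition block_a :: "'m::finite pmat \<Rightarrow> real^2^2" where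
  "block_a X = (\<chi> p q. X $ Inl p $ Inl q)"

definition block_c :: "'m::finite pmat \<Rightarrow> 'm colpair" where
  "block_c X = (\<chi> p q. X $ Inr p $ Inl q)"

definition scalar_prod :: "real^(2 + 'm::finite) \<Rightarrow> real^(2 + 'm) \<Rightarrow> real" where
  "scalar_prod x y =
     - x $ Inl 0 * y $ Inl 0 - x $ Inl 1 * y $ Inl 1 + (\<Sum>j\<in>UNIV. x $ Inr j * y $ Inr j)"

definition pseudo_orthogonal :: "'m::finite pmat set" where
  "pseudo_orthogonal = {X. \<forall>x y. scalar_prod (X *v x) (X *v y) = scalar_prod x y}"

definition O_up :: "'m::finite pmat set" where
  "O_up = connected_component_set pseudo_orthogonal (mat 1)"

definition O_up_group :: "'m::finite pmat monoid" where
  "O_up_group = \<lparr>carrier = O_up, mult = (**), one = mat 1\<rparr>"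

definition positive_definite :: "real^'k^'k \<Rightarrow> bool" where
  "positive_definite A \<longleftrightarrow> transpose A = A \<and> (\<forall>x. x \<noteq> 0 \<longrightarrow> 0 < x \<bullet> (A *v x))"

definition Omega :: "'m::finite colpair set" where
  "Omega = {\<beta>. positive_definite (mat 1 - transpose \<beta> ** \<beta>)}"

abbreviation SO :: "(real^'k^'k) set" where
  "SO \<equiv> {R. rotation_matrix R}"

definition rho :: "real \<Rightarrow> real^2^2" where
  "rho t = (\<chi> i j. if i = j then cos t else if i = 0 then - sin t else sin t)"

definition S_mat :: "real^2^2 \<Rightarrow> 'm sqmat \<Rightarrow> 'm::finite pmat" where
  "S_mat r R = block_matrix r 0 0 R"

definition pi2 :: "'m::finite pmat \<Rightarrow> 'm colpair" where
  "pi2 X = block_c X ** matrix_inv (block_a X)"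


section \<open>The section P\<close>

text \<open>The columns \<open>(1, 0, u)\<close>, \<open>(0, 1, v)\<close> and \<open>(u\<^sup>j, v\<^sup>j, \<delta>\<^sub>j)\<close> make up the matrix with diagonal blocks
  \<open>1\<close>, lower left block \<open>\<beta> = (u v)\<close> and upper right block the transpose of \<open>\<beta>\<close>.\<close>

definition B_mat :: "'m colpair \<Rightarrow> 'm::finite pmat" where
  "B_mat \<beta> = block_matrix (mat 1) (transpose \<beta>) \<beta> (mat 1)"

fun index_less :: "2 + 'm::linorder \<Rightarrow> 2 + 'm \<Rightarrow> bool" where
  "index_less (Inl p) (Inl q) = (p < q)"
| "index_less (Inl p) (Inr q) = True"
| "index_less (Inr p) (Inl q) = False"
| "index_less (Inr p) (Inr q) = (p < q)"

definition upper_triangular_pos :: "'m::{finite,linorder} pmat \<Rightarrow> bool" where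
  "upper_triangular_pos T \<longleftrightarrow>
     (\<forall>i j. index_less j i \<longrightarrow> T $ i $ j = 0) \<and> (\<forall>i. T $ i $ i > 0)"

definition T_mat :: "'m colpair \<Rightarrow> 'm::{finite,linorder} pmat" where
  "T_mat \<beta> = (THE T. upper_triangular_pos T \<and> B_mat \<beta> ** T \<in> O_up)"

definition P_sec :: "'m colpair \<Rightarrow> 'm::{finite,linorder} pmat" where
  "P_sec \<beta> = B_mat \<beta> ** T_mat \<beta>"

definition a_hat :: "'m::{finite,linorder} colpair \<Rightarrow> real^2^2" where
  "a_hat \<beta> = block_a (P_sec \<beta>)"


section \<open>The functions eta, Theta, psi, Psi, zeta\<close>

text \<open>Uniqueness of a function given on a proper subset of a type requires fixing its values outside
  that subset, which is what \<^term>\<open>extensional\<close> does.\<close>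

definition eta :: "'m::{finite,linorder} colpair \<times> (real^2^2) \<Rightarrow> real" where
  "eta = (THE h. h \<in> extensional (Omega \<times> SO) \<and> smooth_on (Omega \<times> SO) h \<and>
     (\<forall>\<beta>\<in>Omega. \<forall>r\<in>SO. rho (h (\<beta>, r)) =
        matrix_inv (a_hat (\<beta> ** matrix_inv r)) ** r ** a_hat \<beta> ** matrix_inv r) \<and>
     h (0, mat 1) = 0)"

definition mrR ::
  "'m colpair \<Rightarrow> 'm colpair \<Rightarrow> 'm colpair \<times> (real^2^2) \<times> 'm::{finite,linorder} sqmat" where
  "mrR \<beta> \<beta>' = (THE (m, r, R). m \<in> Omega \<and> r \<in> SO \<and> R \<in> SO \<and>
     P_sec \<beta> ** P_sec \<beta>' = P_sec m ** S_mat r R)"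

definition frak_r :: "'m colpair \<Rightarrow> 'm::{finite,linorder} colpair \<Rightarrow> real^2^2" where
  "frak_r \<beta> \<beta>' = fst (snd (mrR \<beta> \<beta>'))"

definition Theta :: "'m colpair \<times> 'm::{finite,linorder} colpair \<Rightarrow> real" where
  "Theta = (THE h. h \<in> extensional (Omega \<times> Omega) \<and> smooth_on (Omega \<times> Omega) h \<and>
     (\<forall>\<beta>\<in>Omega. \<forall>\<beta>'\<in>Omega. frak_r \<beta> \<beta>' = rho (h (\<beta>, \<beta>'))) \<and>
     h (0, 0) = 0)"

definition psi_Psi :: "'m::{finite,linorder} pmat \<Rightarrow> (real^2^2) \<times> 'm sqmat" where
  "psi_Psi X = (THE (r, R). r \<in> SO \<and> R \<in> SO \<and> X = P_sec (pi2 X) ** S_mat r R)"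

definition psi :: "'m::{finite,linorder} pmat \<Rightarrow> real^2^2" where
  "psi X = fst (psi_Psi X)"

definition Psi :: "'m::{finite,linorder} pmat \<Rightarrow> 'm sqmat" where
  "Psi X = snd (psi_Psi X)"

definition zeta :: "'m::{finite,linorder} pmat \<Rightarrow> 'm pmat \<Rightarrow> real" where
  "zeta X X' = Theta (pi2 X, Psi X ** pi2 X' ** matrix_inv (psi X)) + eta (pi2 X', psi X)"


section \<open>The covering group\<close>

definition O_hat :: "('m::{finite,linorder} pmat \<times> real) set" where
  "O_hat = {(X, \<tau>). X \<in> O_up \<and> psi X = rho \<tau>}"

definition star ::
  "'m::{finite,linorder} pmat \<times> real \<Rightarrow> 'm pmat \<times> real \<Rightarrow> 'm pmat \<times> real" where
  "star = (\<lambda>(X, \<tau>) (X', \<tau>'). (X ** X', \<tau> + \<tau>' + zeta X X'))"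

definition O_hat_group :: "('m::{finite,linorder} pmat \<times> real) monoid" where
  "O_hat_group = \<lparr>carrier = O_hat, mult = star, one = (mat 1, 0)\<rparr>"

definition sigma_cov :: "'m::{finite,linorder} pmat \<times> real \<Rightarrow> 'm pmat" where
  "sigma_cov = (\<lambda>(X, \<tau>). X)"

text \<open>The center as a group in its own right.  For odd \<open>n\<close> it consists of the elements
  \<open>((-1)\<^sup>k I, k \<pi>)\<close>.  It contains no element of order two and is generated by \<open>(-I, \<pi>)\<close>, whose square
  is \<open>(I, 2 \<pi>)\<close>; so it is infinite cyclic, and not isomorphic to the product of a group of order two
  with the integers.\<close>

definition Z_hat_group :: "('m::{finite,linorder} pmat \<times> real) monoid" where
  "Z_hat_group = O_hat_group\<lparr>carrier := group_center O_hat_group\<rparr>"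

end

theory Submission
  imports Defs
begin

text \<open>Since the columns of \<open>B(\<beta>)\<close> satisfy \<open>\<langle>j\<^sub>p, B\<^sub>j\<rangle> = 0\<close>, the matrix \<open>T(\<beta>)\<close>
  is block diagonal and consists of the Cholesky factors of \<open>1 - \<beta>\<^sup>t\<beta>\<close> and
  \<open>1 - \<beta>\<beta>\<^sup>t\<close>.  All angles are read off the last row \<open>(x, y)\<close> of the upper left block, viewed as the
  complex number \<open>\<lambda> = y + ix\<close>: upper triangular factors with positive diagonal, on either side, never move
  \<open>\<lambda>\<close> across the opposite ray, so \<open>\<eta>\<close> and \<open>\<Theta>\<close> are principal arguments, and \<open>\<psi>(X) = \<rho>(\<tau>)\<close>
  says that \<open>\<lambda>(X)\<close> is a positive multiple of \<open>e\<^sup>i\<^sup>\<tau>\<close>.  Hence \<open>\<rho>(\<zeta>(X, Y)) = \<psi>(XY) \<psi>(X)\<^sup>-\<^sup>1 \<psi>(Y)\<^sup>-\<^sup>1\<close>,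
  and every identity for \<open>\<zeta>\<close> (the cocycle identity, symmetry in a central argument) holds modulo \<open>2\<pi>\<close>;
  it holds exactly because the group is connected.  Charts are translated Cayley transforms, and
  near a point the covering group is the graph of a branch of the argument of \<open>\<lambda>\<close>.\<close>

section \<open>Smooth maps\<close>

text \<open>\<open>eta\<close> and \<open>Theta\<close> are given as unique smooth lifts through
  \<open>rho\<close>. For each an explicit candidate is exhibited, and uniqueness holds because
  continuous lifts agreeing at one point of a connected set coincide. The last row is the right
  place to look because of \<open>block_a X = chol_a (pi2 X) ** psi X\<close>: the bottom row of the
  left factor is \<open>(0, c)\<close> with c > 0, so \<open>lam X\<close> is c times the unit
  number of \<open>psi X\<close>. For \<open>eta\<close> the triangular factor stands to the right
  of a rotation and can turn the row, but never as far as its opposite; for \<open>Theta\<close> the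
  bound comes from the relation a a^t - b b^t = 1 between the upper blocks of a section value and
  from the second argument being a contraction. Since \<open>O_up\<close> is defined as a connected
  component, membership in it requires a connected set reaching back to a known element. For the
  isotropy matrices \<open>S_mat r R\<close> this is the connectedness of the special orthogonal
  groups, obtained by deforming reflections into each other. The parity of n enters only through -1,
  whose lower block must have determinant 1.\<close>

lemma Ck_on_cong:
  fixes f g :: "'a::euclidean_space \<Rightarrow> 'b::real_normed_vector"
  assumes "open U" "\<And>x. x \<in> U \<Longrightarrow> f x = g x" "Ck_on k f U"
  shows "Ck_on k g U"
  using assms(2,3)
proof (induction k arbitrary: f g)
  case 0
  then show ?case by (simp cong: continuous_on_cong)
next
  case (Suc k)
  have d: "(g has_derivative frechet_derivative f (at x)) (at x)" if "x \<in> U" for x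
    using Suc.prems that assms(1)
    by (intro has_derivative_transform_within_open[of f _ x UNIV U g])
       (auto simp: frechet_derivative_works[symmetric])
  then have e: "frechet_derivative g (at x) = frechet_derivative f (at x)" if "x \<in> U" for x
    using frechet_derivative_at that by metis
  show ?case
    using Suc.prems d Suc.IH[of "\<lambda>x. frechet_derivative f (at x) _" "\<lambda>x. frechet_derivative g (at x) _"] e
    by (auto simp: differentiable_def)
qed

text \<open>Derivatives are unique, so any family \<open>D\<close> of derivatives may stand in for
  \<open>frechet_derivative\<close>. The inductions on the order below exhibit a \<open>D\<close>
  built from data of lower order.\<close>

lemma Ck_on_SucI:
  fixes f :: "'a::euclidean_space \<Rightarrow> 'b::real_normed_vector"
  assumes "open U" "\<And>x. x \<in> U \<Longrightarrow> (f has_derivative D x) (at x)"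
    and "\<And>v. Ck_on k (\<lambda>x. D x v) U"
  shows "Ck_on (Suc k) f U"
proof -
  have e: "D x = frechet_derivative f (at x)" if "x \<in> U" for x
    using assms(2)[OF that] frechet_derivative_at by blast
  have "Ck_on k (\<lambda>x. frechet_derivative f (at x) v) U" for v
    by (rule Ck_on_cong[OF assms(1) _ assms(3)[of v]]) (simp add: e)
  then show ?thesis using assms(2) by (auto simp: differentiable_def)
qed

lemma Ck_on_SucD:
  assumes "Ck_on (Suc k) f U"
  shows "Ck_on k f U"
  using assms
proof (induction k arbitrary: f)
  case 0
  then show ?case
    by (auto intro!: differentiable_imp_continuous_on differentiable_at_imp_differentiable_on)
next
  case (Suc k)
  then show ?case by (metis Ck_on.simps(2))
qed

lemma Ck_on_continuous: "Ck_on k f U \<Longrightarrow> continuous_on U f"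
  by (induction k) (auto simp del: Ck_on.simps(2) dest: Ck_on_SucD)

lemma Ck_on_subset: "Ck_on k f U \<Longrightarrow> V \<subseteq> U \<Longrightarrow> Ck_on k f V"
  by (induction k arbitrary: f) (auto intro: continuous_on_subset)

lemma Ck_on_const:
  fixes c :: "'b::real_normed_vector"
  assumes "open U"
  shows "Ck_on k (\<lambda>x. c) U"
proof (induction k arbitrary: c)
  case (Suc k)
  show ?case by (rule Ck_on_SucI[OF assms, where D = "\<lambda>x v. 0"]) (auto intro: Suc)
qed simp

lemma Ck_on_bounded_linear:
  fixes f :: "'a::euclidean_space \<Rightarrow> 'b::real_normed_vector"
  assumes "open U" "bounded_linear f"
  shows "Ck_on k f U"
proof (cases k)
  case 0
  then show ?thesis using assms by (simp add: linear_continuous_on)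
next
  case (Suc j)
  show ?thesis unfolding Suc
    by (rule Ck_on_SucI[OF assms(1), where D = "\<lambda>x. f"])
       (auto intro: Ck_on_const assms bounded_linear_imp_has_derivative)
qed

lemma Ck_on_linear_compose:
  fixes f :: "'a::euclidean_space \<Rightarrow> 'b::real_normed_vector"
  assumes "open U" "bounded_linear h" "Ck_on k f U"
  shows "Ck_on k (\<lambda>x. h (f x)) U"
  using assms(3)
proof (induction k arbitrary: f)
  case 0
  then show ?case using assms(2) by (auto intro: bounded_linear.continuous_on)
next
  case (Suc k)
  show ?case
  proof (rule Ck_on_SucI[OF assms(1)])
    show "((\<lambda>x. h (f x)) has_derivative (\<lambda>v. h (frechet_derivative f (at x) v))) (at x)" if "x \<in> U" for x
      using Suc.prems that by (auto intro!: bounded_linear.has_derivative[OF assms(2)]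
        simp: frechet_derivative_works[symmetric])
  qed (use Suc in auto)
qed

lemma Ck_on_add:
  fixes f :: "'a::euclidean_space \<Rightarrow> 'b::real_normed_vector"
  assumes "open U" "Ck_on k f U" "Ck_on k g U"
  shows "Ck_on k (\<lambda>x. f x + g x) U"
  using assms(2,3)
proof (induction k arbitrary: f g)
  case 0
  then show ?case by (auto intro: continuous_on_add)
next
  case (Suc k)
  show ?case
  proof (rule Ck_on_SucI[OF assms(1)])
    show "((\<lambda>x. f x + g x) has_derivative
        (\<lambda>v. frechet_derivative f (at x) v + frechet_derivative g (at x) v)) (at x)" if "x \<in> U" for x
      using Suc.prems that by (auto intro!: has_derivative_add
        simp: frechet_derivative_works[symmetric])
  qed (use Suc in auto)
qed

lemma Ck_on_sum:
  fixes f :: "'i \<Rightarrow> 'a::euclidean_space \<Rightarrow> 'b::real_normed_vector"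
  assumes "open U" "\<And>i. i \<in> I \<Longrightarrow> Ck_on k (f i) U"
  shows "Ck_on k (\<lambda>x. \<Sum>i\<in>I. f i x) U"
  using assms(2) by (induction I rule: infinite_finite_induct)
    (auto intro: Ck_on_const Ck_on_add assms(1))

lemma Ck_on_bilinear:
  fixes f :: "'a::euclidean_space \<Rightarrow> 'b::real_normed_vector"
    and g :: "'a \<Rightarrow> 'c::real_normed_vector"
  assumes "open U" "bounded_bilinear p" "Ck_on k f U" "Ck_on k g U"
  shows "Ck_on k (\<lambda>x. p (f x) (g x)) U"
  using assms(3,4)
proof (induction k arbitrary: f g)
  case 0
  then show ?case using assms(2) by (auto intro: bounded_bilinear.continuous_on)
next
  case (Suc k)
  show ?case
  proof (rule Ck_on_SucI[OF assms(1)])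
    show "((\<lambda>x. p (f x) (g x)) has_derivative
        (\<lambda>v. p (f x) (frechet_derivative g (at x) v) + p (frechet_derivative f (at x) v) (g x))) (at x)"
      if "x \<in> U" for x
      using Suc.prems that by (auto intro!: bounded_bilinear.FDERIV[OF assms(2)]
        simp: frechet_derivative_works[symmetric])
    show "Ck_on k (\<lambda>x. p (f x) (frechet_derivative g (at x) v) + p (frechet_derivative f (at x) v) (g x)) U" for v
      using Suc.prems Ck_on_SucD[OF Suc.prems(1)] Ck_on_SucD[OF Suc.prems(2)]
      by (intro Ck_on_add assms(1) Suc.IH) auto
  qed
qed

lemma Ck_on_compose:
  fixes f :: "'a::euclidean_space \<Rightarrow> 'b::euclidean_space" and g :: "'b \<Rightarrow> 'c::real_normed_vector"
  assumes "open U" "open V" "f ` U \<subseteq> V" "Ck_on k f U" "Ck_on k g V"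
  shows "Ck_on k (\<lambda>x. g (f x)) U"
  using assms(4,5)
proof (induction k arbitrary: g)
  case 0
  then show ?case using assms(3) by (auto intro: continuous_on_compose2)
next
  case (Suc k)
  let ?f = "\<lambda>x. frechet_derivative f (at x)" and ?g = "\<lambda>y. frechet_derivative g (at y)"
  have fd: "(f has_derivative ?f x) (at x)" if "x \<in> U" for x
    using Suc.prems that by (auto simp: frechet_derivative_works[symmetric])
  have gd: "(g has_derivative ?g (f x)) (at (f x))" if "x \<in> U" for x
    using Suc.prems that assms(3) by (auto simp: frechet_derivative_works[symmetric])
  show ?case
  proof (rule Ck_on_SucI[OF assms(1)])
    fix x assume x: "x \<in> U"
    have "((\<lambda>x. g (f x)) has_derivative (\<lambda>v. ?g (f x) (?f x v))) (at x)"
      using diff_chain_at[OF fd gd, OF x x] by (simp add: o_def)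
    \<comment> \<open>In the chain rule both the base point and the direction depend on
      \<open>x\<close>, whereas the induction hypothesis speaks of a fixed direction. Expanding in
      the basis leaves fixed directions \<open>b\<close> with scalar coefficients.\<close>
    moreover have "?g (f x) (?f x v) = (\<Sum>b\<in>Basis. (?f x v \<bullet> b) *\<^sub>R ?g (f x) b)" for v
    proof -
      have l: "linear (?g (f x))" using gd[OF x] by (rule has_derivative_linear)
      have "?g (f x) (?f x v) = ?g (f x) (\<Sum>b\<in>Basis. (?f x v \<bullet> b) *\<^sub>R b)"
        by (simp add: euclidean_representation)
      also have "\<dots> = (\<Sum>b\<in>Basis. (?f x v \<bullet> b) *\<^sub>R ?g (f x) b)"
        by (simp add: linear_sum[OF l] linear_scale[OF l])
      finally show ?thesis .
    qed
    then have "(\<lambda>v. ?g (f x) (?f x v)) = (\<lambda>v. \<Sum>b\<in>Basis. (?f x v \<bullet> b) *\<^sub>R ?g (f x) b)"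
      by (rule ext)
    ultimately show "((\<lambda>x. g (f x)) has_derivative
        (\<lambda>v. \<Sum>b\<in>Basis. (?f x v \<bullet> b) *\<^sub>R ?g (f x) b)) (at x)" by (rule subst[rotated])
  next
    fix v
    have "Ck_on k (\<lambda>x. ?f x v \<bullet> b) U" for b
      using Suc.prems by (intro Ck_on_linear_compose[OF assms(1) bounded_linear_inner_left]) auto
    moreover have "Ck_on k (\<lambda>x. ?g (f x) b) U" for b
      using Suc.prems Ck_on_SucD[OF Suc.prems(1)] by (intro Suc.IH) auto
    ultimately show "Ck_on k (\<lambda>x. \<Sum>b\<in>Basis. (?f x v \<bullet> b) *\<^sub>R ?g (f x) b) U"
      by (rule Ck_on_sum[OF assms(1) Ck_on_bilinear[OF assms(1) bounded_bilinear_scaleR]])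
  qed
qed

section \<open>Smoothness on arbitrary subsets by local extension\<close>

lemma smooth_onI_open: "open U \<Longrightarrow> (\<And>k. Ck_on k f U) \<Longrightarrow> smooth_on U f"
  unfolding smooth_on_def by blast

lemma smooth_onE:
  assumes "smooth_on S f" "x \<in> S"
  obtains U g where "open U" "x \<in> U" "\<And>k. Ck_on k g U" "\<And>y. y \<in> S \<Longrightarrow> y \<in> U \<Longrightarrow> f y = g y"
proof -
  from assms obtain U g where "open U \<and> x \<in> U \<and> (\<forall>k. Ck_on k g U) \<and> (\<forall>y\<in>S \<inter> U. f y = g y)"
    unfolding smooth_on_def by blast
  then show thesis by (intro that[of U g]) auto
qed

lemma smooth_onI:
  assumes "\<And>x. x \<in> S \<Longrightarrow> \<exists>U g. open U \<and> x \<in> U \<and> (\<forall>k. Ck_on k g U) \<and> (\<forall>y\<in>S \<inter> U. f y = g y)"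
  shows "smooth_on S f"
  unfolding smooth_on_def using assms by (rule ballI)

lemma smooth_on_subset:
  assumes "smooth_on T f" "S \<subseteq> T"
  shows "smooth_on S f"
proof (rule smooth_onI)
  fix x assume "x \<in> S"
  then obtain U g where "open U" "x \<in> U" "\<And>k. Ck_on k g U" "\<And>y. y \<in> T \<Longrightarrow> y \<in> U \<Longrightarrow> f y = g y"
    using assms smooth_onE[of T f x] by blast
  then show "\<exists>U g. open U \<and> x \<in> U \<and> (\<forall>k. Ck_on k g U) \<and> (\<forall>y\<in>S \<inter> U. f y = g y)"
    using assms(2) by (intro exI[of _ U] exI[of _ g]) auto
qed

lemma smooth_on_cong:
  assumes "smooth_on S f" "\<And>x. x \<in> S \<Longrightarrow> f x = g x"
  shows "smooth_on S g"
proof (rule smooth_onI)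
  fix x assume "x \<in> S"
  then obtain U h where "open U" "x \<in> U" "\<And>k. Ck_on k h U" "\<And>y. y \<in> S \<Longrightarrow> y \<in> U \<Longrightarrow> f y = h y"
    using assms(1) smooth_onE[of S f x] by blast
  then show "\<exists>U h. open U \<and> x \<in> U \<and> (\<forall>k. Ck_on k h U) \<and> (\<forall>y\<in>S \<inter> U. g y = h y)"
    using assms(2) by (intro exI[of _ U] exI[of _ h]) auto
qed

lemma smooth_on_imp_continuous_on:
  assumes "smooth_on S f"
  shows "continuous_on S f"
  unfolding continuous_on_eq_continuous_within
proof
  fix x assume x: "x \<in> S"
  then obtain U g where U: "open U" "x \<in> U" "\<forall>k. Ck_on k g U" "\<forall>y\<in>S \<inter> U. f y = g y"
    using assms unfolding smooth_on_def by blast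
  then have "continuous_on (S \<inter> U) g"
    using Ck_on_continuous continuous_on_subset by (metis inf_le2)
  moreover have "continuous_on (S \<inter> U) f \<longleftrightarrow> continuous_on (S \<inter> U) g"
    using U by (intro continuous_on_cong) auto
  ultimately have "continuous (at x within S \<inter> U) f"
    using x U by (simp add: continuous_on_eq_continuous_within)
  moreover have "at x within S \<inter> U = at x within S"
    using U by (intro at_within_nhd[of x U]) auto
  ultimately show "continuous (at x within S) f" by simp
qed

lemma smooth_on_const [intro]: "smooth_on S (\<lambda>x. c)"
  by (rule smooth_on_subset[OF smooth_onI_open[OF open_UNIV]]) (auto intro: Ck_on_const)

lemma smooth_on_bounded_linear: "bounded_linear f \<Longrightarrow> smooth_on S f"
  by (rule smooth_on_subset[OF smooth_onI_open[OF open_UNIV]]) (auto intro: Ck_on_bounded_linear)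

lemma smooth_on_compose:
  fixes f :: "'a::euclidean_space \<Rightarrow> 'b::euclidean_space" and g :: "'b \<Rightarrow> 'c::real_normed_vector"
  assumes g: "smooth_on T g" and f: "smooth_on S f" and "\<And>x. x \<in> S \<Longrightarrow> f x \<in> T"
  shows "smooth_on S (\<lambda>x. g (f x))"
  unfolding smooth_on_def
proof
  fix x assume x: "x \<in> S"
  obtain U f' where U: "open U" "x \<in> U" "\<forall>k. Ck_on k f' U" "\<forall>y\<in>S \<inter> U. f y = f' y"
    using f x unfolding smooth_on_def by blast
  obtain V g' where V: "open V" "f x \<in> V" "\<forall>k. Ck_on k g' V" "\<forall>y\<in>T \<inter> V. g y = g' y"
    using g assms(3)[OF x] unfolding smooth_on_def by blast
  \<comment> \<open>Off \<open>S\<close> the extension \<open>f'\<close> may leave the domain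
    \<open>V\<close> of the extension of \<open>g\<close>, so its own domain is cut down to a
    preimage.\<close>
  let ?W = "U \<inter> f' -` V"
  have o: "open ?W" using U V Ck_on_continuous continuous_on_open_vimage by (metis inf_commute)
  show "\<exists>U g'. open U \<and> x \<in> U \<and> (\<forall>k. Ck_on k g' U) \<and> (\<forall>y\<in>S \<inter> U. g (f y) = g' y)"
  proof (intro exI[of _ ?W] exI[of _ "\<lambda>x. g' (f' x)"] conjI allI)
    show "Ck_on k (\<lambda>x. g' (f' x)) ?W" for k
      by (rule Ck_on_compose[OF o V(1) _ Ck_on_subset[OF U(3)[rule_format]] V(3)[rule_format]]) auto
    show "\<forall>y\<in>S \<inter> ?W. g (f y) = g' (f' y)"
      using U V assms(3) by (metis IntE IntI vimageE)
  qed (use o x U V in auto)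
qed

lemma smooth_on_linear_compose:
  fixes f :: "'a::euclidean_space \<Rightarrow> 'b::real_normed_vector"
  assumes "bounded_linear h" "smooth_on S f"
  shows "smooth_on S (\<lambda>x. h (f x))"
  unfolding smooth_on_def
proof
  fix x assume "x \<in> S"
  then obtain U g where U: "open U" "x \<in> U" "\<forall>k. Ck_on k g U" "\<forall>y\<in>S \<inter> U. f y = g y"
    using assms(2) unfolding smooth_on_def by blast
  then show "\<exists>U g. open U \<and> x \<in> U \<and> (\<forall>k. Ck_on k g U) \<and> (\<forall>y\<in>S \<inter> U. h (f y) = g y)"
    by (intro exI[of _ U] exI[of _ "\<lambda>x. h (g x)"]) (auto intro: Ck_on_linear_compose assms(1))
qed

lemma smooth_on_bilinear:
  fixes f :: "'a::euclidean_space \<Rightarrow> 'b::real_normed_vector"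
    and g :: "'a \<Rightarrow> 'c::real_normed_vector"
  assumes p: "bounded_bilinear p" and f: "smooth_on S f" and g: "smooth_on S g"
  shows "smooth_on S (\<lambda>x. p (f x) (g x))"
  unfolding smooth_on_def
proof
  fix x assume x: "x \<in> S"
  obtain U f' where U: "open U" "x \<in> U" "\<forall>k. Ck_on k f' U" "\<forall>y\<in>S \<inter> U. f y = f' y"
    using f x unfolding smooth_on_def by blast
  obtain V g' where V: "open V" "x \<in> V" "\<forall>k. Ck_on k g' V" "\<forall>y\<in>S \<inter> V. g y = g' y"
    using g x unfolding smooth_on_def by blast
  have "Ck_on k (\<lambda>x. p (f' x) (g' x)) (U \<inter> V)" for k
    using U V by (intro Ck_on_bilinear[OF _ p] Ck_on_subset[OF U(3)[rule_format]]
      Ck_on_subset[OF V(3)[rule_format]]) auto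
  then show "\<exists>U g'. open U \<and> x \<in> U \<and> (\<forall>k. Ck_on k g' U) \<and> (\<forall>y\<in>S \<inter> U. p (f y) (g y) = g' y)"
    using U V by (intro exI[of _ "U \<inter> V"] exI[of _ "\<lambda>x. p (f' x) (g' x)"]) auto
qed

lemma smooth_on_add:
  fixes f :: "'a::euclidean_space \<Rightarrow> 'b::real_normed_vector"
  assumes f: "smooth_on S f" and g: "smooth_on S g"
  shows "smooth_on S (\<lambda>x. f x + g x)"
proof (rule smooth_onI)
  fix x assume x: "x \<in> S"
  obtain U f' where U: "open U" "x \<in> U" "\<And>k. Ck_on k f' U" "\<And>y. y \<in> S \<Longrightarrow> y \<in> U \<Longrightarrow> f y = f' y"
    using smooth_onE[OF f x] by blast
  obtain V g' where V: "open V" "x \<in> V" "\<And>k. Ck_on k g' V" "\<And>y. y \<in> S \<Longrightarrow> y \<in> V \<Longrightarrow> g y = g' y"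
    using smooth_onE[OF g x] by blast
  have "Ck_on k (\<lambda>x. f' x + g' x) (U \<inter> V)" for k
    using U V by (intro Ck_on_add Ck_on_subset[OF U(3)] Ck_on_subset[OF V(3)]) auto
  then show "\<exists>U h. open U \<and> x \<in> U \<and> (\<forall>k. Ck_on k h U) \<and> (\<forall>y\<in>S \<inter> U. f y + g y = h y)"
    using U V by (intro exI[of _ "U \<inter> V"] exI[of _ "\<lambda>x. f' x + g' x"]) auto
qed

text \<open>A pair is the sum of the two linear inclusions of its components.\<close>

lemma smooth_on_Pair:
  fixes f :: "'a::euclidean_space \<Rightarrow> 'b::real_normed_vector"
    and g :: "'a \<Rightarrow> 'c::real_normed_vector"
  assumes "smooth_on S f" "smooth_on S g"
  shows "smooth_on S (\<lambda>x. (f x, g x))"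
proof -
  have l: "bounded_linear (\<lambda>y::'b. (y, 0::'c))" "bounded_linear (\<lambda>y::'c. (0::'b, y))"
    by (auto intro: bounded_linear_Pair bounded_linear_ident bounded_linear_zero)
  from smooth_on_add[OF smooth_on_linear_compose[OF l(1) assms(1)] smooth_on_linear_compose[OF l(2) assms(2)]]
  show ?thesis by simp
qed

lemma smooth_on_minus:
  fixes f :: "'a::euclidean_space \<Rightarrow> 'b::real_normed_vector"
  assumes "smooth_on S f"
  shows "smooth_on S (\<lambda>x. - f x)"
  by (rule smooth_on_linear_compose[OF _ assms]) (simp add: bounded_linear_minus bounded_linear_ident)

lemma smooth_on_diff:
  fixes f :: "'a::euclidean_space \<Rightarrow> 'b::real_normed_vector"
  assumes "smooth_on S f" "smooth_on S g"
  shows "smooth_on S (\<lambda>x. f x - g x)"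
  using smooth_on_add[OF assms(1) smooth_on_minus[OF assms(2)]] by simp

lemma smooth_on_sum:
  fixes f :: "'i \<Rightarrow> 'a::euclidean_space \<Rightarrow> 'b::real_normed_vector"
  assumes "\<And>i. i \<in> I \<Longrightarrow> smooth_on S (f i)"
  shows "smooth_on S (\<lambda>x. \<Sum>i\<in>I. f i x)"
  using assms by (induction I rule: infinite_finite_induct) (auto intro: smooth_on_add)

lemma smooth_on_mult:
  fixes f :: "'a::euclidean_space \<Rightarrow> 'b::real_normed_algebra"
  shows "smooth_on S f \<Longrightarrow> smooth_on S g \<Longrightarrow> smooth_on S (\<lambda>x. f x * g x)"
  by (rule smooth_on_bilinear[OF bounded_bilinear_mult])

lemma smooth_on_prod:
  fixes f :: "'i \<Rightarrow> 'a::euclidean_space \<Rightarrow> real"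
  assumes "\<And>i. i \<in> I \<Longrightarrow> smooth_on S (f i)"
  shows "smooth_on S (\<lambda>x. \<Prod>i\<in>I. f i x)"
  using assms by (induction I rule: infinite_finite_induct) (auto intro: smooth_on_mult)

lemma smooth_on_vec:
  fixes f :: "'i::finite \<Rightarrow> 'a::euclidean_space \<Rightarrow> 'b::euclidean_space"
  assumes "\<And>i. smooth_on S (f i)"
  shows "smooth_on S (\<lambda>x. \<chi> i. f i x)"
proof -
  have "bounded_linear (\<lambda>y::'b. axis i y)" for i :: 'i
    by (intro linear_conv_bounded_linear[THEN iffD1] linearI) (auto simp: axis_def vec_eq_iff)
  then have "smooth_on S (\<lambda>x. \<Sum>i\<in>UNIV. axis i (f i x))"
    using assms by (intro smooth_on_sum smooth_on_linear_compose[of "axis _"]) auto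
  moreover have "(\<Sum>i\<in>UNIV. axis i (f i x)) = (\<chi> i. f i x)" for x
    by (simp add: vec_eq_iff axis_def if_distrib[of "\<lambda>z. z $ _"] sum.delta' cong: if_cong)
  ultimately show ?thesis by simp
qed

lemma smooth_on_vec_nth:
  fixes f :: "'a::euclidean_space \<Rightarrow> 'b::real_normed_vector ^ 'i"
  shows "smooth_on S f \<Longrightarrow> smooth_on S (\<lambda>x. f x $ i)"
  by (rule smooth_on_linear_compose[OF bounded_linear_vec_nth])

lemma smooth_on_fst: "smooth_on S f \<Longrightarrow> smooth_on S (\<lambda>x. fst (f x))"
  by (rule smooth_on_linear_compose[OF bounded_linear_fst])

lemma smooth_on_snd: "smooth_on S f \<Longrightarrow> smooth_on S (\<lambda>x. snd (f x))"
  by (rule smooth_on_linear_compose[OF bounded_linear_snd])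

lemma smooth_on_id: "smooth_on S (\<lambda>x. x)"
  by (rule smooth_on_bounded_linear[OF bounded_linear_ident])

text \<open>The derivative -x^-1 h x^-1 is again a product of inverses, so the order rises by the
  product rule.\<close>

lemma Ck_on_inverse:
  "Ck_on k (inverse :: 'a::{euclidean_space,real_normed_field} \<Rightarrow> 'a) (- {0})"
proof (induction k)
  case 0
  show ?case by (auto intro!: continuous_intros)
next
  case (Suc k)
  have "Ck_on k (\<lambda>x::'a. - (inverse x * v * inverse x)) (- {0})" for v
    using Suc by (intro Ck_on_linear_compose[OF _ bounded_linear_minus[OF bounded_linear_ident]]
      Ck_on_bilinear[OF _ bounded_bilinear_mult] Ck_on_const) auto
  then show ?case
    by (intro Ck_on_SucI[where D = "\<lambda>x h. - (inverse x * h * inverse x)"])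
       (auto intro: has_derivative_inverse')
qed

lemma smooth_on_inverse:
  "smooth_on (- {0}) (inverse :: 'a::{euclidean_space,real_normed_field} \<Rightarrow> 'a)"
  by (rule smooth_onI_open) (auto intro: Ck_on_inverse)

lemma smooth_on_divide:
  fixes f :: "'a::euclidean_space \<Rightarrow> 'b::{euclidean_space,real_normed_field}"
  assumes "smooth_on S f" "smooth_on S g" "\<And>x. x \<in> S \<Longrightarrow> g x \<noteq> 0"
  shows "smooth_on S (\<lambda>x. f x / g x)"
  unfolding divide_inverse
  by (rule smooth_on_mult[OF assms(1) smooth_on_compose[OF smooth_on_inverse assms(2)]])
     (use assms(3) in auto)

text \<open>The derivative is expressed by the inverse of \<open>sqrt\<close> itself, so the
  induction on the order closes up through composition with the smooth map
  \<open>inverse\<close>.\<close>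

lemma smooth_on_sqrt: "smooth_on {0<..} sqrt"
proof (rule smooth_onI_open)
  fix k show "Ck_on k sqrt {0<..}"
  proof (induction k)
    case 0
    show ?case by (auto intro!: continuous_intros)
  next
    case (Suc k)
    have i: "Ck_on k (inverse::real \<Rightarrow> real) {0<..}"
      by (rule Ck_on_subset[OF Ck_on_inverse]) auto
    have "Ck_on k (\<lambda>x. inverse (sqrt x) * (v / 2)) {0<..}" for v
      by (rule Ck_on_bilinear[OF _ bounded_bilinear_mult
            Ck_on_compose[OF _ _ _ Suc i] Ck_on_const]) auto
    moreover have "(sqrt has_derivative (\<lambda>v. inverse (sqrt x) * (v / 2))) (at x)" if "x > 0" for x
      using DERIV_real_sqrt[OF that] unfolding has_field_derivative_def
      by (rule has_derivative_eq_rhs) (simp add: fun_eq_iff field_simps)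
    ultimately show ?case
      by (intro Ck_on_SucI[where D = "\<lambda>x v. inverse (sqrt x) * (v / 2)"]) auto
  qed
qed auto

lemma smooth_on_Ln: "smooth_on (- \<real>\<^sub>\<le>\<^sub>0) Ln"
proof (rule smooth_onI_open)
  show o: "open (- \<real>\<^sub>\<le>\<^sub>0 :: complex set)"
    using closed_nonpos_Reals_complex by (rule open_Compl)
  fix k show "Ck_on k Ln (- \<real>\<^sub>\<le>\<^sub>0)"
  proof (cases k)
    case 0
    show ?thesis unfolding 0 Ck_on.simps by (rule continuous_on_Ln) auto
  next
    case (Suc j)
    have i: "Ck_on j (inverse::complex \<Rightarrow> complex) (- \<real>\<^sub>\<le>\<^sub>0)"
      by (rule Ck_on_subset[OF Ck_on_inverse]) auto
    have "Ck_on j (\<lambda>x. inverse x * v) (- \<real>\<^sub>\<le>\<^sub>0)" for v :: complex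
      by (rule Ck_on_bilinear[OF o bounded_bilinear_mult i Ck_on_const[OF o]])
    moreover have "(Ln has_derivative (*) (inverse x)) (at x)" if "x \<in> - \<real>\<^sub>\<le>\<^sub>0" for x
      using has_field_derivative_Ln[of x] that unfolding has_field_derivative_def by blast
    ultimately show ?thesis unfolding Suc
      by (intro Ck_on_SucI[OF o, where D = "\<lambda>x v. inverse x * v"])
  qed
qed

section \<open>Smoothness of matrix operations\<close>

lemma bounded_bilinear_matrix_mult:
  "bounded_bilinear (\<lambda>(A::real^'n^'m) (B::real^'p^'n). A ** B)"
  unfolding bilinear_conv_bounded_bilinear[symmetric] bilinear_def
  by (intro conjI allI linearI)
     (simp_all add: matrix_matrix_mult_def vec_eq_iff sum.distrib distrib_left distrib_right
        sum_distrib_left mult_ac)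

lemma bounded_linear_transpose: "bounded_linear (transpose :: real^'n^'m \<Rightarrow> real^'m^'n)"
  by (intro linear_conv_bounded_linear[THEN iffD1] linearI) (auto simp: transpose_def vec_eq_iff)

lemma smooth_on_matrix_mult:
  fixes f :: "'a::euclidean_space \<Rightarrow> real^'n^'m" and g :: "'a \<Rightarrow> real^'p^'n"
  shows "smooth_on S f \<Longrightarrow> smooth_on S g \<Longrightarrow> smooth_on S (\<lambda>x. f x ** g x)"
  by (rule smooth_on_bilinear[OF bounded_bilinear_matrix_mult])

lemma smooth_on_transpose:
  fixes f :: "'a::euclidean_space \<Rightarrow> real^'n^'m"
  shows "smooth_on S f \<Longrightarrow> smooth_on S (\<lambda>x. transpose (f x))"
  by (rule smooth_on_linear_compose[OF bounded_linear_transpose])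

lemma smooth_on_det:
  fixes f :: "'a::euclidean_space \<Rightarrow> real^'n^'n"
  assumes "smooth_on S f"
  shows "smooth_on S (\<lambda>x. det (f x))"
  unfolding det_def
  by (intro smooth_on_sum smooth_on_mult smooth_on_const smooth_on_prod smooth_on_vec_nth assms)

lemma
  fixes A :: "real^'n^'n"
  assumes "det A \<noteq> 0"
  shows matrix_inv_right: "A ** matrix_inv A = mat 1"
    and matrix_inv_left: "matrix_inv A ** A = mat 1"
proof -
  have "\<exists>A'. A ** A' = mat 1 \<and> A' ** A = mat 1"
    using assms by (simp add: invertible_det_nz[symmetric] invertible_def)
  then have "A ** matrix_inv A = mat 1 \<and> matrix_inv A ** A = mat 1"
    unfolding matrix_inv_def by (rule someI_ex)
  then show "A ** matrix_inv A = mat 1" "matrix_inv A ** A = mat 1" by auto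
qed

lemma matrix_inv_unique:
  fixes A B :: "real^'n^'n"
  assumes "A ** B = mat 1"
  shows "matrix_inv A = B"
proof -
  have "det A * det B = 1" using assms by (metis det_I det_mul)
  then have "matrix_inv A ** A = mat 1" by (intro matrix_inv_left) auto
  then show ?thesis by (metis assms matrix_mul_assoc matrix_mul_lid matrix_mul_rid)
qed

text \<open>Cramer's rule with the standard basis vectors as right-hand sides. As quotients of
  determinants the entries are visibly smooth in \<open>A\<close>.\<close>

lemma matrix_inv_nth:
  fixes A :: "real^'n^'n"
  assumes "det A \<noteq> 0"
  shows "matrix_inv A $ i $ j = det (\<chi> p q. if q = i then (if p = j then 1 else 0) else A $ p $ q) / det A"
proof -
  have "A *v column j (matrix_inv A) = axis j 1"
  proof -
    have "A ** matrix_inv A = mat 1"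
      using assms by (rule matrix_inv_right)
    then show ?thesis
      by (metis matrix_vector_mul_assoc matrix_vector_mult_basis matrix_vector_mul_lid)
  qed
  then have "column j (matrix_inv A) =
      (\<chi> k. det (\<chi> p q. if q = k then axis j 1 $ p else A $ p $ q) / det A)"
    using cramer[OF assms] by blast
  then have "column j (matrix_inv A) $ i = det (\<chi> p q. if q = i then axis j 1 $ p else A $ p $ q) / det A"
    by simp
  then show ?thesis by (simp add: column_def axis_def cong: if_cong)
qed

lemma smooth_on_matrix_inv:
  fixes f :: "'a::euclidean_space \<Rightarrow> real^'n^'n"
  assumes "smooth_on S f" "\<And>x. x \<in> S \<Longrightarrow> det (f x) \<noteq> 0"
  shows "smooth_on S (\<lambda>x. matrix_inv (f x))"
proof -
  have "smooth_on S (\<lambda>x. if q = i then c else f x $ p $ q)" for p q i c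
    using assms(1) by (cases "q = i") (auto intro: smooth_on_vec_nth)
  then have "smooth_on S (\<lambda>x. \<chi> i j. det (\<chi> p q. if q = i then (if p = j then 1 else 0) else f x $ p $ q) / det (f x))"
    using assms by (intro smooth_on_vec smooth_on_divide smooth_on_det) auto
  then show ?thesis
    by (rule smooth_on_cong) (simp add: vec_eq_iff matrix_inv_nth assms(2))
qed

section \<open>The pseudo-orthogonal group in block form\<close>

lemma UNIV_two: "(UNIV :: 2 set) = {0, 1}"
  using UNIV_2 by force

lemma sum_two: "(\<Sum>i\<in>(UNIV::2 set). f i) = f 0 + (f 1 :: 'a::comm_monoid_add)"
  by (simp add: UNIV_two)

lemma two_cases: "(i :: 2) = 0 \<or> i = 1"
  using UNIV_I[of i] unfolding UNIV_two by simp

lemma forall_two: "(\<forall>i::2. P i) \<longleftrightarrow> P 0 \<and> P 1"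
  by (metis two_cases)

lemma sum_UNIV_sum:
  "(\<Sum>i\<in>(UNIV::('a::finite + 'b::finite) set). f i) =
    (\<Sum>i\<in>UNIV. f (Inl i)) + ((\<Sum>i\<in>UNIV. f (Inr i)) :: 'c::comm_monoid_add)"
  by (simp only: UNIV_Plus_UNIV[symmetric] sum.Plus finite o_def)

lemma forall_sum: "(\<forall>i::'a + 'b. P i) \<longleftrightarrow> (\<forall>i. P (Inl i)) \<and> (\<forall>i. P (Inr i))"
  by (metis sum.exhaust)

definition block_b :: "'m::finite pmat \<Rightarrow> real^'m^2" where
  "block_b X = (\<chi> p q. X $ Inl p $ Inr q)"

definition block_d :: "'m::finite pmat \<Rightarrow> 'm sqmat" where
  "block_d X = (\<chi> p q. X $ Inr p $ Inr q)"

lemma block_matrix_nth [simp]: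
  "block_matrix a b c d $ Inl p $ Inl q = a $ p $ q"
  "block_matrix a b c d $ Inl p $ Inr q' = b $ p $ q'"
  "block_matrix a b c d $ Inr p' $ Inl q = c $ p' $ q"
  "block_matrix a b c d $ Inr p' $ Inr q' = d $ p' $ q'"
  by (simp_all add: block_matrix_def)

lemma block_of_block_matrix [simp]:
  "block_a (block_matrix a b c d) = a" "block_b (block_matrix a b c d) = b"
  "block_c (block_matrix a b c d) = c" "block_d (block_matrix a b c d) = d"
  by (simp_all add: block_a_def block_b_def block_c_def block_d_def vec_eq_iff)

lemma block_matrix_collapse:
  "block_matrix (block_a X) (block_b X) (block_c X) (block_d X) = X"
  by (simp add: block_a_def block_b_def block_c_def block_d_def vec_eq_iff forall_sum)

lemma block_eqI:
  assumes "block_a X = block_a Y" "block_b X = block_b Y" "block_c X = block_c Y" "block_d X = block_d Y"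
  shows "X = Y"
  by (metis assms block_matrix_collapse)

lemma block_matrix_eq_iff:
  "block_matrix a b c d = block_matrix a' b' c' d' \<longleftrightarrow> a = a' \<and> b = b' \<and> c = c' \<and> d = d'"
  by (metis block_of_block_matrix)

lemma block_matrix_mult:
  "block_matrix a b c d ** block_matrix a' b' c' d' =
    block_matrix (a ** a' + b ** c') (a ** b' + b ** d') (c ** a' + d ** c') (c ** b' + d ** d')"
  by (simp add: vec_eq_iff forall_sum matrix_matrix_mult_def sum_UNIV_sum)

lemma transpose_block_matrix:
  "transpose (block_matrix a b c d) =
    block_matrix (transpose a) (transpose c) (transpose b) (transpose d)"
  by (simp add: vec_eq_iff forall_sum transpose_def)

lemma mat_1_block: "mat 1 = block_matrix (mat 1) 0 0 (mat 1)"
  by (simp add: vec_eq_iff forall_sum mat_def)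

lemma block_mat_1 [simp]:
  "block_a (mat 1) = mat 1" "block_b (mat 1) = 0" "block_c (mat 1) = 0" "block_d (mat 1) = mat 1"
  by (simp_all add: mat_1_block)

lemma block_mult:
  "block_a (X ** Y) = block_a X ** block_a Y + block_b X ** block_c Y"
  "block_b (X ** Y) = block_a X ** block_b Y + block_b X ** block_d Y"
  "block_c (X ** Y) = block_c X ** block_a Y + block_d X ** block_c Y"
  "block_d (X ** Y) = block_c X ** block_b Y + block_d X ** block_d Y"
proof -
  have "X ** Y = block_matrix (block_a X) (block_b X) (block_c X) (block_d X) **
      block_matrix (block_a Y) (block_b Y) (block_c Y) (block_d Y)"
    by (simp only: block_matrix_collapse)
  then show "block_a (X ** Y) = block_a X ** block_a Y + block_b X ** block_c Y"
    "block_b (X ** Y) = block_a X ** block_b Y + block_b X ** block_d Y"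
    "block_c (X ** Y) = block_c X ** block_a Y + block_d X ** block_c Y"
    "block_d (X ** Y) = block_c X ** block_b Y + block_d X ** block_d Y"
    by (simp_all add: block_matrix_mult)
qed

lemma bounded_linear_block:
  "bounded_linear (block_a :: 'm::finite pmat \<Rightarrow> _)" "bounded_linear (block_b :: 'm::finite pmat \<Rightarrow> _)"
  "bounded_linear (block_c :: 'm::finite pmat \<Rightarrow> _)" "bounded_linear (block_d :: 'm::finite pmat \<Rightarrow> _)"
  unfolding linear_conv_bounded_linear[symmetric] linear_iff
  by (simp_all add: block_a_def block_b_def block_c_def block_d_def vec_eq_iff)

lemma block_add:
  "block_a (X + Y) = block_a X + block_a Y" "block_b (X + Y) = block_b X + block_b Y"
  "block_c (X + Y) = block_c X + block_c Y" "block_d (X + Y) = block_d X + block_d Y"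
  by (simp_all add: bounded_linear.linear[OF bounded_linear_block(1), THEN linear_add]
      bounded_linear.linear[OF bounded_linear_block(2), THEN linear_add]
      bounded_linear.linear[OF bounded_linear_block(3), THEN linear_add]
      bounded_linear.linear[OF bounded_linear_block(4), THEN linear_add])

lemma block_scaleR:
  "block_a (r *\<^sub>R X) = r *\<^sub>R block_a X" "block_b (r *\<^sub>R X) = r *\<^sub>R block_b X"
  "block_c (r *\<^sub>R X) = r *\<^sub>R block_c X" "block_d (r *\<^sub>R X) = r *\<^sub>R block_d X"
  by (simp_all add: bounded_linear.linear[OF bounded_linear_block(1), THEN linear_scale]
      bounded_linear.linear[OF bounded_linear_block(2), THEN linear_scale]
      bounded_linear.linear[OF bounded_linear_block(3), THEN linear_scale]
      bounded_linear.linear[OF bounded_linear_block(4), THEN linear_scale])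

lemma smooth_on_block_matrix:
  fixes a :: "'a::euclidean_space \<Rightarrow> real^2^2" and d :: "'a \<Rightarrow> 'm::finite sqmat"
  assumes "smooth_on S a" "smooth_on S b" "smooth_on S c" "smooth_on S d"
  shows "smooth_on S (\<lambda>x. block_matrix (a x) (b x) (c x) (d x))"
proof -
  have "smooth_on S (\<lambda>x. case i of
        Inl p \<Rightarrow> (case j of Inl q \<Rightarrow> a x $ p $ q | Inr q \<Rightarrow> b x $ p $ q)
      | Inr p \<Rightarrow> (case j of Inl q \<Rightarrow> c x $ p $ q | Inr q \<Rightarrow> d x $ p $ q))" for i j
    using assms by (cases i; cases j) (simp_all add: smooth_on_vec_nth)
  then show ?thesis unfolding block_matrix_def by (intro smooth_on_vec)
qed

text \<open>The Gram matrix of \<open>scalar_prod\<close>, see \<open>scalar_prod_J\<close>.\<close>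

definition J_mat :: "'m::finite pmat" where
  "J_mat = block_matrix (- mat 1) 0 0 (mat 1)"

text \<open>The adjoint with respect to \<open>scalar_prod\<close>. On the pseudo-orthogonal group
  it is the inverse, and unlike \<open>matrix_inv\<close> it is linear in the matrix, so continuity
  and smoothness of inversion come for free.\<close>

definition adj :: "'m::finite pmat \<Rightarrow> 'm pmat" where
  "adj X = J_mat ** transpose X ** J_mat"

lemma matrix_minus_mult [simp]:
  fixes A :: "real^'n^'m" and B :: "real^'p^'n"
  shows "(- A) ** B = - (A ** B)" "A ** (- B) = - (A ** B)"
  by (simp_all add: matrix_matrix_mult_def vec_eq_iff sum_negf)

lemma matrix_mult_0 [simp]:
  fixes A :: "real^'n^'m"
  shows "A ** (0 :: real^'p^'n) = 0" "(0 :: real^'m^'q) ** A = 0"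
  by (simp_all add: matrix_matrix_mult_def vec_eq_iff)

lemma transpose_simps [simp]:
  "transpose (0 :: real^'n^'m) = 0" "transpose (- A) = - transpose (A :: real^'n^'m)"
  "transpose (A + B) = transpose A + transpose (B :: real^'n^'m)"
  "transpose (A - B) = transpose A - transpose (B :: real^'n^'m)"
  "transpose (r *\<^sub>R A) = r *\<^sub>R transpose A"
  by (simp_all add: transpose_def vec_eq_iff)

lemma J_mat_J_mat [simp]: "J_mat ** J_mat = mat 1"
  by (simp add: J_mat_def block_matrix_mult mat_1_block)

lemma adj_block:
  "adj (block_matrix a b c d) =
    block_matrix (transpose a) (- transpose c) (- transpose b) (transpose d)"
  by (simp add: adj_def J_mat_def transpose_block_matrix block_matrix_mult)

lemma block_adj:
  "block_a (adj X) = transpose (block_a X)" "block_b (adj X) = - transpose (block_c X)"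
  "block_c (adj X) = - transpose (block_b X)" "block_d (adj X) = transpose (block_d X)"
proof -
  have "adj X = adj (block_matrix (block_a X) (block_b X) (block_c X) (block_d X))"
    by (simp only: block_matrix_collapse)
  then show "block_a (adj X) = transpose (block_a X)" "block_b (adj X) = - transpose (block_c X)"
    "block_c (adj X) = - transpose (block_b X)" "block_d (adj X) = transpose (block_d X)"
    by (simp_all add: adj_block)
qed

lemma adj_mult: "adj (X ** Y) = adj Y ** adj X"
proof -
  have "adj Y ** adj X = J_mat ** transpose Y ** (J_mat ** J_mat) ** transpose X ** J_mat"
    by (simp only: adj_def matrix_mul_assoc)
  then show ?thesis
    by (simp only: J_mat_J_mat matrix_mul_rid) (simp add: adj_def matrix_transpose_mul matrix_mul_assoc)
qed

lemma adj_adj [simp]: "adj (adj X) = X"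
  by (rule block_eqI) (simp_all add: block_adj)

lemma adj_mat_1 [simp]: "adj (mat 1) = mat 1"
  by (simp add: adj_def)

lemma adj_add: "adj (X + Y) = adj X + adj Y"
  by (rule block_eqI) (simp_all add: block_adj block_add block_scaleR)

lemma adj_diff: "adj (X - Y) = adj X - adj Y"
  using adj_add[of "X - Y" Y] by (simp add: algebra_simps)

lemma adj_scaleR: "adj (r *\<^sub>R X) = r *\<^sub>R adj X"
  by (rule block_eqI) (simp_all add: block_adj block_add block_scaleR)

lemma bounded_linear_adj: "bounded_linear adj"
  by (intro linear_conv_bounded_linear[THEN iffD1] linearI) (simp_all add: adj_add adj_scaleR)

lemma sum_mat_1: "(\<Sum>j\<in>UNIV. mat 1 $ p $ j * y j) = (y p :: real)"
  by (simp add: mat_def if_distrib[of "\<lambda>z. z * _"] sum.delta cong: if_cong)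

lemma scalar_prod_J: "scalar_prod x y = x \<bullet> (J_mat *v y)"
proof -
  have "(J_mat *v y) $ Inl p = - y $ Inl p" "(J_mat *v y) $ Inr q = y $ Inr q" for p and q :: 'a
    by (simp_all add: matrix_vector_mult_def sum_UNIV_sum J_mat_def sum_mat_1 sum_negf)
  then show ?thesis
    by (simp add: scalar_prod_def inner_vec_def sum_UNIV_sum sum_two)
qed

lemma pseudo_orthogonal_iff: "X \<in> pseudo_orthogonal \<longleftrightarrow> adj X ** X = mat 1"
proof -
  have *: "scalar_prod (X *v x) (X *v y) = x \<bullet> ((transpose X ** J_mat ** X) *v y)" for x y
    unfolding scalar_prod_J vector_transpose_matrix[of x X, symmetric] dot_lmul_matrix
    by (simp only: vector_transpose_matrix matrix_vector_mul_assoc matrix_mul_assoc)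
  have "X \<in> pseudo_orthogonal \<longleftrightarrow>
      (\<forall>x y. x \<bullet> ((transpose X ** J_mat ** X) *v y) = x \<bullet> (J_mat *v y))"
    unfolding pseudo_orthogonal_def mem_Collect_eq * by (simp only: scalar_prod_J)
  also have "\<dots> \<longleftrightarrow> transpose X ** J_mat ** X = J_mat"
    unfolding matrix_eq using vector_eq_ldot by blast
  also have "\<dots> \<longleftrightarrow> adj X ** X = mat 1"
  proof
    assume "transpose X ** J_mat ** X = J_mat"
    then have "J_mat ** (transpose X ** J_mat ** X) = mat 1" by simp
    then show "adj X ** X = mat 1" by (simp add: adj_def matrix_mul_assoc)
  next
    assume "adj X ** X = mat 1"
    then have "J_mat ** (J_mat ** transpose X ** J_mat ** X) = J_mat"
      by (simp only: adj_def matrix_mul_rid)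
    then show "transpose X ** J_mat ** X = J_mat"
      by (simp add: matrix_mul_assoc)
  qed
  finally show ?thesis .
qed

lemma pseudo_orthogonal_mult:
  assumes "X \<in> pseudo_orthogonal" "Y \<in> pseudo_orthogonal"
  shows "X ** Y \<in> pseudo_orthogonal"
proof -
  have "adj (X ** Y) ** (X ** Y) = adj Y ** (adj X ** X) ** Y"
    by (simp only: adj_mult matrix_mul_assoc)
  then show ?thesis using assms by (simp add: pseudo_orthogonal_iff)
qed

lemma pseudo_orthogonal_adj_right: "X \<in> pseudo_orthogonal \<Longrightarrow> X ** adj X = mat 1"
  by (simp add: pseudo_orthogonal_iff matrix_left_right_inverse)

lemma pseudo_orthogonal_adj: "X \<in> pseudo_orthogonal \<Longrightarrow> adj X \<in> pseudo_orthogonal"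
  by (simp add: pseudo_orthogonal_iff matrix_left_right_inverse)

lemma pseudo_orthogonal_mat_1: "mat 1 \<in> pseudo_orthogonal"
  by (simp add: pseudo_orthogonal_iff)

lemma O_up_subset: "O_up \<subseteq> pseudo_orthogonal"
  unfolding O_up_def by (rule connected_component_subset)

lemma mat_1_O_up [simp]: "mat 1 \<in> O_up"
  unfolding O_up_def by (simp add: pseudo_orthogonal_mat_1)

lemma connected_O_up: "connected O_up"
  unfolding O_up_def by (rule connected_connected_component)

lemma connected_subset_O_up:
  assumes "connected T" "T \<subseteq> pseudo_orthogonal" "T \<inter> O_up \<noteq> {}"
  shows "T \<subseteq> O_up"
proof -
  have "connected (O_up \<union> T)" using assms connected_O_up by (intro connected_Un) auto
  then show ?thesis
    using connected_component_maximal[of "mat 1" "O_up \<union> T" pseudo_orthogonal] assms(2) O_up_subset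
    unfolding O_up_def[symmetric] by auto
qed

text \<open>Membership in the identity component is shown by moving a known element
  \<open>f t\<close> continuously inside the pseudo-orthogonal group. Products, inverses, the
  section, the isotropy matrices and the Cayley charts are all placed in \<open>O_up\<close> in this
  way.\<close>

lemma connected_image_O_up:
  assumes "connected T" "continuous_on T f" "t \<in> T" "f t \<in> O_up" "\<And>x. x \<in> T \<Longrightarrow> f x \<in> pseudo_orthogonal"
    "x \<in> T"
  shows "f x \<in> O_up"
  using connected_subset_O_up[of "f ` T"] connected_continuous_image[of T f] assms by blast

lemma continuous_on_matrix_mult [continuous_intros]:
  fixes f :: "'a::topological_space \<Rightarrow> real^'n^'m" and g :: "'a \<Rightarrow> real^'p^'n"
  shows "continuous_on S f \<Longrightarrow> continuous_on S g \<Longrightarrow> continuous_on S (\<lambda>x. f x ** g x)"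
  by (rule bounded_bilinear.continuous_on[OF bounded_bilinear_matrix_mult])

lemma O_up_mult:
  assumes X: "X \<in> O_up" and Y: "Y \<in> O_up"
  shows "X ** Y \<in> O_up"
proof (rule connected_image_O_up[OF connected_O_up, where f = "\<lambda>Y. X ** Y" and t = "mat 1"])
  show "continuous_on O_up (\<lambda>Y. X ** Y)" by (intro continuous_intros)
  show "X ** mat 1 \<in> O_up" using X by simp
  show "X ** Z \<in> pseudo_orthogonal" if "Z \<in> O_up" for Z
    using X that O_up_subset pseudo_orthogonal_mult by blast
qed (use Y in auto)

lemma O_up_adj:
  assumes X: "X \<in> O_up"
  shows "adj X \<in> O_up"
proof (rule connected_image_O_up[OF connected_O_up, where f = adj and t = "mat 1"])
  show "continuous_on O_up adj" by (rule linear_continuous_on[OF bounded_linear_adj])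
  show "adj (mat 1) \<in> O_up" by simp
  show "adj Z \<in> pseudo_orthogonal" if "Z \<in> O_up" for Z
    using that O_up_subset pseudo_orthogonal_adj by blast
qed (use X in auto)

lemma O_up_adj_left: "X \<in> O_up \<Longrightarrow> adj X ** X = mat 1"
  using O_up_subset pseudo_orthogonal_iff by blast

lemma O_up_adj_right: "X \<in> O_up \<Longrightarrow> X ** adj X = mat 1"
  using O_up_subset pseudo_orthogonal_adj_right by blast

lemma O_up_matrix_inv: "X \<in> O_up \<Longrightarrow> matrix_inv X = adj X"
  by (rule matrix_inv_unique) (rule O_up_adj_right)

section \<open>Cholesky factorization\<close>

lemma finite_linorder_induct [case_names less]:
  fixes j :: "'k::{finite,linorder}"
  assumes "\<And>j. (\<And>i. i < j \<Longrightarrow> P i) \<Longrightarrow> P j"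
  shows "P j"
proof (induction j rule: measure_induct_rule[of "\<lambda>j. card {i. i < j}"])
  case (less j)
  have "card {k. k < i} < card {i. i < j}" if "i < j" for i
    using that by (intro psubset_card_mono) auto
  then show ?case using less assms by blast
qed

text \<open>Gram-Schmidt for the form \<open>x \<bullet> (G *v y)\<close>, run on the standard basis
  in the order of the index type. The \<open>j\<close>-th vector involves only basis vectors up to
  \<open>j\<close>, which is the source of triangularity.\<close>

function gram_schmidt :: "'k sqmat \<Rightarrow> 'k::{finite,linorder} \<Rightarrow> (real, 'k) vec" where
  "gram_schmidt G j =
     (let w = axis j 1 - (\<Sum>i\<in>{i. i < j}. (gram_schmidt G i \<bullet> (G *v axis j 1)) *\<^sub>R gram_schmidt G i)
      in inverse (sqrt (w \<bullet> (G *v w))) *\<^sub>R w)"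
  by auto
termination
  by (relation "Wellfounded.measure (\<lambda>(G, j). card {i. i < j})") (auto intro!: psubset_card_mono)

declare gram_schmidt.simps [simp del]

lemma positive_definite_symmetric:
  assumes "positive_definite G"
  shows "x \<bullet> (G *v y) = y \<bullet> (G *v x)"
proof -
  have "x \<bullet> (G *v y) = (x v* G) \<bullet> y" by (rule dot_lmul_matrix[symmetric])
  also have "x v* G = transpose G *v x" by simp
  also have "transpose G = G" using assms by (simp add: positive_definite_def)
  finally show ?thesis by (simp add: inner_commute)
qed

text \<open>The claims are proved together: orthonormality of the earlier vectors makes the
  subtracted projections exact, and their triangularity gives \<open>w\<close> the
  \<open>j\<close>-th entry 1, so that \<open>w\<close> is nonzero and can be normalized.\<close>

lemma gram_schmidt:
  fixes j :: "'k::{finite,linorder}"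
  assumes G: "positive_definite G"
  shows "(\<forall>i>j. gram_schmidt G j $ i = 0) \<and> gram_schmidt G j $ j > 0 \<and>
    gram_schmidt G j \<bullet> (G *v gram_schmidt G j) = 1 \<and>
    (\<forall>i<j. gram_schmidt G i \<bullet> (G *v gram_schmidt G j) = 0)"
proof (induction j rule: finite_linorder_induct)
  case (less j)
  let ?g = "gram_schmidt G"
  define w where "w = axis j 1 - (\<Sum>i\<in>{i. i < j}. (?g i \<bullet> (G *v axis j 1)) *\<^sub>R ?g i)"
  define s where "s = sqrt (w \<bullet> (G *v w))"
  have g: "?g j = inverse s *\<^sub>R w"
    by (subst gram_schmidt.simps) (simp add: w_def s_def Let_def)
  have wi: "w $ i = 0" if "j < i" for i
    using less that by (auto simp: w_def axis_def intro!: sum.neutral)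
  have wj: "w $ j = 1"
    using less by (auto simp: w_def axis_def intro!: sum.neutral)
  then have "w \<noteq> 0" by auto
  then have pos: "w \<bullet> (G *v w) > 0" using G by (simp add: positive_definite_def)
  then have s: "s > 0" "s * s = w \<bullet> (G *v w)" by (simp_all add: s_def)
  have orth: "?g i \<bullet> (G *v ?g k) = (if i = k then 1 else 0)" if "i < j" "k < j" for i k
    using less[OF that(1)] less[OF that(2)] positive_definite_symmetric[OF G, of "?g i" "?g k"]
    by (cases i k rule: linorder_cases) auto
  have "?g i \<bullet> (G *v w) = 0" if "i < j" for i
  proof -
    have "?g i \<bullet> (G *v w) = ?g i \<bullet> (G *v axis j 1) -
        (\<Sum>k\<in>{k. k < j}. (?g k \<bullet> (G *v axis j 1)) * (?g i \<bullet> (G *v ?g k)))"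
      by (simp add: w_def linear_diff[OF matrix_vector_mul_linear] linear_sum[OF matrix_vector_mul_linear]
          linear_scale[OF matrix_vector_mul_linear] inner_diff_right inner_sum_right)
    also have "(\<Sum>k\<in>{k. k < j}. (?g k \<bullet> (G *v axis j 1)) * (?g i \<bullet> (G *v ?g k))) =
        (\<Sum>k\<in>{k. k < j}. if i = k then ?g k \<bullet> (G *v axis j 1) else 0)"
      by (rule sum.cong) (simp_all add: orth that)
    also have "\<dots> = ?g i \<bullet> (G *v axis j 1)" using that by simp
    finally show ?thesis by simp
  qed
  moreover have "?g j \<bullet> (G *v ?g j) = 1"
  proof -
    have "?g j \<bullet> (G *v ?g j) = inverse s * inverse s * (w \<bullet> (G *v w))"
      unfolding g by (simp add: linear_scale[OF matrix_vector_mul_linear])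
    also have "\<dots> = 1" using s by (simp add: field_simps flip: s(2))
    finally show ?thesis .
  qed
  ultimately show ?case
    using s wi wj by (simp add: g linear_scale[OF matrix_vector_mul_linear])
qed

text \<open>For positive definite \<open>G\<close> this is the inverse of the usual upper triangular
  Cholesky factor: it makes the congruence \<open>transpose T ** G ** T\<close> equal to the
  identity.\<close>

definition cholesky :: "'k sqmat \<Rightarrow> 'k::{finite,linorder} sqmat" where
  "cholesky G = (\<chi> i j. gram_schmidt G j $ i)"

definition triangular_pos :: "'k::{finite,linorder} sqmat \<Rightarrow> bool" where
  "triangular_pos T \<longleftrightarrow> (\<forall>i j. j < i \<longrightarrow> T $ i $ j = 0) \<and> (\<forall>i. T $ i $ i > 0)"

lemma triangular_pos_cholesky: "positive_definite G \<Longrightarrow> triangular_pos (cholesky G)"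
  using gram_schmidt[of G] by (simp add: triangular_pos_def cholesky_def)

lemma congruence_nth:
  fixes T G :: "real^'k^'k"
  shows "(transpose T ** G ** T) $ i $ j = column i T \<bullet> (G *v column j T)"
proof -
  have "column i T \<bullet> (G *v column j T) = (\<Sum>k\<in>UNIV. T $ k $ i * (\<Sum>l\<in>UNIV. G $ k $ l * T $ l $ j))"
    by (simp add: inner_vec_def column_def matrix_vector_mult_def)
  moreover have "transpose T ** G ** T = transpose T ** (G ** T)" by (simp add: matrix_mul_assoc)
  ultimately show ?thesis
    by (simp add: matrix_matrix_mult_def transpose_def)
qed

lemma cholesky_congruence:
  assumes G: "positive_definite G"
  shows "transpose (cholesky G) ** G ** cholesky G = mat 1"
proof -
  have c: "column j (cholesky G) = gram_schmidt G j" for j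
    by (simp add: column_def cholesky_def vec_eq_iff)
  have "gram_schmidt G i \<bullet> (G *v gram_schmidt G j) = (if i = j then 1 else 0)" for i j
    using gram_schmidt[OF G, of i] gram_schmidt[OF G, of j]
      positive_definite_symmetric[OF G, of "gram_schmidt G i" "gram_schmidt G j"]
    by (cases i j rule: linorder_cases) auto
  then show ?thesis by (simp add: vec_eq_iff congruence_nth c mat_def)
qed

text \<open>Back substitution: as soon as column \<open>j\<close> of \<open>N\<close> vanishes below
  row \<open>i\<close>, only the diagonal entry of \<open>T\<close> contributes to entry
  \<open>(i, j)\<close> of the product.\<close>

lemma triangular_pos_cancel:
  assumes T: "triangular_pos T" and TN: "triangular_pos (T ** N)"
  shows "triangular_pos N"
proof -
  have nth: "(T ** N) $ i $ j = T $ i $ i * N $ i $ j" if "\<And>k. k > i \<Longrightarrow> N $ k $ j = 0" for i j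
  proof -
    have "(T ** N) $ i $ j = (\<Sum>k\<in>UNIV. T $ i $ k * N $ k $ j)"
      by (simp add: matrix_matrix_mult_def)
    also have "\<dots> = (\<Sum>k\<in>{i}. T $ i $ k * N $ k $ j)"
    proof (rule sum.mono_neutral_right)
      show "\<forall>k\<in>UNIV - {i}. T $ i $ k * N $ k $ j = 0"
        using T that by (auto simp: triangular_pos_def) (metis linorder_neqE)
    qed auto
    finally show ?thesis by simp
  qed
  have low: "N $ i $ j = 0" if "j < i" for i j
  proof (rule ccontr)
    assume "N $ i $ j \<noteq> 0"
    then have ne: "{k. j < k \<and> N $ k $ j \<noteq> 0} \<noteq> {}" using that by auto
    \<comment> \<open>The lowest nonzero entry of column \<open>j\<close> below the diagonal;
      everything beneath it is zero, so \<open>nth\<close> applies to its row.\<close>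
    define m where "m = Max {k. j < k \<and> N $ k $ j \<noteq> 0}"
    have m: "j < m" "N $ m $ j \<noteq> 0"
      using Max_in[OF _ ne] by (auto simp: m_def)
    have "N $ k $ j = 0" if "k > m" for k
    proof (rule ccontr)
      assume "N $ k $ j \<noteq> 0"
      then have "k \<le> m" unfolding m_def using that m(1) by (intro Max_ge) auto
      then show False using that by simp
    qed
    then have "(T ** N) $ m $ j = T $ m $ m * N $ m $ j" by (rule nth)
    moreover have "(T ** N) $ m $ j = 0" "T $ m $ m > 0"
      using T TN m(1) by (simp_all add: triangular_pos_def)
    ultimately show False using m(2) by simp
  qed
  moreover have "N $ j $ j > 0" for j
  proof -
    have "(T ** N) $ j $ j = T $ j $ j * N $ j $ j" by (rule nth) (rule low)
    moreover have "(T ** N) $ j $ j > 0" "T $ j $ j > 0"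
      using T TN by (simp_all add: triangular_pos_def)
    ultimately show ?thesis by (simp add: zero_less_mult_iff)
  qed
  ultimately show ?thesis by (simp add: triangular_pos_def)
qed

text \<open>Column by column: the earlier columns are already basis vectors, so orthogonality kills
  the entries above the diagonal, and unit length with positivity makes the diagonal entry
  1.\<close>

lemma triangular_pos_orthogonal:
  assumes N: "triangular_pos N" and o: "transpose N ** N = mat 1"
  shows "N = mat 1"
proof -
  have ip: "column i N \<bullet> column j N = (if i = j then 1 else 0)" for i j
  proof -
    have "column i N \<bullet> column j N = (mat 1 :: 'a sqmat) $ i $ j"
      using congruence_nth[of N "mat 1" i j] by (simp add: o)
    then show ?thesis by (simp add: mat_def)
  qed
  have "column j N = axis j 1" for j
  proof (induction j rule: finite_linorder_induct)
    case (less j)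
    have "N $ i $ j = 0" if "i \<noteq> j" for i
    proof (cases "i < j")
      case True
      then have "column i N = axis i 1" by (rule less)
      then show ?thesis using ip[of i j] that by (simp add: inner_axis' column_def)
    next
      case False
      then show ?thesis using N that by (auto simp: triangular_pos_def)
    qed
    then have e: "column j N = axis j (N $ j $ j)" by (auto simp: column_def axis_def vec_eq_iff)
    then have "axis j (N $ j $ j) \<bullet> axis j (N $ j $ j) = 1" using ip[of j j] by simp
    then have "(N $ j $ j - 1) * (N $ j $ j + 1) = 0" by (simp add: inner_axis_axis algebra_simps)
    moreover have "N $ j $ j > 0" using N by (simp add: triangular_pos_def)
    ultimately have "N $ j $ j = 1" by auto
    then show ?case using e by simp
  qed
  then show ?thesis by (auto simp: vec_eq_iff column_def axis_def mat_def)
qed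

text \<open>Two solutions differ by a right factor \<open>N\<close> that is triangular with positive
  diagonal by cancellation, and orthogonal because both congruences yield the identity.\<close>

lemma cholesky_unique:
  assumes "positive_definite G" "triangular_pos T" "transpose T ** G ** T = mat 1"
  shows "T = cholesky G"
proof -
  let ?C = "cholesky G"
  have C: "triangular_pos ?C" "transpose ?C ** G ** ?C = mat 1"
    using assms(1) by (auto intro: triangular_pos_cholesky cholesky_congruence)
  have "det (transpose ?C ** G ** ?C) = 1" using C by simp
  then have d: "det ?C \<noteq> 0" by (auto simp: det_mul)
  define N where "N = matrix_inv ?C ** T"
  have T: "T = ?C ** N" by (simp add: N_def matrix_mul_assoc matrix_inv_right[OF d])
  then have N: "triangular_pos N" using triangular_pos_cancel C(1) assms(2) by metis
  have "transpose N ** (transpose ?C ** G ** ?C) ** N = mat 1"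
    using assms(3) unfolding T by (simp add: matrix_transpose_mul matrix_mul_assoc)
  then have "transpose N ** N = mat 1" by (simp add: C(2))
  then have "N = mat 1" by (rule triangular_pos_orthogonal[OF N])
  then show ?thesis using T by simp
qed

lemma bounded_bilinear_matrix_vector_mult:
  "bounded_bilinear (\<lambda>(A::real^'n^'m) x. A *v x)"
  unfolding bilinear_conv_bounded_bilinear[symmetric] bilinear_def
  by (intro conjI allI linearI)
     (simp_all add: matrix_vector_mult_def vec_eq_iff sum.distrib distrib_left distrib_right
        sum_distrib_left mult_ac)

lemma smooth_on_matrix_vector_mult:
  fixes f :: "'a::euclidean_space \<Rightarrow> real^'n^'m"
  shows "smooth_on S f \<Longrightarrow> smooth_on S g \<Longrightarrow> smooth_on S (\<lambda>x. f x *v g x)"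
  by (rule smooth_on_bilinear[OF bounded_bilinear_matrix_vector_mult])

lemma smooth_on_inner:
  fixes f :: "'a::euclidean_space \<Rightarrow> 'b::real_inner"
  shows "smooth_on S f \<Longrightarrow> smooth_on S g \<Longrightarrow> smooth_on S (\<lambda>x. f x \<bullet> g x)"
  by (rule smooth_on_bilinear[OF bounded_bilinear_inner])

lemma smooth_on_scaleR:
  fixes f :: "'a::euclidean_space \<Rightarrow> real" and g :: "'a \<Rightarrow> 'b::real_normed_vector"
  shows "smooth_on S f \<Longrightarrow> smooth_on S g \<Longrightarrow> smooth_on S (\<lambda>x. f x *\<^sub>R g x)"
  by (rule smooth_on_bilinear[OF bounded_bilinear_scaleR])

lemma smooth_on_gram_schmidt:
  fixes j :: "'k::{finite,linorder}"
  shows "smooth_on {G. positive_definite G} (\<lambda>G. gram_schmidt G j)"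
proof (induction j rule: finite_linorder_induct)
  case (less j)
  let ?S = "{G :: 'k sqmat. positive_definite G}"
  define w where "w G = axis j 1 - (\<Sum>i\<in>{i. i < j}. (gram_schmidt G i \<bullet> (G *v axis j 1)) *\<^sub>R gram_schmidt G i)" for G
  have g: "gram_schmidt G j = inverse (sqrt (w G \<bullet> (G *v w G))) *\<^sub>R w G" for G
    by (subst gram_schmidt.simps) (simp add: w_def Let_def)
  have pos: "w G \<bullet> (G *v w G) > 0" if "positive_definite G" for G
  proof -
    \<comment> \<open>A zero \<open>w G\<close> would make the normalized vector zero, against its
      positive diagonal entry.\<close>
    have "w G \<noteq> 0" using gram_schmidt[OF that, of j] by (auto simp: g)
    then show ?thesis using that by (simp add: positive_definite_def)
  qed
  have w: "smooth_on ?S w"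
    unfolding w_def by (intro smooth_on_diff smooth_on_const smooth_on_sum smooth_on_scaleR smooth_on_inner
        smooth_on_matrix_vector_mult smooth_on_id less) auto
  then have "smooth_on ?S (\<lambda>G. w G \<bullet> (G *v w G))"
    by (intro smooth_on_inner smooth_on_matrix_vector_mult smooth_on_id)
  then have "smooth_on ?S (\<lambda>G. sqrt (w G \<bullet> (G *v w G)))"
    by (rule smooth_on_compose[OF smooth_on_sqrt]) (use pos in auto)
  then have "smooth_on ?S (\<lambda>G. inverse (sqrt (w G \<bullet> (G *v w G))))"
    by (rule smooth_on_compose[OF smooth_on_inverse]) (use pos in force)
  then show ?case unfolding g using w by (rule smooth_on_scaleR)
qed

lemma smooth_on_cholesky:
  "smooth_on {G :: 'k::{finite,linorder} sqmat. positive_definite G} cholesky"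
  unfolding cholesky_def by (intro smooth_on_vec smooth_on_vec_nth smooth_on_gram_schmidt)

section \<open>The domain and the section P\<close>

lemma inner_matrix_left:
  fixes A :: "real^'n^'m"
  shows "(A *v x) \<bullet> y = x \<bullet> (transpose A *v y)"
  by (metis dot_lmul_matrix vector_transpose_matrix transpose_transpose)

lemma norm_matrix_vector_sq:
  fixes A :: "real^'n^'m"
  shows "(norm (A *v x))\<^sup>2 = x \<bullet> ((transpose A ** A) *v x)"
proof -
  have "(A *v x) \<bullet> (A *v x) = x \<bullet> (transpose A *v (A *v x))" by (rule inner_matrix_left)
  then show ?thesis by (simp only: power2_norm_eq_inner matrix_vector_mul_assoc)
qed

text \<open>The quadratic form is the difference of the squared norms of \<open>x\<close> and
  \<open>A *v x\<close>. Reading \<open>Omega\<close> as the set of strict contractions turns its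
  convexity and its invariance under orthogonal factors into statements about norms.\<close>

lemma positive_definite_contraction:
  fixes A :: "real^'n^'m"
  shows "positive_definite (mat 1 - transpose A ** A) \<longleftrightarrow> (\<forall>x. x \<noteq> 0 \<longrightarrow> norm (A *v x) < norm x)"
proof -
  have "x \<bullet> ((mat 1 - transpose A ** A) *v x) = (norm x)\<^sup>2 - (norm (A *v x))\<^sup>2" for x
    by (simp add: matrix_vector_mult_diff_rdistrib inner_diff_right norm_matrix_vector_sq dot_square_norm)
  moreover have "(norm (A *v x))\<^sup>2 < (norm x)\<^sup>2 \<longleftrightarrow> norm (A *v x) < norm x" for x
    by (meson norm_ge_zero power2_less_imp_less power_strict_mono zero_less_numeral)
  ultimately show ?thesis
    by (simp add: positive_definite_def matrix_transpose_mul)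
qed

lemma Omega_iff: "\<beta> \<in> Omega \<longleftrightarrow> (\<forall>x. x \<noteq> 0 \<longrightarrow> norm (\<beta> *v x) < norm x)"
  by (simp add: Omega_def positive_definite_contraction)

text \<open>The squared norm of \<open>transpose A *v y\<close> equals
  \<open>y \<bullet> (A *v (transpose A *v y))\<close>. Cauchy-Schwarz and the contraction property
  of \<open>A\<close> leave one factor to cancel.\<close>

lemma contraction_transpose:
  fixes A :: "real^'n^'m"
  assumes "\<And>x. x \<noteq> 0 \<Longrightarrow> norm (A *v x) < norm x" "y \<noteq> 0"
  shows "norm (transpose A *v y) < norm y"
proof (cases "transpose A *v y = 0")
  case False
  let ?z = "transpose A *v y"
  have "norm ?z * norm ?z = y \<bullet> (A *v ?z)"
    unfolding power2_eq_square[symmetric] power2_norm_eq_inner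
    by (simp only: inner_matrix_left transpose_transpose)
  also have "\<dots> \<le> norm y * norm (A *v ?z)" by (rule norm_cauchy_schwarz)
  also have "\<dots> < norm y * norm ?z" using assms False by simp
  finally show ?thesis using False by simp
qed (use assms in simp)

lemma Omega_positive_definite:
  assumes "\<beta> \<in> Omega"
  shows "positive_definite (mat 1 - transpose \<beta> ** \<beta>)" "positive_definite (mat 1 - \<beta> ** transpose \<beta>)"
proof -
  show "positive_definite (mat 1 - transpose \<beta> ** \<beta>)" using assms by (simp add: Omega_def)
  have "norm (transpose \<beta> *v y) < norm y" if "y \<noteq> 0" for y
    using contraction_transpose[of \<beta> y] assms that by (simp add: Omega_iff)
  then have "positive_definite (mat 1 - transpose (transpose \<beta>) ** transpose \<beta>)"
    unfolding positive_definite_contraction by blast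
  then show "positive_definite (mat 1 - \<beta> ** transpose \<beta>)" by simp
qed

lemma zero_in_Omega [simp]: "0 \<in> Omega"
  by (simp add: Omega_iff)

text \<open>Convexity supplies the connectedness along which sections and lifts are compared with
  their values at the origin.\<close>

lemma convex_Omega: "convex Omega"
proof (rule convexI)
  fix \<beta> \<gamma> :: "'a colpair" and u v :: real
  assume *: "\<beta> \<in> Omega" "\<gamma> \<in> Omega" "0 \<le> u" "0 \<le> v" "u + v = 1"
  show "u *\<^sub>R \<beta> + v *\<^sub>R \<gamma> \<in> Omega"
    unfolding Omega_iff
  proof (intro allI impI)
    fix x :: "real^2" assume x: "x \<noteq> 0"
    have "norm ((u *\<^sub>R \<beta> + v *\<^sub>R \<gamma>) *v x) \<le> u * norm (\<beta> *v x) + v * norm (\<gamma> *v x)"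
      using *(3,4) norm_triangle_ineq[of "u *\<^sub>R (\<beta> *v x)" "v *\<^sub>R (\<gamma> *v x)"]
      by (simp add: matrix_vector_mult_add_rdistrib scaleR_matrix_vector_assoc[symmetric])
    also have "\<dots> < norm x"
      by (rule convex_bound_lt) (use * x in \<open>auto simp: Omega_iff\<close>)
    finally show "norm ((u *\<^sub>R \<beta> + v *\<^sub>R \<gamma>) *v x) < norm x" .
  qed
qed

lemma connected_Omega: "connected Omega"
  by (rule convex_connected[OF convex_Omega])

lemma Omega_orthogonal:
  fixes R :: "'m::finite sqmat"
  assumes "\<beta> \<in> Omega" "orthogonal_matrix R" "orthogonal_matrix r"
  shows "R ** \<beta> ** r \<in> Omega"
proof -
  have n: "norm (Q *v x) = norm x" if "orthogonal_matrix Q" for Q :: "real^'n^'n" and x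
    using that orthogonal_transformation_matrix[of "(*v) Q"]
    by (auto simp: orthogonal_transformation)
  have "norm ((R ** \<beta> ** r) *v x) < norm x" if "x \<noteq> 0" for x
  proof -
    have "r *v x \<noteq> 0" using that n[OF assms(3), of x] by auto
    then have "norm (\<beta> *v (r *v x)) < norm (r *v x)" using assms(1) by (simp add: Omega_iff)
    then show ?thesis using n[OF assms(2)] n[OF assms(3)] by (simp flip: matrix_vector_mul_assoc)
  qed
  then show ?thesis by (simp add: Omega_iff)
qed

definition chol_a :: "'m::finite colpair \<Rightarrow> real^2^2" where
  "chol_a \<beta> = cholesky (mat 1 - transpose \<beta> ** \<beta>)"

definition chol_d :: "'m::{finite,linorder} colpair \<Rightarrow> 'm sqmat" where
  "chol_d \<beta> = cholesky (mat 1 - \<beta> ** transpose \<beta>)"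

lemma
  assumes "\<beta> \<in> Omega"
  shows triangular_pos_chol_a: "triangular_pos (chol_a \<beta>)"
    and triangular_pos_chol_d: "triangular_pos (chol_d \<beta>)"
    and chol_a_congruence: "transpose (chol_a \<beta>) ** (mat 1 - transpose \<beta> ** \<beta>) ** chol_a \<beta> = mat 1"
    and chol_d_congruence: "transpose (chol_d \<beta>) ** (mat 1 - \<beta> ** transpose \<beta>) ** chol_d \<beta> = mat 1"
  using Omega_positive_definite[OF assms]
  by (auto simp: chol_a_def chol_d_def intro: triangular_pos_cholesky cholesky_congruence)

lemma cholesky_mat_1: "cholesky (mat 1) = mat 1"
  by (rule cholesky_unique[symmetric])
     (auto simp: positive_definite_def triangular_pos_def, simp_all add: mat_def)

lemma chol_0 [simp]: "chol_a 0 = mat 1" "chol_d 0 = mat 1"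
  by (simp_all add: chol_a_def chol_d_def cholesky_mat_1)

text \<open>The section without definite description. \<open>P_sec_eq\<close> identifies it with
  \<open>P_sec\<close> on \<open>Omega\<close>, after smoothness and membership in
  \<open>O_up\<close> have been read off these blocks.\<close>

definition P_dir :: "'m colpair \<Rightarrow> 'm::{finite,linorder} pmat" where
  "P_dir \<beta> = block_matrix (chol_a \<beta>) (transpose \<beta> ** chol_d \<beta>) (\<beta> ** chol_a \<beta>) (chol_d \<beta>)"

lemma B_mat_mult_diag:
  "B_mat \<beta> ** block_matrix a 0 0 d = block_matrix a (transpose \<beta> ** d) (\<beta> ** a) d"
  by (simp add: B_mat_def block_matrix_mult)

lemma B_mat_congruence:
  "transpose (B_mat \<beta>) ** J_mat ** B_mat \<beta> =
    block_matrix (- (mat 1 - transpose \<beta> ** \<beta>)) 0 0 (mat 1 - \<beta> ** transpose \<beta>)"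
  by (simp add: B_mat_def J_mat_def transpose_block_matrix block_matrix_mult)

lemma pseudo_orthogonal_congruence:
  "X \<in> pseudo_orthogonal \<longleftrightarrow> transpose X ** J_mat ** X = J_mat"
proof
  assume "X \<in> pseudo_orthogonal"
  then have "J_mat ** (adj X ** X) = J_mat" by (simp add: pseudo_orthogonal_iff)
  then show "transpose X ** J_mat ** X = J_mat" by (simp add: adj_def matrix_mul_assoc)
next
  assume "transpose X ** J_mat ** X = J_mat"
  then have "J_mat ** (transpose X ** J_mat ** X) = mat 1" by simp
  then show "X \<in> pseudo_orthogonal" by (simp add: pseudo_orthogonal_iff adj_def matrix_mul_assoc)
qed

lemma B_mat_mult_pseudo_orthogonal:
  "B_mat \<beta> ** T \<in> pseudo_orthogonal \<longleftrightarrow>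
    transpose T ** block_matrix (- (mat 1 - transpose \<beta> ** \<beta>)) 0 0 (mat 1 - \<beta> ** transpose \<beta>) ** T = J_mat"
  unfolding pseudo_orthogonal_congruence B_mat_congruence[symmetric]
  by (simp add: matrix_transpose_mul matrix_mul_assoc)

lemma P_dir_eq: "P_dir \<beta> = B_mat \<beta> ** block_matrix (chol_a \<beta>) 0 0 (chol_d \<beta>)"
  by (simp add: P_dir_def B_mat_mult_diag)

lemma P_dir_pseudo_orthogonal:
  assumes "\<beta> \<in> Omega"
  shows "P_dir \<beta> \<in> pseudo_orthogonal"
  unfolding P_dir_eq B_mat_mult_pseudo_orthogonal transpose_block_matrix
  using chol_a_congruence[OF assms] chol_d_congruence[OF assms]
  by (simp only: block_matrix_mult matrix_mult_0 matrix_minus_mult transpose_simps minus_zero add_0_left add_0_right J_mat_def)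

lemma smooth_on_chol:
  "smooth_on Omega chol_a" "smooth_on Omega chol_d"
proof -
  have "smooth_on Omega (\<lambda>\<beta>. mat 1 - transpose \<beta> ** \<beta>)" "smooth_on Omega (\<lambda>\<beta>. mat 1 - \<beta> ** transpose \<beta>)"
    by (intro smooth_on_diff smooth_on_const smooth_on_matrix_mult smooth_on_transpose smooth_on_id)+
  from smooth_on_compose[OF smooth_on_cholesky this(1)] smooth_on_compose[OF smooth_on_cholesky this(2)]
  show "smooth_on Omega chol_a" "smooth_on Omega chol_d"
    using Omega_positive_definite unfolding chol_a_def chol_d_def by auto
qed

lemma smooth_on_P_dir: "smooth_on Omega P_dir"
  unfolding P_dir_def
  by (intro smooth_on_block_matrix smooth_on_matrix_mult smooth_on_transpose smooth_on_chol smooth_on_id)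

lemma P_dir_O_up:
  assumes "\<beta> \<in> Omega"
  shows "P_dir \<beta> \<in> O_up"
proof (rule connected_image_O_up[OF connected_Omega, where f = P_dir and t = 0])
  show "P_dir 0 \<in> O_up" by (simp add: P_dir_def flip: mat_1_block)
qed (auto intro: smooth_on_imp_continuous_on smooth_on_P_dir P_dir_pseudo_orthogonal assms)

lemma upper_triangular_pos_iff:
  "upper_triangular_pos T \<longleftrightarrow>
    triangular_pos (block_a T) \<and> block_c T = 0 \<and> triangular_pos (block_d T)"
  unfolding upper_triangular_pos_def triangular_pos_def forall_sum
  by (auto simp: block_a_def block_c_def block_d_def vec_eq_iff)

lemma det_triangular_pos:
  assumes "positive_definite G" "transpose T ** G ** T = mat 1"
  shows "det T \<noteq> 0" "det G \<noteq> 0"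
proof -
  have "det (transpose T ** G ** T) = 1" using assms by simp
  then show "det T \<noteq> 0" "det G \<noteq> 0" by (auto simp: det_mul)
qed

text \<open>The diagonal blocks are forced by uniqueness of the Cholesky factors. An admissible
  \<open>T\<close> may a priori have a nonzero upper right block; orthogonality of its two groups of
  columns excludes this.\<close>

lemma T_mat_eq:
  assumes "\<beta> \<in> Omega"
  shows "T_mat \<beta> = block_matrix (chol_a \<beta>) 0 0 (chol_d \<beta>)"
  unfolding T_mat_def
proof (rule the_equality)
  show "upper_triangular_pos (block_matrix (chol_a \<beta>) 0 0 (chol_d \<beta>)) \<and>
      B_mat \<beta> ** block_matrix (chol_a \<beta>) 0 0 (chol_d \<beta>) \<in> O_up"
    using triangular_pos_chol_a[OF assms] triangular_pos_chol_d[OF assms] P_dir_O_up[OF assms]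
    by (simp add: upper_triangular_pos_iff P_dir_eq)
next
  fix T assume T: "upper_triangular_pos T \<and> B_mat \<beta> ** T \<in> O_up"
  let ?M = "mat 1 - transpose \<beta> ** \<beta>" and ?N = "mat 1 - \<beta> ** transpose \<beta>"
  define a b d where "a = block_a T" "b = block_b T" "d = block_d T"
  have a: "triangular_pos a" and d: "triangular_pos d" and c: "block_c T = 0"
    using T by (auto simp: upper_triangular_pos_iff a_b_d_def)
  have Tb: "T = block_matrix a b 0 d"
    using block_matrix_collapse[of T] c by (simp add: a_b_d_def)
  have "transpose T ** block_matrix (- ?M) 0 0 ?N ** T = J_mat"
    using T O_up_subset B_mat_mult_pseudo_orthogonal by blast
  then have "block_matrix (- (transpose a ** ?M ** a)) (- (transpose a ** ?M ** b))
      (- (transpose b ** ?M ** a)) (- (transpose b ** ?M ** b) + transpose d ** ?N ** d) =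
      block_matrix (- mat 1) 0 0 (mat 1)"
    unfolding Tb transpose_block_matrix
    by (simp only: block_matrix_mult matrix_mult_0 matrix_minus_mult transpose_simps minus_zero add_0_left add_0_right J_mat_def)
  then have e: "transpose a ** ?M ** a = mat 1" "transpose a ** ?M ** b = 0"
      "- (transpose b ** ?M ** b) + transpose d ** ?N ** d = mat 1"
    by (auto simp only: block_matrix_eq_iff neg_equal_iff_equal neg_equal_0_iff_equal)
  \<comment> \<open>The off-diagonal block of the congruence is
    \<open>transpose a ** ?M ** b = 0\<close>, and the factor in front of \<open>b\<close> is
    invertible.\<close>
  have "matrix_inv (transpose a ** ?M) ** (transpose a ** ?M) ** b = 0"
    using e(2) by (simp flip: matrix_mul_assoc)
  moreover have "det (transpose a ** ?M) \<noteq> 0"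
    using det_triangular_pos[OF Omega_positive_definite(1)[OF assms] e(1)] by (simp add: det_mul)
  ultimately have b: "b = 0" by (simp add: matrix_inv_left)
  have "a = chol_a \<beta>" "d = chol_d \<beta>"
    unfolding chol_a_def chol_d_def
    using e b a d Omega_positive_definite[OF assms] by (auto intro!: cholesky_unique)
  then show "T = block_matrix (chol_a \<beta>) 0 0 (chol_d \<beta>)" using Tb b by simp
qed

lemma P_sec_eq: "\<beta> \<in> Omega \<Longrightarrow> P_sec \<beta> = P_dir \<beta>"
  by (simp add: P_sec_def T_mat_eq P_dir_eq)

lemma P_sec_O_up: "\<beta> \<in> Omega \<Longrightarrow> P_sec \<beta> \<in> O_up"
  by (simp add: P_sec_eq P_dir_O_up)

lemma smooth_on_P_sec: "smooth_on Omega P_sec"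
  by (rule smooth_on_cong[OF smooth_on_P_dir]) (simp add: P_sec_eq)

lemma a_hat_eq: "\<beta> \<in> Omega \<Longrightarrow> a_hat \<beta> = chol_a \<beta>"
  by (simp add: a_hat_def P_sec_eq P_dir_def)

section \<open>Connectedness of the special orthogonal group\<close>

text \<open>The reflection in the hyperplane orthogonal to \<open>w\<close>. It depends continuously
  on nonzero \<open>w\<close>, which is what allows two reflections to be joined inside the
  orthogonal group.\<close>

definition householder :: "real^'k \<Rightarrow> real^'k^'k" where
  "householder w = mat 1 - (2 / (w \<bullet> w)) *\<^sub>R (\<chi> i j. w $ i * w $ j)"

lemma householder_mult_vec:
  "householder w *v x = x - (2 * (w \<bullet> x) / (w \<bullet> w)) *\<^sub>R w"
proof -
  have "(\<chi> i j. w $ i * w $ j) *v x = (w \<bullet> x) *\<^sub>R w"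
    by (simp add: vec_eq_iff matrix_vector_mult_def inner_vec_def sum_distrib_left mult_ac)
  then show ?thesis
    by (simp add: householder_def matrix_vector_mult_diff_rdistrib scaleR_matrix_vector_assoc[symmetric])
qed

lemma householder_involution:
  assumes "w \<noteq> 0"
  shows "householder w ** householder w = mat 1"
proof -
  have "householder w *v (householder w *v x) = x" for x
  proof -
    have "w \<bullet> (householder w *v x) = - (w \<bullet> x)"
      using assms by (simp add: householder_mult_vec inner_diff_right)
    then show ?thesis
      unfolding householder_mult_vec[of w "householder w *v x"] by (simp add: householder_mult_vec)
  qed
  then show ?thesis by (simp add: matrix_eq matrix_vector_mul_assoc[symmetric])
qed

lemma orthogonal_householder:
  assumes "w \<noteq> 0"
  shows "orthogonal_matrix (householder w)"
proof -
  have "transpose (householder w) = householder w"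
    by (simp add: householder_def transpose_def vec_eq_iff mat_def mult.commute eq_commute)
  then show ?thesis by (simp add: orthogonal_matrix householder_involution assms)
qed

lemma det_householder_axis: "det (householder (axis k 1)) = -1"
proof -
  have d: "householder (axis k 1) $ i $ j = (if i = j then if i = k then -1 else 1 else 0)" for i j
  proof -
    have "axis k (1::real) \<bullet> axis k 1 = 1" by (simp add: inner_axis_axis)
    then have "householder (axis k 1) = mat 1 - 2 *\<^sub>R (\<chi> i j. axis k 1 $ i * axis k 1 $ j)"
      by (simp add: householder_def)
    then show ?thesis by (simp add: mat_def axis_def)
  qed
  have "det (householder (axis k 1)) = (\<Prod>i\<in>UNIV. if i = k then -1 else 1)"
    by (subst det_diagonal) (simp_all add: d)
  also have "\<dots> = -1" by (simp add: prod.delta)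
  finally show ?thesis .
qed

lemma orthogonal_inner:
  assumes "orthogonal_matrix (Q :: real^'k^'k)"
  shows "(Q *v x) \<bullet> (Q *v y) = x \<bullet> y"
proof -
  have "(Q *v x) \<bullet> (Q *v y) = x \<bullet> (transpose Q *v (Q *v y))" by (rule inner_matrix_left)
  also have "\<dots> = x \<bullet> ((transpose Q ** Q) *v y)" by (simp only: matrix_vector_mul_assoc)
  finally show ?thesis using assms by (simp add: orthogonal_matrix)
qed

text \<open>For vectors of equal length \<open>2 * ((x - y) \<bullet> x)\<close> is the squared
  length of \<open>x - y\<close>, so the reflection subtracts exactly \<open>x - y\<close> from
  \<open>x\<close>.\<close>

lemma householder_swap:
  assumes "x \<bullet> x = y \<bullet> y" "x \<noteq> y"
  shows "householder (x - y) *v x = y"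
proof -
  have "(x - y) \<bullet> (x - y) \<noteq> 0" using assms(2) by simp
  moreover have "2 * ((x - y) \<bullet> x) = (x - y) \<bullet> (x - y)"
    using assms(1) by (simp add: inner_diff_left inner_diff_right inner_commute)
  ultimately show ?thesis by (simp add: householder_mult_vec)
qed

lemma continuous_on_householder: "continuous_on (- {0}) (householder :: real^'k \<Rightarrow> _)"
proof -
  have "continuous_on (- {0}) (\<lambda>w :: real^'k. \<chi> i j. w $ i * w $ j)"
    by (intro continuous_intros)
  then show ?thesis unfolding householder_def by (intro continuous_intros) auto
qed

lemma connected_component_orthogonal_mult:
  assumes "connected_component (Collect orthogonal_matrix) A B" "orthogonal_matrix (R :: real^'k^'k)"
  shows "connected_component (Collect orthogonal_matrix) (R ** A) (R ** B)"
proof -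
  obtain T where T: "connected T" "T \<subseteq> Collect orthogonal_matrix" "A \<in> T" "B \<in> T"
    using assms(1) unfolding connected_component_def by blast
  have "connected ((\<lambda>X. R ** X) ` T)"
    by (rule connected_continuous_image[OF _ T(1)]) (intro continuous_intros)
  moreover have "(\<lambda>X. R ** X) ` T \<subseteq> Collect orthogonal_matrix"
    using T(2) assms(2) by (auto intro: orthogonal_matrix_mul)
  ultimately show ?thesis using T unfolding connected_component_def by blast
qed

text \<open>Induction on the number of basis vectors moved by \<open>Q\<close>. Splitting off one
  reflection fixes a further basis vector, and in dimension at least 2 the reflection can be
  deformed to the fixed one \<open>householder (axis k 1)\<close>, so each factor merely exchanges
  the two alternatives.\<close>

lemma orthogonal_component:
  fixes Q :: "real^'k^'k"
  assumes card: "2 \<le> CARD('k)" and Q: "orthogonal_matrix Q"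
  shows "connected_component (Collect orthogonal_matrix) (mat 1) Q \<or>
    connected_component (Collect orthogonal_matrix) (householder (axis k 1)) Q"
  using Q
proof (induction "card {j. Q *v axis j 1 \<noteq> axis j 1}" arbitrary: Q rule: less_induct)
  case less
  let ?O = "Collect orthogonal_matrix :: (real^'k^'k) set" and ?H = "householder (axis k 1 :: real^'k)"
  have H: "orthogonal_matrix ?H" "?H ** ?H = mat 1"
    by (auto intro!: orthogonal_householder householder_involution)
  show ?case
  proof (cases "{j. Q *v axis j 1 \<noteq> axis j 1} = {}")
    case True
    then have "Q *v axis j 1 = axis j 1" for j by blast
    then have "column j Q = axis j 1" for j by (metis matrix_vector_mult_basis)
    then have "Q = mat 1" by (auto simp: vec_eq_iff column_def axis_def mat_def)
    then show ?thesis using less.prems by simp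
  next
    case False
    then obtain j where j: "Q *v axis j 1 \<noteq> axis j 1" by blast
    \<comment> \<open>The reflection along \<open>w\<close> carries the image of
      \<open>axis j 1\<close> back to \<open>axis j 1\<close>. Basis vectors already fixed by
      \<open>Q\<close> are orthogonal to \<open>w\<close>, because \<open>Q\<close> preserves inner
      products, and stay fixed.\<close>
    define w where "w = Q *v axis j 1 - axis j 1"
    have w0: "w \<noteq> 0" using j by (simp add: w_def)
    define Q' where "Q' = householder w ** Q"
    have Q': "orthogonal_matrix Q'"
      unfolding Q'_def using less.prems w0 by (intro orthogonal_matrix_mul orthogonal_householder)
    have "Q' *v axis j 1 = axis j 1"
      unfolding Q'_def matrix_vector_mul_assoc[symmetric] w_def
      by (rule householder_swap) (use j orthogonal_inner[OF less.prems] in auto)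
    moreover have "Q' *v axis i 1 = axis i 1" if i: "Q *v axis i 1 = axis i 1" for i
    proof -
      have "w \<bullet> axis i 1 = 0"
        using orthogonal_inner[OF less.prems, of "axis j 1" "axis i 1"] i
        by (simp add: w_def inner_diff_left)
      then show ?thesis
        unfolding Q'_def matrix_vector_mul_assoc[symmetric] i by (simp add: householder_mult_vec)
    qed
    ultimately have "{i. Q' *v axis i 1 \<noteq> axis i 1} \<subset> {i. Q *v axis i 1 \<noteq> axis i 1}"
      using j by blast
    then have "card {i. Q' *v axis i 1 \<noteq> axis i 1} < card {i. Q *v axis i 1 \<noteq> axis i 1}"
      by (intro psubset_card_mono) auto
    then have IH: "connected_component ?O (mat 1) Q' \<or> connected_component ?O ?H Q'"
      using less.hyps Q' by blast
    have "householder w ** Q' = (householder w ** householder w) ** Q"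
      by (simp add: Q'_def matrix_mul_assoc)
    then have Q: "Q = householder w ** Q'" using householder_involution[OF w0] by simp
    \<comment> \<open>Connectedness of the punctured space requires dimension at least 2.\<close>
    have "connected (- {0 :: real^'k})" using card by (intro connected_punctured_universe) simp
    then have "connected ((\<lambda>w. householder w ** Q') ` (- {0}))"
      by (rule connected_continuous_image[rotated]) (intro continuous_intros continuous_on_householder)
    moreover have "(\<lambda>w. householder w ** Q') ` (- {0}) \<subseteq> ?O"
      using Q' by (auto intro: orthogonal_matrix_mul orthogonal_householder)
    moreover have "?H ** Q' \<in> (\<lambda>w. householder w ** Q') ` (- {0})"
      by (rule image_eqI[of _ _ "axis k 1"]) auto
    moreover have "Q \<in> (\<lambda>w. householder w ** Q') ` (- {0})"
      using w0 Q by blast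
    ultimately have c: "connected_component ?O (?H ** Q') Q"
      unfolding connected_component_def by blast
    from IH show ?thesis
    proof
      assume "connected_component ?O (mat 1) Q'"
      from connected_component_orthogonal_mult[OF this H(1)] c
      have "connected_component ?O ?H Q" by (simp add: connected_component_trans)
      then show ?thesis ..
    next
      assume "connected_component ?O ?H Q'"
      from connected_component_orthogonal_mult[OF this H(1)] c
      have "connected_component ?O (mat 1) Q" by (simp add: H(2) connected_component_trans)
      then show ?thesis ..
    qed
  qed
qed

lemma continuous_on_det [continuous_intros]:
  fixes f :: "'a::topological_space \<Rightarrow> real^'n^'n"
  shows "continuous_on S f \<Longrightarrow> continuous_on S (\<lambda>x. det (f x))"
  unfolding det_def by (intro continuous_intros)

lemma det_connected_component_orthogonal:
  assumes "connected_component (Collect orthogonal_matrix) A (B :: real^'k^'k)"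
  shows "det A = det B"
proof -
  obtain T where T: "connected T" "T \<subseteq> Collect orthogonal_matrix" "A \<in> T" "B \<in> T"
    using assms(1) unfolding connected_component_def by blast
  have "det ` T \<subseteq> {1, -1}" using T(2) det_orthogonal_matrix by blast
  then have "finite (det ` T)" by (rule finite_subset) simp
  then have "det constant_on T"
    by (intro continuous_finite_range_constant T(1) continuous_intros)
  then show ?thesis using T unfolding constant_on_def by metis
qed

text \<open>The determinant is constant on components and the reflection has determinant -1, so the
  second alternative of \<open>orthogonal_component\<close> cannot occur. The axis index
  \<open>undefined\<close> is an arbitrary choice.\<close>

lemma connected_SO:
  assumes "2 \<le> CARD('k)"
  shows "connected (SO :: (real^'k^'k) set)"
proof -
  let ?C = "connected_component_set (Collect orthogonal_matrix) (mat 1 :: real^'k^'k)"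
  have "?C \<subseteq> SO"
  proof
    fix Q assume "Q \<in> ?C"
    then have "connected_component (Collect orthogonal_matrix) (mat 1) Q" by simp
    from det_connected_component_orthogonal[OF this] connected_component_in[OF this]
    show "Q \<in> SO" by (simp add: rotation_matrix_def)
  qed
  moreover have "SO \<subseteq> ?C"
  proof
    fix Q :: "real^'k^'k" assume "Q \<in> SO"
    then have Q: "orthogonal_matrix Q" "det Q = 1" by (auto simp: rotation_matrix_def)
    show "Q \<in> ?C"
    proof (rule ccontr)
      assume "Q \<notin> ?C"
      then have "connected_component (Collect orthogonal_matrix) (householder (axis undefined 1)) Q"
        using orthogonal_component[OF assms Q(1), of undefined] by simp
      from det_connected_component_orthogonal[OF this] show False
        using Q(2) by (simp add: det_householder_axis)
    qed
  qed
  ultimately have e: "SO = ?C" by (rule subset_antisym[rotated])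
  show ?thesis unfolding e by (rule connected_connected_component)
qed

section \<open>The fibration over the domain\<close>

lemma O_up_block_relations:
  assumes "X \<in> pseudo_orthogonal"
  shows "transpose (block_a X) ** block_a X = mat 1 + transpose (block_c X) ** block_c X"
    and "transpose (block_d X) ** block_d X = mat 1 + transpose (block_b X) ** block_b X"
    and "transpose (block_a X) ** block_b X = transpose (block_c X) ** block_d X"
proof -
  have e: "adj X ** X = mat 1" using assms by (simp add: pseudo_orthogonal_iff)
  from arg_cong[OF e, of block_a] arg_cong[OF e, of block_b] arg_cong[OF e, of block_d]
  show "transpose (block_a X) ** block_a X = mat 1 + transpose (block_c X) ** block_c X"
    "transpose (block_d X) ** block_d X = mat 1 + transpose (block_b X) ** block_b X"
    "transpose (block_a X) ** block_b X = transpose (block_c X) ** block_d X"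
    by (simp_all add: block_mult block_adj algebra_simps)
qed

text \<open>The hypothesis says that the squared norm of \<open>A *v x\<close> is that of
  \<open>x\<close> plus that of \<open>C *v x\<close>, so \<open>A\<close> has trivial
  kernel.\<close>

lemma det_gram_nonzero:
  fixes A :: "real^'k^'k" and C :: "real^'k^'m"
  assumes "transpose A ** A = mat 1 + transpose C ** C"
  shows "det A \<noteq> 0"
proof
  assume "det A = 0"
  then obtain x where x: "x \<noteq> 0" "A *v x = 0"
    by (metis invertible_det_nz matrix_left_invertible_ker invertible_left_inverse)
  have "(norm (A *v x))\<^sup>2 = (norm x)\<^sup>2 + (norm (C *v x))\<^sup>2"
    unfolding norm_matrix_vector_sq assms
    by (simp add: matrix_vector_mult_add_rdistrib inner_add_right dot_square_norm)
  then show False using x by (simp add: sum_power2_eq_zero_iff)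
qed

lemma connected_positive:
  fixes f :: "'a::topological_space \<Rightarrow> real"
  assumes "connected S" "continuous_on S f" "a \<in> S" "f a > 0" "\<And>x. x \<in> S \<Longrightarrow> f x \<noteq> 0" "x \<in> S"
  shows "f x > 0"
proof (rule ccontr)
  assume "\<not> f x > 0"
  moreover have "connected (f ` S)" using assms by (intro connected_continuous_image)
  ultimately have "0 \<in> f ` S"
    using connectedD_interval[of "f ` S" "f x" "f a" 0] assms by auto
  then show False using assms(5) by auto
qed

lemma O_up_det_pos:
  assumes "X \<in> O_up"
  shows "det (block_a X) > 0" "det (block_d X) > 0"
proof -
  have nz: "det (block_a Y) \<noteq> 0" "det (block_d Y) \<noteq> 0" if "Y \<in> O_up" for Y :: "'a pmat"
    using that O_up_subset O_up_block_relations det_gram_nonzero by blast+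
  have c: "continuous_on O_up (\<lambda>X::'a pmat. det (block_a X))" "continuous_on O_up (\<lambda>X::'a pmat. det (block_d X))"
    by (intro continuous_intros linear_continuous_on bounded_linear_block)+
  show "det (block_a X) > 0"
    by (rule connected_positive[OF connected_O_up c(1) mat_1_O_up]) (use assms nz in auto)
  show "det (block_d X) > 0"
    by (rule connected_positive[OF connected_O_up c(2) mat_1_O_up]) (use assms nz in auto)
qed

text \<open>Both rotation groups are connected, hence so is the set of these block matrices, and it
  contains the identity.\<close>

lemma S_mat_O_up:
  fixes R :: "'m::{finite,linorder} sqmat"
  assumes "2 \<le> CARD('m)" "r \<in> SO" "R \<in> SO"
  shows "S_mat r R \<in> O_up"
proof -
  have "connected ((SO :: (real^2^2) set) \<times> (SO :: 'm sqmat set))"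
    using assms(1) by (intro connected_Times connected_SO) simp_all
  moreover have "continuous_on (SO \<times> SO) (\<lambda>p. S_mat (fst p) (snd p))"
    unfolding S_mat_def
    by (intro smooth_on_imp_continuous_on smooth_on_block_matrix smooth_on_const smooth_on_fst smooth_on_snd smooth_on_id)
  moreover have "S_mat (mat 1) (mat 1) \<in> (O_up :: 'm pmat set)"
    by (simp add: S_mat_def flip: mat_1_block)
  moreover have "S_mat r R \<in> pseudo_orthogonal" if "r \<in> SO" "R \<in> SO" for r and R :: "'m sqmat"
    using that by (simp add: pseudo_orthogonal_iff S_mat_def adj_block block_matrix_mult
        rotation_matrix_def orthogonal_matrix flip: mat_1_block)
  ultimately show ?thesis
    using connected_image_O_up[where f = "\<lambda>p. S_mat (fst p) (snd p)" and T = "SO \<times> SO"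
        and t = "(mat 1, mat 1)" and x = "(r, R)"] assms(2,3)
    by (auto simp: rotation_matrix_def orthogonal_matrix_id)
qed

lemma block_S_mat [simp]:
  "block_a (S_mat r R) = r" "block_b (S_mat r R) = 0" "block_c (S_mat r R) = 0" "block_d (S_mat r R) = R"
  by (simp_all add: S_mat_def)

lemma block_P_sec:
  assumes "\<beta> \<in> Omega"
  shows "block_a (P_sec \<beta>) = chol_a \<beta>" "block_b (P_sec \<beta>) = transpose \<beta> ** chol_d \<beta>"
    "block_c (P_sec \<beta>) = \<beta> ** chol_a \<beta>" "block_d (P_sec \<beta>) = chol_d \<beta>"
  by (simp_all add: P_sec_eq[OF assms] P_dir_def)

lemma det_chol_a:
  fixes \<beta> :: "'m::{finite,linorder} colpair"
  assumes "\<beta> \<in> Omega"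
  shows "det (chol_a \<beta>) \<noteq> 0"
  using det_triangular_pos(1)[OF Omega_positive_definite(1)[OF assms] chol_a_congruence[OF assms]] .

lemma pi2_eqI:
  assumes "det (block_a X) \<noteq> 0" "block_c X = \<beta> ** block_a X"
  shows "pi2 X = \<beta>"
  unfolding pi2_def assms(2) by (simp add: matrix_inv_right[OF assms(1)] flip: matrix_mul_assoc)

lemma pi2_mult_block_a:
  assumes "det (block_a X) \<noteq> 0"
  shows "pi2 X ** block_a X = block_c X"
  unfolding pi2_def by (simp add: matrix_inv_left[OF assms] flip: matrix_mul_assoc)

lemma pi2_P_sec:
  assumes "\<beta> \<in> Omega"
  shows "pi2 (P_sec \<beta>) = \<beta>"
  by (rule pi2_eqI) (simp_all add: block_P_sec assms det_chol_a)

lemma block_mult_S_mat: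
  "block_a (X ** S_mat r R) = block_a X ** r" "block_c (X ** S_mat r R) = block_c X ** r"
  "block_b (X ** S_mat r R) = block_b X ** R" "block_d (X ** S_mat r R) = block_d X ** R"
  by (simp_all add: block_mult)

lemma det_SO: "r \<in> SO \<Longrightarrow> det r = 1"
  by (simp add: rotation_matrix_def)

lemma pi2_mult_S_mat:
  assumes "det (block_a X) \<noteq> 0" "r \<in> SO"
  shows "pi2 (X ** S_mat r R) = pi2 X"
  by (rule pi2_eqI) (use assms det_SO[of r] in \<open>simp_all add: block_mult_S_mat det_mul pi2_mult_block_a[symmetric] matrix_mul_assoc\<close>)

text \<open>Writing x = a y turns \<open>pi2 X *v x\<close> into c y, and the first block relation
  says that the squared norm of x exceeds that of c y by the squared norm of y.\<close>

lemma pi2_Omega: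
  assumes X: "X \<in> O_up"
  shows "pi2 X \<in> Omega"
proof -
  let ?a = "block_a X"
  have d: "det ?a \<noteq> 0" using O_up_det_pos[OF X] by simp
  have "norm (pi2 X *v x) < norm x" if "x \<noteq> 0" for x
  proof -
    define y where "y = matrix_inv ?a *v x"
    have xy: "x = ?a *v y" by (simp add: y_def matrix_vector_mul_assoc matrix_inv_right[OF d])
    then have y0: "y \<noteq> 0" using that by auto
    have p: "pi2 X *v x = block_c X *v y"
      unfolding xy by (simp add: matrix_vector_mul_assoc pi2_mult_block_a[OF d])
    have X': "X \<in> pseudo_orthogonal" using X O_up_subset by blast
    have "(norm x)\<^sup>2 = (norm y)\<^sup>2 + (norm (block_c X *v y))\<^sup>2"
      unfolding xy norm_matrix_vector_sq O_up_block_relations(1)[OF X']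
      by (simp add: matrix_vector_mult_add_rdistrib inner_add_right dot_square_norm)
    then have "(norm (pi2 X *v x))\<^sup>2 < (norm x)\<^sup>2" using y0 p by simp
    then show ?thesis by (rule power2_less_imp_less) simp
  qed
  then show ?thesis by (simp add: Omega_iff)
qed

text \<open>With c = 0 the block relations make a orthogonal, then force b = 0, then make d
  orthogonal. The positive determinants select the special orthogonal groups.\<close>

lemma O_up_isotropy:
  assumes X: "X \<in> O_up" and c: "block_c X = 0"
  shows "\<exists>r\<in>SO. \<exists>R\<in>SO. X = S_mat r R"
proof -
  have X': "X \<in> pseudo_orthogonal" using X O_up_subset by blast
  have a: "transpose (block_a X) ** block_a X = mat 1"
    using O_up_block_relations(1)[OF X'] c by simp
  have "transpose (block_a X) ** block_b X = 0"
    using O_up_block_relations(3)[OF X'] c by simp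
  then have "block_a X ** (transpose (block_a X) ** block_b X) = 0" by simp
  moreover have "block_a X ** transpose (block_a X) = mat 1"
    using a by (simp add: matrix_left_right_inverse)
  ultimately have b: "block_b X = 0" by (simp add: matrix_mul_assoc)
  have d: "transpose (block_d X) ** block_d X = mat 1"
    using O_up_block_relations(2)[OF X'] b by simp
  have "rotation_matrix (block_a X)" "rotation_matrix (block_d X)"
    using a d O_up_det_pos[OF X] det_orthogonal_matrix[of "block_a X"] det_orthogonal_matrix[of "block_d X"]
    by (auto simp: rotation_matrix_def orthogonal_matrix)
  moreover have "X = S_mat (block_a X) (block_d X)"
    unfolding S_mat_def using block_matrix_collapse[of X] b c by simp
  ultimately show ?thesis by blast
qed

text \<open>Multiplying by the inverse of the section value over \<open>pi2 X\<close> moves the base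
  point to the origin, where the stabilizer is known.\<close>

lemma O_up_decomposition:
  assumes X: "X \<in> O_up"
  shows "\<exists>r\<in>SO. \<exists>R\<in>SO. X = P_sec (pi2 X) ** S_mat r R"
proof -
  let ?\<beta> = "pi2 X"
  have b: "?\<beta> \<in> Omega" by (rule pi2_Omega[OF X])
  have d: "det (block_a X) \<noteq> 0" using O_up_det_pos[OF X] by simp
  define Y where "Y = adj (P_sec ?\<beta>) ** X"
  have Y: "Y \<in> O_up" unfolding Y_def using X b by (intro O_up_mult O_up_adj P_sec_O_up)
  have "block_c Y = 0"
    unfolding Y_def block_mult block_adj block_P_sec[OF b] pi2_mult_block_a[OF d, symmetric]
    by (simp add: matrix_transpose_mul matrix_mul_assoc)
  then obtain r R where "r \<in> SO" "R \<in> SO" "Y = S_mat r R" using O_up_isotropy[OF Y] by blast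
  moreover have "X = P_sec ?\<beta> ** Y"
    unfolding Y_def by (simp add: matrix_mul_assoc O_up_adj_right P_sec_O_up b)
  ultimately show ?thesis by blast
qed

lemma pi2_P_sec_S_mat:
  assumes "\<beta> \<in> Omega" "r \<in> SO"
  shows "pi2 (P_sec \<beta> ** S_mat r R) = \<beta>"
  using pi2_mult_S_mat[of "P_sec \<beta>" r R] assms by (simp add: block_P_sec det_chol_a pi2_P_sec)

lemma P_sec_S_mat_inject:
  assumes "\<beta> \<in> Omega" "\<beta>' \<in> Omega" "r \<in> SO" "r' \<in> SO"
    and e: "P_sec \<beta> ** S_mat r R = P_sec \<beta>' ** S_mat r' R'"
  shows "\<beta> = \<beta>' \<and> r = r' \<and> R = R'"
proof -
  have "pi2 (P_sec \<beta> ** S_mat r R) = \<beta>" "pi2 (P_sec \<beta>' ** S_mat r' R') = \<beta>'"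
    by (intro pi2_P_sec_S_mat assms)+
  then have b: "\<beta> = \<beta>'" using e by simp
  have "adj (P_sec \<beta>) ** (P_sec \<beta> ** S_mat r R) = adj (P_sec \<beta>) ** (P_sec \<beta> ** S_mat r' R')"
    using e b by simp
  then have "S_mat r R = S_mat r' R'"
    by (simp add: matrix_mul_assoc O_up_adj_left P_sec_O_up assms(1))
  then show ?thesis using b by (simp add: S_mat_def block_matrix_eq_iff)
qed

text \<open>This evaluates the definite description behind \<open>psi\<close> and
  \<open>Psi\<close>: any factorization through the section, found by whatever means, yields the
  values of all three maps.\<close>

lemma psi_Psi_unique:
  assumes "\<beta> \<in> Omega" "r \<in> SO" "R \<in> SO" "X = P_sec \<beta> ** S_mat r R"
  shows "pi2 X = \<beta>" "psi X = r" "Psi X = R"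
proof -
  show b: "pi2 X = \<beta>"
    unfolding assms(4) by (rule pi2_P_sec_S_mat[OF assms(1,2)])
  have "psi_Psi X = (r, R)"
    unfolding psi_Psi_def b
  proof (rule the_equality)
    show "case (r, R) of (r, R) \<Rightarrow> r \<in> SO \<and> R \<in> SO \<and> X = P_sec \<beta> ** S_mat r R"
      using assms by simp
    fix p assume p: "case p of (r, R) \<Rightarrow> r \<in> SO \<and> R \<in> SO \<and> X = P_sec \<beta> ** S_mat r R"
    obtain r' R' where p': "p = (r', R')" by (rule prod.exhaust)
    with p have "r' \<in> SO" and e: "X = P_sec \<beta> ** S_mat r' R'" by (simp_all only: prod.case)
    from P_sec_S_mat_inject[OF assms(1,1) this(1) assms(2) trans[OF e[symmetric] assms(4)]]
    show "p = (r, R)" unfolding p' by blast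
  qed
  then show "psi X = r" "Psi X = R" by (simp_all add: psi_def Psi_def)
qed

lemma psi_Psi:
  assumes X: "X \<in> O_up"
  shows "psi X \<in> SO" "Psi X \<in> SO" "X = P_sec (pi2 X) ** S_mat (psi X) (Psi X)"
proof -
  obtain r R where r: "r \<in> SO" and R: "R \<in> SO" and e: "X = P_sec (pi2 X) ** S_mat r R"
    using O_up_decomposition[OF X] by blast
  note u = psi_Psi_unique(2,3)[OF pi2_Omega[OF X] r R e]
  show "psi X \<in> SO" "Psi X \<in> SO" "X = P_sec (pi2 X) ** S_mat (psi X) (Psi X)"
    unfolding u by (fact r, fact R, fact e)
qed

text \<open>A closed formula in terms of smooth maps, from which the smoothness of
  \<open>psi\<close> and \<open>Psi\<close> is read off.\<close>

lemma psi_Psi_block: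
  assumes X: "X \<in> O_up"
  shows "psi X = block_a (adj (P_sec (pi2 X)) ** X)" "Psi X = block_d (adj (P_sec (pi2 X)) ** X)"
proof -
  have "adj (P_sec (pi2 X)) ** X = adj (P_sec (pi2 X)) ** (P_sec (pi2 X) ** S_mat (psi X) (Psi X))"
    by (rule arg_cong[OF psi_Psi(3)[OF X]])
  also have "\<dots> = S_mat (psi X) (Psi X)"
    by (simp add: matrix_mul_assoc O_up_adj_left P_sec_O_up pi2_Omega X)
  finally have "adj (P_sec (pi2 X)) ** X = S_mat (psi X) (Psi X)" .
  then show "psi X = block_a (adj (P_sec (pi2 X)) ** X)" "Psi X = block_d (adj (P_sec (pi2 X)) ** X)"
    by simp_all
qed

lemma smooth_on_block:
  fixes f :: "'a::euclidean_space \<Rightarrow> 'm::finite pmat"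
  assumes "smooth_on S f"
  shows "smooth_on S (\<lambda>x. block_a (f x))" "smooth_on S (\<lambda>x. block_b (f x))"
    "smooth_on S (\<lambda>x. block_c (f x))" "smooth_on S (\<lambda>x. block_d (f x))"
  using assms by (auto intro: smooth_on_linear_compose bounded_linear_block)

lemma smooth_on_pi2: "smooth_on O_up pi2"
  unfolding pi2_def
  by (intro smooth_on_matrix_mult smooth_on_matrix_inv smooth_on_block smooth_on_id)
     (use O_up_det_pos in force)

lemma smooth_on_psi_Psi:
  "smooth_on (O_up :: 'm::{finite,linorder} pmat set) psi" "smooth_on (O_up :: 'm pmat set) Psi"
proof -
  have P: "smooth_on O_up (\<lambda>X. P_sec (pi2 X))"
    by (rule smooth_on_compose[OF smooth_on_P_sec smooth_on_pi2]) (rule pi2_Omega)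
  have "smooth_on O_up (\<lambda>X. adj (P_sec (pi2 X)) ** X)"
    by (rule smooth_on_matrix_mult[OF smooth_on_linear_compose[OF bounded_linear_adj P] smooth_on_id])
  from smooth_on_block(1,4)[OF this]
  show "smooth_on (O_up :: 'm pmat set) psi" "smooth_on (O_up :: 'm pmat set) Psi"
    by (auto elim: smooth_on_cong simp: psi_Psi_block)
qed

section \<open>Angles\<close>

text \<open>An upper triangular left factor only rescales the last row, and on \<open>SO(2)\<close> the last row gives an
  isomorphism onto the unit circle.\<close>

definition lam2 :: "real^2^2 \<Rightarrow> complex" where
  "lam2 A = Complex (A $ 1 $ 1) (A $ 1 $ 0)"

lemma two_neq [simp]: "(0::2) \<noteq> 1" "(1::2) \<noteq> 0"
  by simp_all

lemma matrix_mult_two: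
  fixes A :: "real^2^'n" and B :: "real^'p^2"
  shows "(A ** B) $ i $ j = A $ i $ 0 * B $ 0 $ j + A $ i $ 1 * B $ 1 $ j"
  by (simp add: matrix_matrix_mult_def sum_two)

lemma bounded_linear_lam2: "bounded_linear lam2"
  unfolding linear_conv_bounded_linear[symmetric] linear_iff
  by (simp add: lam2_def complex_eq_iff)

lemma rho_nth [simp]:
  "rho t $ 0 $ 0 = cos t" "rho t $ 0 $ 1 = - sin t" "rho t $ 1 $ 0 = sin t" "rho t $ 1 $ 1 = cos t"
  by (simp_all add: rho_def)

lemma lam2_rho [simp]: "lam2 (rho t) = cis t"
  by (simp add: lam2_def complex_eq_iff)

lemma det_two: "det (A :: real^2^2) = A $ 0 $ 0 * A $ 1 $ 1 - A $ 0 $ 1 * A $ 1 $ 0"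
proof -
  have two: "(2::2) = 0" by simp
  show ?thesis unfolding det_2 two by simp
qed

lemma SO_two_nth:
  fixes r :: "real^2^2"
  assumes "r \<in> SO"
  shows "r $ 0 $ 0 = r $ 1 $ 1" "r $ 0 $ 1 = - r $ 1 $ 0" "(r $ 1 $ 1)\<^sup>2 + (r $ 1 $ 0)\<^sup>2 = 1"
proof -
  have "transpose r ** r = mat 1" "det r = 1"
    using assms by (auto simp: rotation_matrix_def orthogonal_matrix)
  then have m: "(transpose r ** r) $ i $ j = (if i = j then 1 else 0)" and d: "det r = 1" for i j
    by (simp_all add: mat_def)
  have *: "r $ 0 $ 0 * r $ 0 $ 0 + r $ 1 $ 0 * r $ 1 $ 0 = 1"
    "r $ 0 $ 1 * r $ 0 $ 1 + r $ 1 $ 1 * r $ 1 $ 1 = 1"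
    "r $ 0 $ 0 * r $ 1 $ 1 - r $ 0 $ 1 * r $ 1 $ 0 = 1"
    using m[of 0 0] m[of 1 1] d by (simp_all add: matrix_mult_two transpose_def det_two)
  then have "(r $ 0 $ 0 - r $ 1 $ 1)\<^sup>2 + (r $ 0 $ 1 + r $ 1 $ 0)\<^sup>2 = 0"
    by (simp add: power2_eq_square algebra_simps)
  then show e: "r $ 0 $ 0 = r $ 1 $ 1" "r $ 0 $ 1 = - r $ 1 $ 0"
    by (simp_all add: sum_power2_eq_zero_iff)
  show "(r $ 1 $ 1)\<^sup>2 + (r $ 1 $ 0)\<^sup>2 = 1"
    using *(1) unfolding e by (simp add: power2_eq_square)
qed

lemma norm_lam2_SO: "r \<in> SO \<Longrightarrow> norm (lam2 r) = 1"
  using SO_two_nth(3)[of r] by (simp add: lam2_def cmod_def)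

lemma lam2_SO_nonzero: "r \<in> SO \<Longrightarrow> lam2 r \<noteq> 0"
  using norm_lam2_SO by force

lemma lam2_inject:
  assumes "r \<in> SO" "r' \<in> SO" "lam2 r = lam2 r'"
  shows "r = r'"
  using SO_two_nth[OF assms(1)] SO_two_nth[OF assms(2)] assms(3)
  by (simp add: lam2_def vec_eq_iff forall_two)

lemma lam2_mult_SO:
  assumes "r \<in> SO"
  shows "lam2 (A ** r) = lam2 A * lam2 r"
  using SO_two_nth[OF assms] by (simp add: lam2_def complex_eq_iff matrix_mult_two algebra_simps)

lemma rho_SO [simp]: "rho t \<in> SO"
  by (simp add: rotation_matrix_def orthogonal_matrix vec_eq_iff forall_two matrix_mult_two transpose_def
      mat_def det_two flip: power2_eq_square)

lemma SO_mult:
  fixes A B :: "real^'k^'k"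
  shows "A \<in> SO \<Longrightarrow> B \<in> SO \<Longrightarrow> A ** B \<in> SO"
  by (simp add: rotation_matrix_def orthogonal_matrix_mul det_mul)

lemma SO_transpose:
  fixes A :: "real^'k^'k"
  shows "A \<in> SO \<Longrightarrow> transpose A \<in> SO"
  by (simp add: rotation_matrix_def)

lemma SO_inv:
  fixes A :: "real^'k^'k"
  assumes "A \<in> SO"
  shows "matrix_inv A = transpose A" "A ** transpose A = mat 1" "transpose A ** A = mat 1"
  using assms by (auto simp: rotation_matrix_def orthogonal_matrix_def intro: matrix_inv_unique)

lemma mat_1_SO [simp]: "mat 1 \<in> (SO :: (real^'k^'k) set)"
  by (simp add: rotation_matrix_def orthogonal_matrix_id)

lemma rotation_matrix_simps [simp]: "rotation_matrix (mat 1)" "rotation_matrix (rho t)"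
  using rho_SO by (simp_all add: rotation_matrix_def orthogonal_matrix_id)

lemma lam2_mat_1 [simp]: "lam2 (mat 1) = 1"
  by (simp add: lam2_def complex_eq_iff mat_def)

lemma lam2_transpose_SO:
  assumes "r \<in> SO"
  shows "lam2 (transpose r) = inverse (lam2 r)"
proof -
  have "lam2 (transpose r) * lam2 r = 1"
    using lam2_mult_SO[OF assms, of "transpose r"] SO_inv[OF assms] by simp
  then show ?thesis using lam2_SO_nonzero[OF assms] by (simp add: field_simps)
qed

lemma triangular_pos_two:
  assumes "triangular_pos (U :: real^2^2)"
  shows "U $ 1 $ 0 = 0" "U $ 0 $ 0 > 0" "U $ 1 $ 1 > 0"
proof -
  have "(0::2) < 1" by (simp add: less_bit0_def bit0.Rep_0 bit0.Rep_1)
  then show "U $ 1 $ 0 = 0" "U $ 0 $ 0 > 0" "U $ 1 $ 1 > 0"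
    using assms by (auto simp: triangular_pos_def)
qed

lemma lam2_triangular_mult:
  assumes "triangular_pos U"
  shows "lam2 (U ** A) = of_real (U $ 1 $ 1) * lam2 A"
  using triangular_pos_two[OF assms] by (simp add: lam2_def complex_eq_iff matrix_mult_two)

lemma lam2_triangular:
  assumes "triangular_pos U"
  shows "lam2 U = of_real (U $ 1 $ 1)"
  using triangular_pos_two[OF assms] by (simp add: lam2_def complex_eq_iff)

text \<open>Right multiplication by \<open>U\<close> acts on the last row as a real linear map with positive
  eigenvalues, so it never turns a vector into a nonpositive multiple of itself.\<close>

lemma lam2_mult_triangular_ratio:
  assumes U: "triangular_pos U" and A: "lam2 A \<noteq> 0"
  shows "lam2 (A ** U) / lam2 A \<notin> \<real>\<^sub>\<le>\<^sub>0"
proof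
  assume "lam2 (A ** U) / lam2 A \<in> \<real>\<^sub>\<le>\<^sub>0"
  then obtain c where c: "c \<le> 0" "lam2 (A ** U) / lam2 A = of_real c"
    by (auto elim: nonpos_Reals_cases)
  then have "lam2 (A ** U) = of_real c * lam2 A" using A by (simp add: field_simps)
  then have e: "A $ 1 $ 0 * U $ 0 $ 0 = c * A $ 1 $ 0"
    "A $ 1 $ 0 * U $ 0 $ 1 + A $ 1 $ 1 * U $ 1 $ 1 = c * A $ 1 $ 1"
    using triangular_pos_two[OF U] by (simp_all add: lam2_def complex_eq_iff matrix_mult_two)
  have "A $ 1 $ 0 = 0" using e(1) c(1) triangular_pos_two[OF U] by auto
  moreover from this have "A $ 1 $ 1 = 0" using e(2) c(1) triangular_pos_two[OF U] by auto
  ultimately show False using A by (simp add: lam2_def complex_eq_iff)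
qed

text \<open>If the value is real, then the entry \<open>A $ 1 $ 0\<close> vanishes, and what remains
  is the product of two positive diagonal entries.\<close>

lemma lam2_mult_triangular_half_plane:
  assumes U: "triangular_pos U" and A: "A $ 1 $ 1 > 0"
  shows "lam2 (A ** U) \<notin> \<real>\<^sub>\<le>\<^sub>0"
  using triangular_pos_two[OF U] A
  by (auto simp: lam2_def complex_nonpos_Reals_iff matrix_mult_two not_le)

lemma smooth_on_arg:
  fixes f :: "'a::euclidean_space \<Rightarrow> complex"
  assumes "smooth_on S f" "\<And>x. x \<in> S \<Longrightarrow> f x \<notin> \<real>\<^sub>\<le>\<^sub>0"
  shows "smooth_on S (\<lambda>x. Im (Ln (f x)))"
  by (rule smooth_on_linear_compose[OF bounded_linear_Im smooth_on_compose[OF smooth_on_Ln assms(1)]])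
     (use assms(2) in auto)

lemma sgn_unit: "norm z = 1 \<Longrightarrow> sgn z = (z :: complex)"
  by (simp add: sgn_div_norm)

lemma cis_Im_Ln:
  assumes "z \<noteq> 0"
  shows "cis (Im (Ln z)) = sgn z"
proof -
  have "sgn (exp (Ln z)) = cis (Im (Ln z))"
    unfolding exp_eq_polar[of "Ln z"] by (simp add: sgn_mult sgn_of_real sgn_unit)
  then show ?thesis using assms by simp
qed

section \<open>Lifts of angles on connected sets\<close>

lemma cis_eq_1D:
  assumes "cis t = 1"
  obtains k :: int where "t = 2 * pi * of_int k"
proof -
  have "cos t = 1" using assms by (simp add: complex_eq_iff)
  then obtain k :: int where "t = of_int k * 2 * pi" using cos_one_2pi_int by blast
  then show thesis by (intro that[of k]) simp
qed

text \<open>\<open>d\<close> takes values among the multiples of 2 pi. Distinct multiples are at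
  least 2 pi apart, so a continuous \<open>d\<close> is constant on a connected set.\<close>

lemma connected_angle_zero:
  fixes d :: "'a::topological_space \<Rightarrow> real"
  assumes "connected S" "continuous_on S d" "\<And>x. x \<in> S \<Longrightarrow> cis (d x) = 1" "a \<in> S" "d a = 0" "x \<in> S"
  shows "d x = 0"
proof -
  have "d constant_on S"
  proof (rule continuous_discrete_range_constant[OF assms(1,2)])
    fix x assume x: "x \<in> S"
    have "2 * pi \<le> norm (d y - d x)" if y: "y \<in> S" "d y \<noteq> d x" for y
    proof -
      have "cis (d y - d x) = 1" using assms(3)[OF x] assms(3)[OF y(1)] by (simp flip: cis_divide)
      then obtain k :: int where k: "d y - d x = 2 * pi * of_int k" by (rule cis_eq_1D)
      then have "k \<noteq> 0" using y by auto
      then have "1 \<le> \<bar>of_int k :: real\<bar>" by linarith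
      then show ?thesis unfolding k by (simp add: abs_mult)
    qed
    then show "\<exists>e>0. \<forall>y. y \<in> S \<and> d y \<noteq> d x \<longrightarrow> e \<le> norm (d y - d x)"
      by (intro exI[of _ "2 * pi"]) auto
  qed
  then show ?thesis using assms(4-6) unfolding constant_on_def by metis
qed

lemma rho_lift_unique:
  fixes h h' :: "'a::topological_space \<Rightarrow> real"
  assumes "connected S" "continuous_on S h" "continuous_on S h'"
    "\<And>x. x \<in> S \<Longrightarrow> rho (h x) = rho (h' x)" "a \<in> S" "h a = h' a" "x \<in> S"
  shows "h x = h' x"
proof -
  have "cis (h y - h' y) = 1" if "y \<in> S" for y
    using arg_cong[OF assms(4)[OF that], of lam2] by (simp flip: cis_divide)
  moreover have "continuous_on S (\<lambda>x. h x - h' x)" using assms(2,3) by (rule continuous_on_diff)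
  ultimately have "h x - h' x = 0"
    using connected_angle_zero[OF assms(1), of "\<lambda>x. h x - h' x" a x] assms(5-7) by simp
  then show ?thesis by simp
qed

text \<open>Reduces a definite description of the kind used for \<open>eta\<close> and
  \<open>Theta\<close> to exhibiting one explicit lift. The description also demands extensionality,
  so the described function is the restriction of that lift; \<open>Q\<close> is kept abstract to
  match the form of both definitions.\<close>

lemma the_angle_lift:
  fixes h :: "'a::euclidean_space \<Rightarrow> real"
  assumes S: "connected S" "a \<in> S" and h: "smooth_on S h" "\<And>x. x \<in> S \<Longrightarrow> rho (h x) = w x" "h a = 0"
    and Q: "\<And>h. Q h \<longleftrightarrow> h \<in> extensional S \<and> smooth_on S h \<and> (\<forall>x\<in>S. rho (h x) = w x) \<and> h a = 0"
    and x: "x \<in> S"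
  shows "(THE h. Q h) x = h x"
proof -
  have "(THE h. Q h) = restrict h S"
  proof (rule the_equality)
    have "smooth_on S (restrict h S)" by (rule smooth_on_cong[OF h(1)]) simp
    then show "Q (restrict h S)" unfolding Q using h S(2) by simp
    fix g assume "Q g"
    then have g: "g \<in> extensional S" "smooth_on S g" "\<forall>x\<in>S. rho (g x) = w x" "g a = 0"
      unfolding Q by auto
    have "g x = h x" if "x \<in> S" for x
      by (rule rho_lift_unique[of S g h a x])
         (use S g h that in \<open>auto intro: smooth_on_imp_continuous_on\<close>)
    then show "g = restrict h S" using g(1) by (auto simp: extensional_def fun_eq_iff)
  qed
  then show ?thesis using x by simp
qed

text \<open>Linear on all matrices, so the angle of \<open>psi X\<close> can be followed by a smooth
  formula in \<open>X\<close>; the link is \<open>sgn_lam\<close>.\<close>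

definition lam :: "'m::finite pmat \<Rightarrow> complex" where
  "lam X = lam2 (block_a X)"

lemma bounded_linear_lam: "bounded_linear lam"
  unfolding lam_def by (rule bounded_linear_compose[OF bounded_linear_lam2 bounded_linear_block(1)])

lemma block_a_psi:
  assumes "X \<in> O_up"
  shows "block_a X = chol_a (pi2 X) ** psi X"
  using arg_cong[OF psi_Psi(3)[OF assms], of block_a]
  by (simp only: block_mult_S_mat block_P_sec pi2_Omega[OF assms])

lemma lam_eq:
  assumes "X \<in> O_up"
  shows "lam X = of_real (chol_a (pi2 X) $ 1 $ 1) * lam2 (psi X)" "chol_a (pi2 X) $ 1 $ 1 > 0"
  unfolding lam_def block_a_psi[OF assms]
  using triangular_pos_chol_a[OF pi2_Omega[OF assms]]
  by (simp_all add: lam2_triangular_mult triangular_pos_two)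

lemma lam_nonzero:
  fixes X :: "'m::{finite,linorder} pmat"
  assumes "X \<in> O_up"
  shows "lam X \<noteq> 0"
  using lam_eq[OF assms] lam2_SO_nonzero[OF psi_Psi(1)[OF assms]] by simp

lemma sgn_lam:
  assumes "X \<in> O_up"
  shows "sgn (lam X) = lam2 (psi X)"
  using lam_eq[OF assms] norm_lam2_SO[OF psi_Psi(1)[OF assms]]
  by (simp add: sgn_mult sgn_of_real sgn_unit)

lemma psi_eq_rho_iff:
  assumes "X \<in> O_up"
  shows "psi X = rho t \<longleftrightarrow> sgn (lam X) = cis t"
  unfolding sgn_lam[OF assms] using lam2_inject[OF psi_Psi(1)[OF assms] rho_SO[of t]] by auto

lemma psi_mult_S_mat:
  assumes X: "X \<in> O_up" and r: "r \<in> SO" and R: "R \<in> SO"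
  shows "psi (X ** S_mat r R) = psi X ** r"
proof (rule psi_Psi_unique)
  have "X ** S_mat r R = (P_sec (pi2 X) ** S_mat (psi X) (Psi X)) ** S_mat r R"
    using psi_Psi(3)[OF X] by (rule arg_cong)
  also have "\<dots> = P_sec (pi2 X) ** S_mat (psi X ** r) (Psi X ** R)"
    by (simp add: matrix_mul_assoc[symmetric] S_mat_def block_matrix_mult)
  finally show "X ** S_mat r R = P_sec (pi2 X) ** S_mat (psi X ** r) (Psi X ** R)" .
qed (use psi_Psi[OF X] r R SO_mult pi2_Omega[OF X] in blast)+

lemma frak_r_eq:
  assumes "\<beta> \<in> Omega" "\<beta>' \<in> Omega"
  shows "frak_r \<beta> \<beta>' = psi (P_sec \<beta> ** P_sec \<beta>')"
proof -
  let ?X = "P_sec \<beta> ** P_sec \<beta>'"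
  have X: "?X \<in> O_up" using assms by (intro O_up_mult P_sec_O_up)
  have "mrR \<beta> \<beta>' = (pi2 ?X, psi ?X, Psi ?X)"
    unfolding mrR_def
  proof (rule the_equality)
    show "case (pi2 ?X, psi ?X, Psi ?X) of (m, r, R) \<Rightarrow>
        m \<in> Omega \<and> r \<in> SO \<and> R \<in> SO \<and> ?X = P_sec m ** S_mat r R"
      using psi_Psi[OF X] pi2_Omega[OF X] by simp
    fix p assume p: "case p of (m, r, R) \<Rightarrow>
        m \<in> Omega \<and> r \<in> SO \<and> R \<in> SO \<and> ?X = P_sec m ** S_mat r R"
    obtain m r R where p': "p = (m, r, R)" by (rule prod_cases3)
    with p have "m \<in> Omega" "r \<in> SO" "R \<in> SO" "?X = P_sec m ** S_mat r R" by (simp_all only: prod.case)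
    from psi_Psi_unique[OF this] show "p = (pi2 ?X, psi ?X, Psi ?X)" by (simp only: p')
  qed
  then show ?thesis by (simp add: frak_r_def)
qed

text \<open>The upper left block of the product is \<open>A ** chol_a \<beta>'\<close> with
  \<open>A\<close> equal to a + b \<beta>'. The last diagonal entry of \<open>A\<close> is positive
  because the last row of b is shorter than the last diagonal entry of a and \<beta>' is a
  contraction; the half-plane lemma then applies.\<close>

lemma lam_P_sec_mult:
  assumes b: "\<beta> \<in> Omega" and b': "\<beta>' \<in> Omega"
  shows "lam (P_sec \<beta> ** P_sec \<beta>') \<notin> \<real>\<^sub>\<le>\<^sub>0"
proof -
  let ?a = "chol_a \<beta>" and ?b = "block_b (P_sec \<beta>)"
  define A where "A = ?a + ?b ** \<beta>'"
  have "block_a (P_sec \<beta> ** P_sec \<beta>') = A ** chol_a \<beta>'"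
    unfolding A_def by (simp add: block_mult block_P_sec b b' bounded_bilinear.add_left[OF bounded_bilinear_matrix_mult] matrix_mul_assoc)
  moreover have "A $ 1 $ 1 > 0"
  proof -
    have a: "?a $ 1 $ 0 = 0" "?a $ 1 $ 1 > 0"
      using triangular_pos_two[OF triangular_pos_chol_a[OF b]] by auto
    \<comment> \<open>The right inverse gives a relation between rows. The last row of a is zero
      except for its diagonal entry, so the squared length of the last row of b is the square of
      that entry minus 1.\<close>
    have "P_sec \<beta> ** adj (P_sec \<beta>) = mat 1" by (rule O_up_adj_right[OF P_sec_O_up[OF b]])
    from arg_cong[OF this, of block_a]
    have "?a ** transpose ?a - ?b ** transpose ?b = mat 1"
      by (simp add: block_mult block_adj block_P_sec(1)[OF b])
    then have "(?a ** transpose ?a - ?b ** transpose ?b) $ 1 $ 1 = 1" by (simp add: mat_def)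
    moreover have "(?b ** transpose ?b) $ 1 $ 1 = (norm (?b $ 1))\<^sup>2"
      by (simp add: power2_norm_eq_inner inner_vec_def matrix_matrix_mult_def transpose_def)
    moreover have "(?a ** transpose ?a) $ 1 $ 1 = (?a $ 1 $ 1)\<^sup>2"
      using a(1) by (simp add: matrix_mult_two transpose_def power2_eq_square)
    ultimately have "(norm (?b $ 1))\<^sup>2 < (?a $ 1 $ 1)\<^sup>2"
      unfolding vector_minus_component by linarith
    then have n: "norm (?b $ 1) < ?a $ 1 $ 1"
      by (rule power2_less_imp_less[OF _ less_imp_le[OF a(2)]])
    have "(?b ** \<beta>') $ 1 $ 1 = ?b $ 1 \<bullet> (\<beta>' *v axis 1 1)"
      by (simp add: matrix_vector_mult_basis column_def inner_vec_def matrix_matrix_mult_def)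
    also have "\<bar>\<dots>\<bar> \<le> norm (?b $ 1) * norm (\<beta>' *v axis 1 1)" by (rule Cauchy_Schwarz_ineq2)
    also have "\<dots> \<le> norm (?b $ 1) * 1"
    proof (rule mult_left_mono)
      have "norm (\<beta>' *v axis 1 1) < norm (axis 1 (1::real) :: real^2)"
        using b' unfolding Omega_iff by (metis axis_eq_0_iff zero_neq_one)
      then show "norm (\<beta>' *v axis 1 1) \<le> 1" by simp
    qed simp
    finally show ?thesis using n by (simp add: A_def)
  qed
  ultimately show ?thesis
    unfolding lam_def using lam2_mult_triangular_half_plane[OF triangular_pos_chol_a[OF b']] by simp
qed

lemma P_sec_0 [simp]: "P_sec 0 = mat 1"
  by (simp add: P_sec_eq P_dir_def flip: mat_1_block)

lemma smooth_on_Theta_lift: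
  "smooth_on (Omega \<times> Omega)
    (\<lambda>p :: 'm::{finite,linorder} colpair \<times> 'm colpair. Im (Ln (lam (P_sec (fst p) ** P_sec (snd p)))))"
proof -
  have P: "smooth_on (Omega \<times> Omega) (\<lambda>p :: 'm colpair \<times> 'm colpair. P_sec (fst p))"
    "smooth_on (Omega \<times> Omega) (\<lambda>p :: 'm colpair \<times> 'm colpair. P_sec (snd p))"
    by (rule smooth_on_compose[OF smooth_on_P_sec], auto intro: smooth_on_bounded_linear bounded_linear_fst bounded_linear_snd)+
  show ?thesis
    by (rule smooth_on_arg[OF smooth_on_linear_compose[OF bounded_linear_lam smooth_on_matrix_mult[OF P]]])
       (auto simp: lam_P_sec_mult)
qed

lemma Theta_eq:
  fixes \<beta> \<beta>' :: "'m::{finite,linorder} colpair"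
  assumes "\<beta> \<in> Omega" "\<beta>' \<in> Omega"
  shows "Theta (\<beta>, \<beta>') = Im (Ln (lam (P_sec \<beta> ** P_sec \<beta>')))"
proof -
  let ?h' = "\<lambda>p :: 'm colpair \<times> 'm colpair. Im (Ln (lam (P_sec (fst p) ** P_sec (snd p))))"
  let ?O = "Omega \<times> Omega :: ('m colpair \<times> 'm colpair) set"
  have "Theta (\<beta>, \<beta>') = ?h' (\<beta>, \<beta>')"
    unfolding Theta_def
  proof (rule the_angle_lift[where S = ?O and a = "(0, 0)" and w = "\<lambda>p. frak_r (fst p) (snd p)"])
    show "connected ?O" by (intro connected_Times connected_Omega)
    show "smooth_on ?O ?h'" by (rule smooth_on_Theta_lift)
    show "rho (?h' p) = frak_r (fst p) (snd p)" if "p \<in> ?O" for p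
    proof -
      have b: "fst p \<in> Omega" "snd p \<in> Omega" using that by auto
      then have X: "P_sec (fst p) ** P_sec (snd p) \<in> O_up" by (intro O_up_mult P_sec_O_up)
      show ?thesis
        unfolding frak_r_eq[OF b] by (rule sym) (simp only: psi_eq_rho_iff[OF X] cis_Im_Ln lam_nonzero[OF X] not_False_eq_True)
    qed
    show "?h' (0, 0) = 0" by (simp add: lam_def P_sec_0)
  qed (use assms in auto)
  then show ?thesis by simp
qed

lemma chol_a_orthogonal_mult:
  assumes "orthogonal_matrix R"
  shows "chol_a (R ** \<beta>) = chol_a \<beta>"
proof -
  have "transpose (R ** \<beta>) ** (R ** \<beta>) = transpose \<beta> ** (transpose R ** R) ** \<beta>"
    by (simp only: matrix_transpose_mul matrix_mul_assoc)
  then show ?thesis using assms by (simp add: chol_a_def orthogonal_matrix)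
qed

text \<open>Moves an isotropy matrix past the section. The matrix in the definition of
  \<open>eta\<close> thereby becomes \<open>psi Y ** matrix_inv r\<close>, in particular a rotation;
  \<open>R\<close> has no influence on the angle since \<open>chol_a\<close> is invariant under
  orthogonal left factors.\<close>

lemma psi_S_mat_mult_P_sec:
  fixes \<beta> :: "'m::{finite,linorder} colpair" and r :: "real^2^2"
  assumes card: "2 \<le> CARD('m)" and b: "\<beta> \<in> Omega" and r: "r \<in> SO" and R: "R \<in> SO"
  defines "Y \<equiv> S_mat r R ** P_sec \<beta>"
  shows "Y \<in> O_up" "pi2 Y = R ** \<beta> ** matrix_inv r"
    "psi Y = matrix_inv (a_hat (\<beta> ** matrix_inv r)) ** r ** a_hat \<beta>"
    "\<beta> ** matrix_inv r \<in> Omega"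
proof -
  show Y: "Y \<in> O_up"
    unfolding Y_def by (intro O_up_mult S_mat_O_up P_sec_O_up assms)
  have rr: "transpose r ** r = mat 1" "matrix_inv r = transpose r" using SO_inv[OF r] by auto
  have o: "orthogonal_matrix R" "orthogonal_matrix (transpose r)" using R r by (auto simp: rotation_matrix_def)
  show b': "\<beta> ** matrix_inv r \<in> Omega"
    using Omega_orthogonal[OF b orthogonal_matrix_id o(2)] rr by simp
  have a: "block_a Y = r ** chol_a \<beta>"
    unfolding Y_def by (simp add: block_mult block_P_sec[OF b])
  have "block_c Y = (R ** \<beta> ** transpose r) ** block_a Y"
  proof -
    have "(R ** \<beta> ** transpose r) ** block_a Y = R ** \<beta> ** (transpose r ** r) ** chol_a \<beta>"
      unfolding a by (simp only: matrix_mul_assoc)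
    then show ?thesis
      unfolding Y_def by (simp add: block_mult block_P_sec[OF b] rr(1) matrix_mul_assoc)
  qed
  then show p: "pi2 Y = R ** \<beta> ** matrix_inv r"
    unfolding rr(2) by (rule pi2_eqI[rotated]) (use O_up_det_pos[OF Y] in simp)
  have "chol_a (pi2 Y) = chol_a (\<beta> ** matrix_inv r)"
    unfolding p using chol_a_orthogonal_mult[OF o(1), of "\<beta> ** matrix_inv r"] by (simp add: matrix_mul_assoc)
  then have "a_hat (\<beta> ** matrix_inv r) ** psi Y = r ** a_hat \<beta>"
    using block_a_psi[OF Y] a by (simp add: a_hat_eq b b')
  then have "matrix_inv (a_hat (\<beta> ** matrix_inv r)) ** (a_hat (\<beta> ** matrix_inv r) ** psi Y) =
      matrix_inv (a_hat (\<beta> ** matrix_inv r)) ** (r ** a_hat \<beta>)" by (rule arg_cong)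
  moreover have "matrix_inv (a_hat (\<beta> ** matrix_inv r)) ** (a_hat (\<beta> ** matrix_inv r) ** psi Y) = psi Y"
    using matrix_inv_left[OF det_chol_a[OF b']] by (simp add: matrix_mul_assoc a_hat_eq b')
  ultimately show "psi Y = matrix_inv (a_hat (\<beta> ** matrix_inv r)) ** r ** a_hat \<beta>"
    by (simp add: matrix_mul_assoc)
qed

text \<open>The right-hand side is \<open>psi Y\<close> times the inverse of \<open>r\<close>, and
  the angle of \<open>psi Y\<close> is that of \<open>lam Y\<close>. Dividing by the unit number
  \<open>lam2 r\<close> subtracts the angle of \<open>r\<close>.\<close>

lemma eta_lift:
  fixes \<beta> :: "'m::{finite,linorder} colpair"
  assumes card: "2 \<le> CARD('m)" and b: "\<beta> \<in> Omega" and r: "r \<in> SO"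
  shows "rho (Im (Ln (lam2 (r ** chol_a \<beta>) / lam2 r))) =
    matrix_inv (a_hat (\<beta> ** matrix_inv r)) ** r ** a_hat \<beta> ** matrix_inv r"
proof -
  define Y where "Y = S_mat r (mat 1) ** P_sec \<beta>"
  note Y = psi_S_mat_mult_P_sec[OF card b r mat_1_SO, folded Y_def]
  have y: "sgn (lam Y) = lam2 (psi Y)" by (rule sgn_lam[OF Y(1)])
  have l: "lam Y = lam2 (r ** chol_a \<beta>)"
    unfolding Y_def lam_def by (simp add: block_mult block_P_sec[OF b])
  have i: "matrix_inv r = transpose r" using SO_inv[OF r] by simp
  have "cis (Im (Ln (lam Y / lam2 r))) = sgn (lam Y / lam2 r)"
    using lam_nonzero[OF Y(1)] lam2_SO_nonzero[OF r] by (intro cis_Im_Ln) simp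
  also have "\<dots> = lam2 (psi Y) * inverse (lam2 r)"
    unfolding divide_inverse sgn_mult y using norm_lam2_SO[OF r] by (simp add: sgn_unit norm_inverse)
  also have "\<dots> = lam2 (psi Y ** transpose r)"
    unfolding lam2_mult_SO[OF SO_transpose[OF r]] lam2_transpose_SO[OF r] ..
  finally have "lam2 (rho (Im (Ln (lam Y / lam2 r)))) = lam2 (psi Y ** transpose r)" by simp
  then have "rho (Im (Ln (lam Y / lam2 r))) = psi Y ** transpose r"
    by (intro lam2_inject rho_SO SO_mult psi_Psi(1) Y(1) SO_transpose r)
  then show ?thesis unfolding Y(3) l i .
qed

lemma smooth_on_eta_lift:
  "smooth_on (Omega \<times> SO)
    (\<lambda>p :: 'm::{finite,linorder} colpair \<times> (real^2^2). Im (Ln (lam2 (snd p ** chol_a (fst p)) / lam2 (snd p))))"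
proof (rule smooth_on_arg[OF smooth_on_divide])
  let ?O = "Omega \<times> SO :: ('m colpair \<times> (real^2^2)) set"
  have s: "smooth_on ?O snd" "smooth_on ?O fst"
    by (auto intro: smooth_on_bounded_linear bounded_linear_fst bounded_linear_snd)
  have c: "smooth_on ?O (\<lambda>p. chol_a (fst p))"
    by (rule smooth_on_compose[OF smooth_on_chol(1) s(2)]) auto
  show "smooth_on ?O (\<lambda>p. lam2 (snd p ** chol_a (fst p)))"
    by (rule smooth_on_linear_compose[OF bounded_linear_lam2 smooth_on_matrix_mult[OF s(1) c]])
  show "smooth_on ?O (\<lambda>p. lam2 (snd p))"
    by (rule smooth_on_linear_compose[OF bounded_linear_lam2 s(1)])
qed (use lam2_mult_triangular_ratio triangular_pos_chol_a lam2_SO_nonzero in force)+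

lemma eta_eq:
  fixes \<beta> :: "'m::{finite,linorder} colpair"
  assumes card: "2 \<le> CARD('m)" and b: "\<beta> \<in> Omega" and r: "r \<in> SO"
  shows "eta (\<beta>, r) = Im (Ln (lam2 (r ** chol_a \<beta>) / lam2 r))"
proof -
  let ?h = "\<lambda>p :: 'm colpair \<times> (real^2^2). Im (Ln (lam2 (snd p ** chol_a (fst p)) / lam2 (snd p)))"
  let ?O = "Omega \<times> SO :: ('m colpair \<times> (real^2^2)) set"
  have "eta (\<beta>, r) = ?h (\<beta>, r)"
    unfolding eta_def
  proof (rule the_angle_lift[where S = ?O and a = "(0, mat 1)" and
        w = "\<lambda>p. matrix_inv (a_hat (fst p ** matrix_inv (snd p))) ** snd p ** a_hat (fst p) ** matrix_inv (snd p)"])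
    show "connected ?O" by (intro connected_Times connected_Omega connected_SO) simp
    show "smooth_on ?O ?h" by (rule smooth_on_eta_lift)
    show "rho (?h p) = matrix_inv (a_hat (fst p ** matrix_inv (snd p))) ** snd p ** a_hat (fst p) ** matrix_inv (snd p)"
      if "p \<in> ?O" for p
      by (rule eta_lift[OF card]) (use that in auto)
  qed (use b r in auto)
  then show ?thesis by simp
qed

section \<open>The function zeta and the angle of a product\<close>

lemma smooth_on_Theta: "smooth_on (Omega \<times> Omega) (Theta :: 'm::{finite,linorder} colpair \<times> 'm colpair \<Rightarrow> real)"
  by (rule smooth_on_cong[OF smooth_on_Theta_lift]) (auto simp: Theta_eq)

lemma smooth_on_eta:
  assumes "2 \<le> CARD('m)"
  shows "smooth_on (Omega \<times> SO) (eta :: 'm::{finite,linorder} colpair \<times> (real^2^2) \<Rightarrow> real)"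
  by (rule smooth_on_cong[OF smooth_on_eta_lift]) (auto simp: eta_eq[OF assms])

lemma zeta_argument_Omega:
  assumes "X \<in> O_up" "X' \<in> O_up"
  shows "Psi X ** pi2 X' ** matrix_inv (psi X) \<in> Omega"
proof -
  have "orthogonal_matrix (Psi X)" "orthogonal_matrix (transpose (psi X))"
    using psi_Psi(1,2)[OF assms(1)] by (auto simp: rotation_matrix_def)
  from Omega_orthogonal[OF pi2_Omega[OF assms(2)] this] show ?thesis
    using SO_inv(1)[OF psi_Psi(1)[OF assms(1)]] by simp
qed

lemma smooth_on_zeta:
  assumes card: "2 \<le> CARD('m)"
  shows "smooth_on (O_up \<times> O_up) (\<lambda>p. zeta (fst p) (snd p :: 'm::{finite,linorder} pmat))"
proof -
  let ?O = "O_up \<times> O_up :: ('m pmat \<times> 'm pmat) set"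
  have s: "smooth_on ?O snd" "smooth_on ?O fst"
    by (auto intro: smooth_on_bounded_linear bounded_linear_fst bounded_linear_snd)
  have p: "smooth_on ?O (\<lambda>p. pi2 (fst p))" "smooth_on ?O (\<lambda>p. pi2 (snd p))"
    by (rule smooth_on_compose[OF smooth_on_pi2 s(2)], force) (rule smooth_on_compose[OF smooth_on_pi2 s(1)], force)
  have q: "smooth_on ?O (\<lambda>p. psi (fst p))" "smooth_on ?O (\<lambda>p. Psi (fst p))"
    by (rule smooth_on_compose[OF smooth_on_psi_Psi(1) s(2)], force) (rule smooth_on_compose[OF smooth_on_psi_Psi(2) s(2)], force)
  have i: "smooth_on ?O (\<lambda>p. matrix_inv (psi (fst p)))"
    by (rule smooth_on_matrix_inv[OF q(1)]) (use psi_Psi(1) det_SO in force)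
  have "smooth_on ?O (\<lambda>p. Theta (pi2 (fst p), Psi (fst p) ** pi2 (snd p) ** matrix_inv (psi (fst p))))"
    by (rule smooth_on_compose[OF smooth_on_Theta smooth_on_Pair[OF p(1) smooth_on_matrix_mult[OF smooth_on_matrix_mult[OF q(2) p(2)] i]]])
       (use pi2_Omega zeta_argument_Omega in auto)
  moreover have "smooth_on ?O (\<lambda>p. eta (pi2 (snd p), psi (fst p)))"
    by (rule smooth_on_compose[OF smooth_on_eta[OF card] smooth_on_Pair[OF p(2) q(1)]])
       (use pi2_Omega psi_Psi(1) in auto)
  ultimately show ?thesis unfolding zeta_def by (rule smooth_on_add)
qed

text \<open>In X X' = P S P' S' the middle factor S P' is rewritten as a section value times an
  isotropy matrix. The angle of the product of the two section values is the \<open>Theta\<close>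
  term, the change of angle caused by moving S past P' is the \<open>eta\<close> term, and the
  angles of S and S' remain.\<close>

lemma rho_zeta:
  fixes X X' :: "'m::{finite,linorder} pmat"
  assumes card: "2 \<le> CARD('m)" and X: "X \<in> O_up" and X': "X' \<in> O_up"
  shows "psi (X ** X') = rho (zeta X X') ** psi X ** psi X'"
proof -
  let ?\<beta> = "pi2 X" and ?\<beta>' = "pi2 X'"
  define Y where "Y = S_mat (psi X) (Psi X) ** P_sec ?\<beta>'"
  note Y = psi_S_mat_mult_P_sec[OF card pi2_Omega[OF X'] psi_Psi(1,2)[OF X], folded Y_def]
  define \<beta>'' where "\<beta>'' = Psi X ** ?\<beta>' ** matrix_inv (psi X)"
  have b: "\<beta>'' \<in> Omega" unfolding \<beta>''_def by (rule zeta_argument_Omega[OF X X'])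
  have PP: "P_sec ?\<beta> ** P_sec \<beta>'' \<in> O_up" by (intro O_up_mult P_sec_O_up pi2_Omega X b)
  have "X ** X' = P_sec ?\<beta> ** S_mat (psi X) (Psi X) ** (P_sec ?\<beta>' ** S_mat (psi X') (Psi X'))"
    by (rule arg_cong2[OF psi_Psi(3)[OF X] psi_Psi(3)[OF X']])
  also have "\<dots> = P_sec ?\<beta> ** Y ** S_mat (psi X') (Psi X')"
    unfolding Y_def by (simp only: matrix_mul_assoc)
  also have "P_sec ?\<beta> ** Y = P_sec ?\<beta> ** (P_sec \<beta>'' ** S_mat (psi Y) (Psi Y))"
    using psi_Psi(3)[OF Y(1)] unfolding Y(2) \<beta>''_def[symmetric] by (rule arg_cong)
  finally have e: "X ** X' = (P_sec ?\<beta> ** P_sec \<beta>'' ** S_mat (psi Y) (Psi Y)) ** S_mat (psi X') (Psi X')"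
    by (simp only: matrix_mul_assoc)
  have PY: "P_sec ?\<beta> ** P_sec \<beta>'' ** S_mat (psi Y) (Psi Y) \<in> O_up"
    by (intro O_up_mult[OF PP] S_mat_O_up card psi_Psi Y(1))
  have p: "psi (X ** X') = psi (P_sec ?\<beta> ** P_sec \<beta>'') ** psi Y ** psi X'"
    unfolding e psi_mult_S_mat[OF PY psi_Psi(1,2)[OF X']] psi_mult_S_mat[OF PP psi_Psi(1,2)[OF Y(1)]] ..
  have "psi (P_sec ?\<beta> ** P_sec \<beta>'') = rho (Theta (?\<beta>, \<beta>''))"
    unfolding Theta_eq[OF pi2_Omega[OF X] b] psi_eq_rho_iff[OF PP]
    by (rule cis_Im_Ln[symmetric]) (rule lam_nonzero[OF PP])
  moreover have "psi Y ** matrix_inv (psi X) = rho (eta (?\<beta>', psi X))"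
    unfolding Y(3) eta_eq[OF card pi2_Omega[OF X'] psi_Psi(1)[OF X]]
    by (rule eta_lift[OF card pi2_Omega[OF X'] psi_Psi(1)[OF X], symmetric])
  then have "psi Y ** matrix_inv (psi X) ** psi X = rho (eta (?\<beta>', psi X)) ** psi X" by simp
  then have "psi Y = rho (eta (?\<beta>', psi X)) ** psi X"
    by (simp add: SO_inv[OF psi_Psi(1)[OF X]] matrix_mul_assoc[symmetric])
  moreover have "rho (zeta X X') = rho (Theta (?\<beta>, \<beta>'')) ** rho (eta (?\<beta>', psi X))"
    unfolding zeta_def \<beta>''_def
    by (rule lam2_inject) (simp_all add: SO_mult[unfolded mem_Collect_eq] lam2_mult_SO cis_mult)
  ultimately show ?thesis unfolding p by (simp only: matrix_mul_assoc)
qed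

lemma pi2_mat_1 [simp]: "pi2 (mat 1) = 0"
  by (rule pi2_eqI) simp_all

text \<open>Over the origin the section is the identity, so both summands are arguments of the
  number 1. This computes products of central elements later.\<close>

lemma zeta_S_mat:
  fixes R :: "'m::{finite,linorder} sqmat"
  assumes card: "2 \<le> CARD('m)" and "r \<in> SO" "R \<in> SO" "r' \<in> SO" "R' \<in> SO"
  shows "zeta (S_mat r R) (S_mat r' R') = 0"
proof -
  have e: "S_mat r R = P_sec 0 ** S_mat r R" "S_mat r' R' = P_sec 0 ** S_mat r' R'" by simp_all
  note u = psi_Psi_unique[OF zero_in_Omega assms(2,3) e(1)] psi_Psi_unique[OF zero_in_Omega assms(4,5) e(2)]
  show ?thesis
    unfolding zeta_def u using assms(2) lam2_SO_nonzero[of r]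
    by (simp add: Theta_eq eta_eq[OF card] lam_def)
qed

lemma psi_Psi_mat_1 [simp]:
  "psi (mat 1 :: 'm::{finite,linorder} pmat) = mat 1" "Psi (mat 1) = (mat 1 :: 'm sqmat)"
proof -
  have "(mat 1 :: 'm pmat) = P_sec 0 ** S_mat (mat 1) (mat 1)"
    by (simp add: S_mat_def flip: mat_1_block)
  from psi_Psi_unique(2,3)[OF zero_in_Omega mat_1_SO mat_1_SO this]
  show "psi (mat 1 :: 'm pmat) = mat 1" "Psi (mat 1) = (mat 1 :: 'm sqmat)" .
qed

lemma Im_Ln_lam_P_sec:
  assumes "\<beta> \<in> Omega"
  shows "Im (Ln (lam (P_sec \<beta>))) = 0"
  using triangular_pos_two[OF triangular_pos_chol_a[OF assms]]
  by (simp add: lam_def block_P_sec[OF assms] lam2_triangular[OF triangular_pos_chol_a[OF assms]] Ln_of_real)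

lemma zeta_mat_1:
  fixes X :: "'m::{finite,linorder} pmat"
  assumes card: "2 \<le> CARD('m)" and X: "X \<in> O_up"
  shows "zeta (mat 1) X = 0" "zeta X (mat 1) = 0"
proof -
  have i: "matrix_inv (mat 1 :: real^2^2) = mat 1" by (rule matrix_inv_unique) simp
  have b: "pi2 X \<in> Omega" by (rule pi2_Omega[OF X])
  show "zeta (mat 1) X = 0"
    using Im_Ln_lam_P_sec[OF b]
    by (simp add: zeta_def i Theta_eq b eta_eq[OF card] lam_def block_P_sec[OF b])
  show "zeta X (mat 1) = 0"
    using Im_Ln_lam_P_sec[OF b] lam2_SO_nonzero[OF psi_Psi(1)[OF X]] psi_Psi(1)[OF X]
    by (simp add: zeta_def Theta_eq b eta_eq[OF card])
qed

section \<open>The cocycle and the group structure\<close>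

lemma lam2_psi_mult:
  fixes X Y :: "'m::{finite,linorder} pmat"
  assumes "2 \<le> CARD('m)" "X \<in> O_up" "Y \<in> O_up"
  shows "lam2 (psi (X ** Y)) = cis (zeta X Y) * lam2 (psi X) * lam2 (psi Y)"
  unfolding rho_zeta[OF assms]
  using psi_Psi(1)[OF assms(2)] psi_Psi(1)[OF assms(3)] by (simp add: lam2_mult_SO)

lemma continuous_on_zeta:
  fixes f g :: "'a::topological_space \<Rightarrow> 'm::{finite,linorder} pmat"
  assumes card: "2 \<le> CARD('m)" and "continuous_on S f" "continuous_on S g"
    "\<And>x. x \<in> S \<Longrightarrow> f x \<in> O_up" "\<And>x. x \<in> S \<Longrightarrow> g x \<in> O_up"
  shows "continuous_on S (\<lambda>x. zeta (f x) (g x))"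
proof -
  have "continuous_on S (\<lambda>x. (f x, g x))" using assms(2,3) by (rule continuous_on_Pair)
  from continuous_on_compose2[OF smooth_on_imp_continuous_on[OF smooth_on_zeta[OF card]] this] assms(4,5)
  show ?thesis by auto
qed

text \<open>Both sides measure the angle of \<open>psi (X ** Y ** Z)\<close> relative to the three
  separate angles, by the two bracketings. Their difference vanishes at the triple of
  identities.\<close>

lemma zeta_cocycle:
  fixes X Y Z :: "'m::{finite,linorder} pmat"
  assumes card: "2 \<le> CARD('m)" and X: "X \<in> O_up" and Y: "Y \<in> O_up" and Z: "Z \<in> O_up"
  shows "zeta X Y + zeta (X ** Y) Z = zeta Y Z + zeta X (Y ** Z)"
proof -
  let ?S = "O_up \<times> O_up \<times> O_up :: ('m pmat \<times> 'm pmat \<times> 'm pmat) set"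
  let ?d = "\<lambda>p :: 'm pmat \<times> 'm pmat \<times> 'm pmat. zeta (fst p) (fst (snd p)) +
    zeta (fst p ** fst (snd p)) (snd (snd p)) -
    (zeta (fst (snd p)) (snd (snd p)) + zeta (fst p) (fst (snd p) ** snd (snd p)))"
  have "?d (X, Y, Z) = 0"
  proof (rule connected_angle_zero[where S = ?S and a = "(mat 1, mat 1, mat 1)"])
    show "connected ?S" by (intro connected_Times connected_O_up)
    show "continuous_on ?S ?d"
      by (intro continuous_on_diff continuous_on_add continuous_on_zeta[OF card] continuous_on_matrix_mult
          continuous_on_fst continuous_on_snd continuous_on_id) (auto intro: O_up_mult)
    show "cis (?d p) = 1" if "p \<in> ?S" for p
    proof -
      obtain A B C where p: "p = (A, B, C)" by (rule prod_cases3)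
      have A: "A \<in> O_up" and B: "B \<in> O_up" and C: "C \<in> O_up" using that p by auto
      have "lam2 (psi (A ** B ** C)) = lam2 (psi (A ** (B ** C)))" by (simp add: matrix_mul_assoc)
      then have "cis (zeta (A ** B) C) * (cis (zeta A B) * lam2 (psi A) * lam2 (psi B)) * lam2 (psi C) =
          cis (zeta A (B ** C)) * lam2 (psi A) * (cis (zeta B C) * lam2 (psi B) * lam2 (psi C))"
        by (simp only: lam2_psi_mult[OF card] A B C O_up_mult)
      then have "cis (zeta A B) * cis (zeta (A ** B) C) = cis (zeta B C) * cis (zeta A (B ** C))"
        using lam2_SO_nonzero[OF psi_Psi(1)[OF A]] lam2_SO_nonzero[OF psi_Psi(1)[OF B]]
          lam2_SO_nonzero[OF psi_Psi(1)[OF C]] by (simp add: mult_ac)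
      then have "cis (zeta A B + zeta (A ** B) C) = cis (zeta B C + zeta A (B ** C))"
        by (simp only: cis_mult)
      then show ?thesis by (simp add: p flip: cis_divide)
    qed
  qed (use X Y Z in \<open>auto simp: zeta_mat_1[OF card]\<close>)
  then show ?thesis by simp
qed

lemma mem_O_hat_iff: "(X, t) \<in> O_hat \<longleftrightarrow> X \<in> O_up \<and> psi X = rho t"
  by (simp add: O_hat_def)

lemma O_hat_group_simps [simp]:
  "carrier O_hat_group = O_hat" "one O_hat_group = (mat 1, 0)"
  "(X, t) \<otimes>\<^bsub>O_hat_group\<^esub> (Y, s) = (X ** Y, t + s + zeta X Y)"
  by (simp_all add: O_hat_group_def star_def)

lemma O_up_group_simps [simp]:
  "carrier O_up_group = O_up" "one O_up_group = mat 1" "X \<otimes>\<^bsub>O_up_group\<^esub> Y = X ** Y"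
  by (simp_all add: O_up_group_def)

lemma rho_add: "rho s ** rho t = rho (s + t)"
  by (rule lam2_inject) (simp_all add: SO_mult[unfolded mem_Collect_eq] lam2_mult_SO cis_mult)

lemma rho_0 [simp]: "rho 0 = mat 1"
  by (rule lam2_inject) simp_all

lemma O_hat_mult:
  fixes X Y :: "'m::{finite,linorder} pmat"
  assumes card: "2 \<le> CARD('m)" and "(X, t) \<in> O_hat" "(Y, s) \<in> O_hat"
  shows "(X ** Y, t + s + zeta X Y) \<in> O_hat"
  using assms(2,3) by (simp add: mem_O_hat_iff O_up_mult rho_zeta[OF card] rho_add add_ac)

lemma O_hat_inv:
  fixes X :: "'m::{finite,linorder} pmat"
  assumes card: "2 \<le> CARD('m)" and X: "(X, t) \<in> O_hat"
  shows "(adj X, - t - zeta X (adj X)) \<in> O_hat"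
    "(X, t) \<otimes>\<^bsub>O_hat_group\<^esub> (adj X, - t - zeta X (adj X)) = \<one>\<^bsub>O_hat_group\<^esub>"
    "(adj X, - t - zeta X (adj X)) \<otimes>\<^bsub>O_hat_group\<^esub> (X, t) = \<one>\<^bsub>O_hat_group\<^esub>"
proof -
  have O: "X \<in> O_up" "psi X = rho t" "adj X \<in> O_up" using X by (auto simp: mem_O_hat_iff O_up_adj)
  have "lam2 (psi (X ** adj X)) = cis (zeta X (adj X)) * lam2 (psi X) * lam2 (psi (adj X))"
    by (rule lam2_psi_mult[OF card O(1,3)])
  then have "1 = cis (zeta X (adj X) + t) * lam2 (psi (adj X))"
    by (simp add: O_up_adj_right[OF O(1)] O(2) cis_mult)
  then have "lam2 (psi (adj X)) = inverse (cis (zeta X (adj X) + t))"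
    by (simp add: field_simps)
  then have "lam2 (psi (adj X)) = lam2 (rho (- t - zeta X (adj X)))"
    by (simp add: add.commute)
  then show "(adj X, - t - zeta X (adj X)) \<in> O_hat"
    using lam2_inject[OF psi_Psi(1)[OF O(3)] rho_SO] O(3) by (simp add: mem_O_hat_iff)
  show "(X, t) \<otimes>\<^bsub>O_hat_group\<^esub> (adj X, - t - zeta X (adj X)) = \<one>\<^bsub>O_hat_group\<^esub>"
    by (simp add: O_up_adj_right[OF O(1)])
  \<comment> \<open>The cocycle identity at the triple (X, X^-1, X), where the terms containing the
    identity vanish. It makes the right inverse a left inverse.\<close>
  have "zeta (adj X) X = zeta X (adj X)"
    using zeta_cocycle[OF card O(1,3,1)]
    by (simp add: O_up_adj_right[OF O(1)] O_up_adj_left[OF O(1)] zeta_mat_1[OF card O(1)])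
  then show "(adj X, - t - zeta X (adj X)) \<otimes>\<^bsub>O_hat_group\<^esub> (X, t) = \<one>\<^bsub>O_hat_group\<^esub>"
    by (simp add: O_up_adj_left[OF O(1)])
qed

lemma group_O_hat:
  assumes card: "2 \<le> CARD('m)"
  shows "group (O_hat_group :: ('m::{finite,linorder} pmat \<times> real) monoid)"
proof (rule groupI)
  fix x y :: "'m pmat \<times> real"
  assume "x \<in> carrier O_hat_group" "y \<in> carrier O_hat_group"
  then show "x \<otimes>\<^bsub>O_hat_group\<^esub> y \<in> carrier O_hat_group"
    using O_hat_mult[OF card] by (cases x; cases y) simp
next
  show "\<one>\<^bsub>O_hat_group\<^esub> \<in> carrier (O_hat_group :: ('m pmat \<times> real) monoid)"
    by (simp add: mem_O_hat_iff)
next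
  fix x y z :: "'m pmat \<times> real"
  assume "x \<in> carrier O_hat_group" "y \<in> carrier O_hat_group" "z \<in> carrier O_hat_group"
  then show "x \<otimes>\<^bsub>O_hat_group\<^esub> y \<otimes>\<^bsub>O_hat_group\<^esub> z = x \<otimes>\<^bsub>O_hat_group\<^esub> (y \<otimes>\<^bsub>O_hat_group\<^esub> z)"
    using zeta_cocycle[OF card, of "fst x" "fst y" "fst z"]
    by (cases x; cases y; cases z) (simp add: mem_O_hat_iff matrix_mul_assoc)
next
  fix x :: "'m pmat \<times> real"
  assume x: "x \<in> carrier O_hat_group"
  then show "\<one>\<^bsub>O_hat_group\<^esub> \<otimes>\<^bsub>O_hat_group\<^esub> x = x"
    by (cases x) (simp add: mem_O_hat_iff zeta_mat_1[OF card])
  show "\<exists>y\<in>carrier O_hat_group. y \<otimes>\<^bsub>O_hat_group\<^esub> x = \<one>\<^bsub>O_hat_group\<^esub>"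
    using O_hat_inv(1,3)[OF card, of "fst x" "snd x"] x by (intro bexI) simp_all
qed

lemma inv_O_hat:
  fixes X :: "'m::{finite,linorder} pmat"
  assumes card: "2 \<le> CARD('m)" and X: "(X, t) \<in> O_hat"
  shows "inv\<^bsub>O_hat_group\<^esub> (X, t) = (adj X, - t - zeta X (adj X))"
  using group.inv_equality[OF group_O_hat[OF card] O_hat_inv(3)[OF card X]] O_hat_inv(1)[OF card X] X by simp

lemma group_O_up: "group (O_up_group :: 'm::finite pmat monoid)"
proof (rule groupI)
  fix X :: "'m pmat" assume X: "X \<in> carrier O_up_group"
  then show "\<exists>Y\<in>carrier O_up_group. Y \<otimes>\<^bsub>O_up_group\<^esub> X = \<one>\<^bsub>O_up_group\<^esub>"
    by (intro bexI[of _ "adj X"]) (simp_all add: O_up_adj O_up_adj_left)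
qed (simp_all add: O_up_mult matrix_mul_assoc)

lemma inv_O_up: "X \<in> O_up \<Longrightarrow> inv\<^bsub>O_up_group\<^esub> X = adj X"
  using group.inv_equality[OF group_O_up, of "adj X" X] by (simp add: O_up_adj O_up_adj_left)

lemma smooth_on_O_hat_mult:
  assumes card: "2 \<le> CARD('m)"
  shows "smooth_on (O_hat \<times> O_hat) (\<lambda>(x, y :: 'm::{finite,linorder} pmat \<times> real). x \<otimes>\<^bsub>O_hat_group\<^esub> y)"
proof -
  let ?S = "O_hat \<times> O_hat :: (('m pmat \<times> real) \<times> ('m pmat \<times> real)) set"
  have l: "smooth_on ?S (\<lambda>p. fst (fst p))" "smooth_on ?S (\<lambda>p. fst (snd p))"
    "smooth_on ?S (\<lambda>p. snd (fst p))" "smooth_on ?S (\<lambda>p. snd (snd p))"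
    by (intro smooth_on_fst smooth_on_snd smooth_on_id)+
  have z: "smooth_on ?S (\<lambda>p. zeta (fst (fst p)) (fst (snd p)))"
    using smooth_on_compose[OF smooth_on_zeta[OF card] smooth_on_Pair[OF l(1,2)]] by (auto simp: mem_O_hat_iff)
  have "smooth_on ?S (\<lambda>p. (fst (fst p) ** fst (snd p), snd (fst p) + snd (snd p) + zeta (fst (fst p)) (fst (snd p))))"
    by (intro smooth_on_Pair smooth_on_matrix_mult smooth_on_add l z)
  then show ?thesis by (rule smooth_on_cong) auto
qed

lemma smooth_on_O_hat_inv:
  assumes card: "2 \<le> CARD('m)"
  shows "smooth_on O_hat (\<lambda>x :: 'm::{finite,linorder} pmat \<times> real. inv\<^bsub>O_hat_group\<^esub> x)"
proof -
  let ?S = "O_hat :: ('m pmat \<times> real) set"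
  have l: "smooth_on ?S (\<lambda>p. fst p)" "smooth_on ?S (\<lambda>p. adj (fst p))" "smooth_on ?S (\<lambda>p. snd p)"
    by (intro smooth_on_linear_compose[OF bounded_linear_adj] smooth_on_fst smooth_on_snd smooth_on_id)+
  have z: "smooth_on ?S (\<lambda>p. zeta (fst p) (adj (fst p)))"
    using smooth_on_compose[OF smooth_on_zeta[OF card] smooth_on_Pair[OF l(1,2)]] by (auto simp: mem_O_hat_iff O_up_adj)
  have "smooth_on ?S (\<lambda>p. (adj (fst p), - snd p - zeta (fst p) (adj (fst p))))"
    by (intro smooth_on_Pair smooth_on_diff smooth_on_minus l z)
  then show ?thesis by (rule smooth_on_cong) (auto simp: inv_O_hat[OF card])
qed

lemma smooth_on_O_up_mult: "smooth_on (O_up \<times> O_up) (\<lambda>(x, y :: 'm::finite pmat). x \<otimes>\<^bsub>O_up_group\<^esub> y)"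
  unfolding O_up_group_simps case_prod_beta
  by (intro smooth_on_matrix_mult smooth_on_fst smooth_on_snd smooth_on_id)

lemma smooth_on_O_up_inv: "smooth_on O_up (\<lambda>x :: 'm::finite pmat. inv\<^bsub>O_up_group\<^esub> x)"
  by (rule smooth_on_cong[OF smooth_on_bounded_linear[OF bounded_linear_adj]]) (simp add: inv_O_up)

section \<open>Charts\<close>

lemma smooth_on_sin_cos: "smooth_on S (sin :: real \<Rightarrow> real)" "smooth_on S (cos :: real \<Rightarrow> real)"
proof -
  have "Ck_on k (sin :: real \<Rightarrow> real) UNIV \<and> Ck_on k (cos :: real \<Rightarrow> real) UNIV" for k
  proof (induction k)
    case 0
    show ?case by (simp add: continuous_on_sin continuous_on_cos continuous_on_id)
  next
    case (Suc k)
    have "Ck_on k (\<lambda>x::real. cos x * v) UNIV" "Ck_on k (\<lambda>x::real. - sin x * v) UNIV" for v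
      using Suc Ck_on_linear_compose[OF open_UNIV bounded_linear_mult_left[of v], of k cos]
        Ck_on_linear_compose[OF open_UNIV bounded_linear_mult_left[of "- v"], of k sin] by simp_all
    moreover have "(sin has_derivative (*) (cos x)) (at x)" "(cos has_derivative (*) (- sin x)) (at x)" for x :: real
      using DERIV_sin[of x] DERIV_cos[of x] by (simp_all add: has_field_derivative_def)
    ultimately show ?case
      by (intro conjI Ck_on_SucI[OF open_UNIV, where D = "\<lambda>x v. cos x * v"]
          Ck_on_SucI[OF open_UNIV, where D = "\<lambda>x v. - sin x * v"])
  qed
  then show "smooth_on S (sin :: real \<Rightarrow> real)" "smooth_on S (cos :: real \<Rightarrow> real)"
    by (auto intro: smooth_on_subset[OF smooth_onI_open[OF open_UNIV]])
qed

lemma smooth_on_rho: "smooth_on S rho"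
proof -
  have "smooth_on S (\<lambda>t. if i = j then cos t else if i = 0 then - sin t else sin t)" for i j :: 2
    by (cases "i = j"; cases "i = 0") (simp_all add: smooth_on_sin_cos smooth_on_minus)
  then show ?thesis unfolding rho_def by (intro smooth_on_vec)
qed

lemma SO_two_rho:
  assumes "r \<in> SO"
  obtains t where "r = rho t"
proof -
  obtain t where "lam2 r = cis t"
    using norm_lam2_SO[OF assms] by (metis complex_unit_circle cis_Im_Ln lam2_SO_nonzero[OF assms] sgn_unit)
  then have "r = rho t" by (intro lam2_inject assms rho_SO) simp
  then show thesis by (rule that)
qed

lemma diffeomorphismI:
  assumes "smooth_on S f" "smooth_on T g" "\<And>x. x \<in> S \<Longrightarrow> f x \<in> T" "\<And>y. y \<in> T \<Longrightarrow> g y \<in> S"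
    "\<And>x. x \<in> S \<Longrightarrow> g (f x) = x" "\<And>y. y \<in> T \<Longrightarrow> f (g y) = y"
  shows "diffeomorphism S T f g"
proof -
  have "T \<subseteq> f ` S"
  proof
    fix y assume "y \<in> T"
    then show "y \<in> f ` S" using assms(4)[of y] assms(6)[of y] by (intro image_eqI[of _ f "g y"]) auto
  qed
  moreover have "S \<subseteq> g ` T"
  proof
    fix x assume "x \<in> S"
    then show "x \<in> g ` T" using assms(3)[of x] assms(5)[of x] by (intro image_eqI[of _ g "f x"]) auto
  qed
  ultimately show ?thesis unfolding diffeomorphism_def using assms by auto
qed

lemma diffeomorphismD:
  assumes "diffeomorphism S T f g"
  shows "smooth_on S f" "smooth_on T g" "\<And>x. x \<in> S \<Longrightarrow> f x \<in> T" "\<And>y. y \<in> T \<Longrightarrow> g y \<in> S"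
    "\<And>x. x \<in> S \<Longrightarrow> g (f x) = x" "\<And>y. y \<in> T \<Longrightarrow> f (g y) = y" "f ` S = T" "g ` T = S"
  using assms unfolding diffeomorphism_def by auto

lemma diffeomorphism_connected:
  assumes "diffeomorphism S T f g" "connected T"
  shows "connected S"
  using connected_continuous_image[OF smooth_on_imp_continuous_on[OF diffeomorphismD(2)[OF assms(1)]] assms(2)]
  unfolding diffeomorphismD(8)[OF assms(1)] .

text \<open>The coordinates are those of the factorization through the section, with the real angle
  in place of the rotation: on \<open>O_hat\<close> the factor \<open>psi X\<close> is recovered
  from the second component.\<close>

lemma diffeomorphism_O_hat:
  assumes card: "2 \<le> CARD('m)"
  shows "diffeomorphism (O_hat :: ('m::{finite,linorder} pmat \<times> real) set) (Omega \<times> UNIV \<times> SO)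
    (\<lambda>x. (pi2 (fst x), snd x, Psi (fst x))) (\<lambda>y. (P_sec (fst y) ** S_mat (rho (fst (snd y))) (snd (snd y)), fst (snd y)))"
    (is "diffeomorphism ?S ?T ?f ?g")
proof -
  have u: "P_sec \<beta> ** S_mat (rho t) R \<in> O_up" "pi2 (P_sec \<beta> ** S_mat (rho t) R) = \<beta>"
      "psi (P_sec \<beta> ** S_mat (rho t) R) = rho t" "Psi (P_sec \<beta> ** S_mat (rho t) R) = R"
    if "\<beta> \<in> Omega" "R \<in> SO" for \<beta> :: "'m colpair" and t R
    using psi_Psi_unique[OF that(1) rho_SO that(2) refl] that card by (auto intro!: O_up_mult P_sec_O_up S_mat_O_up)
  have fst_in: "fst x \<in> O_up" if "x \<in> ?S" for x using that by (cases x) (simp add: mem_O_hat_iff)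
  have f: "?f x \<in> ?T" if "x \<in> ?S" for x
    using pi2_Omega psi_Psi(2) fst_in[OF that] by auto
  have g: "?g y \<in> ?S" if "y \<in> ?T" for y
    using u(1,3) that by (auto simp: mem_O_hat_iff)
  have gf: "?g (?f x) = x" if "x \<in> ?S" for x
  proof -
    obtain X t where x: "x = (X, t)" by (rule prod.exhaust)
    then have X: "X \<in> O_up" "psi X = rho t" using that by (auto simp: mem_O_hat_iff)
    from psi_Psi(3)[OF X(1)] show ?thesis unfolding x by (simp add: X(2))
  qed
  have fg: "?f (?g y) = y" if "y \<in> ?T" for y
    using u that by (auto simp: prod_eq_iff)
  show ?thesis
  proof (rule diffeomorphismI[OF _ _ f g gf fg])
    show "smooth_on ?S ?f"
      by (intro smooth_on_Pair smooth_on_compose[OF smooth_on_pi2] smooth_on_compose[OF smooth_on_psi_Psi(2)]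
          smooth_on_fst smooth_on_snd smooth_on_id fst_in)
    have a: "smooth_on ?T (\<lambda>y. P_sec (fst y))"
      by (rule smooth_on_compose[OF smooth_on_P_sec smooth_on_fst[OF smooth_on_id]]) auto
    have b: "smooth_on ?T (\<lambda>y. rho (fst (snd y)))"
      by (rule smooth_on_compose[OF smooth_on_rho[of UNIV] smooth_on_fst[OF smooth_on_snd[OF smooth_on_id]]]) auto
    show "smooth_on ?T ?g"
      unfolding S_mat_def
      by (intro smooth_on_Pair smooth_on_matrix_mult a b smooth_on_block_matrix smooth_on_const
          smooth_on_fst smooth_on_snd smooth_on_id)
  qed
qed

lemma connected_O_hat:
  assumes card: "2 \<le> CARD('m)"
  shows "connected (O_hat :: ('m::{finite,linorder} pmat \<times> real) set)"
proof -
  have "connected (Omega \<times> (UNIV :: real set) \<times> (SO :: 'm sqmat set))"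
    by (intro connected_Times connected_Omega connected_SO card connected_UNIV)
  then show ?thesis by (rule diffeomorphism_connected[OF diffeomorphism_O_hat[OF card]])
qed

lemma diffeomorphism_subset:
  assumes "diffeomorphism U V f g" "S \<subseteq> U"
  shows "diffeomorphism S (f ` S) f g"
proof -
  note d = diffeomorphismD[OF assms(1)]
  show ?thesis
  proof (rule diffeomorphismI)
    show "smooth_on S f" by (rule smooth_on_subset[OF d(1) assms(2)])
    show "smooth_on (f ` S) g" by (rule smooth_on_subset[OF d(2)]) (use d(3) assms(2) in auto)
    show "g y \<in> S" "f (g y) = y" if y: "y \<in> f ` S" for y
    proof -
      obtain x where x: "x \<in> S" "y = f x" using y by blast
      then have "g y = x" using d(5) assms(2) by auto
      then show "g y \<in> S" "f (g y) = y" using x by auto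
    qed
    show "g (f x) = x" if "x \<in> S" for x using d(5) that assms(2) by auto
  qed auto
qed

lemma diffeomorphism_openin_image:
  assumes d: "diffeomorphism U V f g" and S: "openin (top_of_set U) S"
  shows "openin (top_of_set V) (f ` S)"
proof -
  have "S \<subseteq> U" using S openin_imp_subset by blast
  then have "f ` S = V \<inter> g -` S"
    using diffeomorphismD(3-6)[OF d] by (auto intro!: image_eqI)
  moreover have "openin (top_of_set V) (V \<inter> g -` S)"
    by (rule continuous_openin_preimage[OF smooth_on_imp_continuous_on[OF diffeomorphismD(2)[OF d]] _ S])
       (use diffeomorphismD(4)[OF d] in auto)
  ultimately show ?thesis by simp
qed

section \<open>Cayley transforms and charts of the pseudo-orthogonal group\<close>

lemmas matrix_distribs =
  bounded_bilinear.add_left[OF bounded_bilinear_matrix_mult]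
  bounded_bilinear.add_right[OF bounded_bilinear_matrix_mult]
  bounded_bilinear.diff_left[OF bounded_bilinear_matrix_mult]
  bounded_bilinear.diff_right[OF bounded_bilinear_matrix_mult]
  bounded_bilinear.scaleR_left[OF bounded_bilinear_matrix_mult]
  bounded_bilinear.scaleR_right[OF bounded_bilinear_matrix_mult]

text \<open>A rational parametrization that plays the part of the exponential map: it too sends skew
  elements to group elements, and its inverse is explicit.\<close>

definition cayley :: "real^'k^'k \<Rightarrow> real^'k^'k" where
  "cayley A = (mat 1 + A) ** matrix_inv (mat 1 - A)"

definition inv_cayley :: "real^'k^'k \<Rightarrow> real^'k^'k" where
  "inv_cayley X = (X - mat 1) ** matrix_inv (X + mat 1)"

lemma inv_cayley_cayley:
  assumes "det (mat 1 - A) \<noteq> 0"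
  shows "inv_cayley (cayley A) = A" "det (cayley A + mat 1) \<noteq> 0"
proof -
  let ?N = "matrix_inv (mat 1 - A)"
  have N: "(mat 1 - A) ** ?N = mat 1" "?N ** (mat 1 - A) = mat 1"
    using matrix_inv_right[OF assms] matrix_inv_left[OF assms] .
  have "cayley A + mat 1 = (mat 1 + A) ** ?N + (mat 1 - A) ** ?N" by (simp add: cayley_def N)
  also have "\<dots> = 2 *\<^sub>R ?N" by (simp only: matrix_distribs) (simp add: scaleR_2)
  finally have p: "cayley A + mat 1 = 2 *\<^sub>R ?N" .
  have "cayley A - mat 1 = (mat 1 + A) ** ?N - (mat 1 - A) ** ?N" by (simp add: cayley_def N)
  also have "\<dots> = 2 *\<^sub>R (A ** ?N)" by (simp only: matrix_distribs) (simp add: scaleR_2)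
  finally have m: "cayley A - mat 1 = 2 *\<^sub>R (A ** ?N)" .
  have i: "(cayley A + mat 1) ** ((1/2) *\<^sub>R (mat 1 - A)) = mat 1"
    unfolding p matrix_distribs(5,6) N by simp
  have "inv_cayley (cayley A) = (2 *\<^sub>R (A ** ?N)) ** ((1/2) *\<^sub>R (mat 1 - A))"
    unfolding inv_cayley_def m matrix_inv_unique[OF i] ..
  also have "\<dots> = A ** (?N ** (mat 1 - A))" by (simp add: matrix_distribs(5,6) matrix_mul_assoc)
  finally show "inv_cayley (cayley A) = A" by (simp add: N)
  have "det (cayley A + mat 1) * det ((1/2) *\<^sub>R (mat 1 - A)) = 1"
    using arg_cong[OF i, of det] by (simp only: det_mul det_I)
  then show "det (cayley A + mat 1) \<noteq> 0" by auto
qed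

text \<open>Because of this symmetry the second inverse law follows from the first one at
  \<open>- X\<close>.\<close>

lemma inv_cayley_minus: "inv_cayley X = - cayley (- X)"
proof -
  have "cayley (- X) = - (X - mat 1) ** matrix_inv (X + mat 1)" by (simp add: cayley_def add.commute)
  then show ?thesis by (simp add: inv_cayley_def del: minus_diff_eq)
qed

lemma cayley_inv_cayley:
  assumes "det (X + mat 1) \<noteq> 0"
  shows "cayley (inv_cayley X) = X"
  using inv_cayley_cayley(1)[of "- X"] assms by (simp add: inv_cayley_minus add.commute)

text \<open>The matrices skew for \<open>scalar_prod\<close>. This one linear subspace serves as the
  model space of all charts, which makes the dimension constant.\<close>

definition lie_algebra :: "'m::finite pmat set" where
  "lie_algebra = {A. adj A = - A}"

lemma subspace_lie_algebra: "subspace lie_algebra"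
  by (auto simp: lie_algebra_def subspace_def adj_add adj_scaleR intro: linear_0[OF bounded_linear.linear[OF bounded_linear_adj]])

text \<open>The adjoint exchanges \<open>mat 1 + A\<close> and \<open>mat 1 - A\<close>, and these
  commute, so numerators cancel denominators.\<close>

lemma cayley_pseudo_orthogonal:
  assumes A: "A \<in> lie_algebra" and d: "det (mat 1 - A) \<noteq> 0"
  shows "cayley A \<in> pseudo_orthogonal"
proof -
  let ?N = "matrix_inv (mat 1 - A)"
  have a: "adj (mat 1 + A) = mat 1 - A" "adj (mat 1 - A) = mat 1 + A"
    using A by (simp_all add: adj_add adj_diff lie_algebra_def)
  have "adj (cayley A) ** cayley A = adj ?N ** ((mat 1 - A) ** (mat 1 + A)) ** ?N"
    by (simp only: cayley_def adj_mult a matrix_mul_assoc)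
  also have "(mat 1 - A) ** (mat 1 + A) = (mat 1 + A) ** (mat 1 - A)"
    by (simp add: matrix_distribs)
  also have "adj ?N ** ((mat 1 + A) ** (mat 1 - A)) ** ?N = adj ((mat 1 - A) ** ?N) ** ((mat 1 - A) ** ?N)"
    by (simp only: adj_mult a matrix_mul_assoc)
  also have "\<dots> = mat 1" by (simp add: matrix_inv_right[OF d])
  finally show ?thesis by (simp add: pseudo_orthogonal_iff)
qed

text \<open>After inserting \<open>(X + mat 1) ** ?N\<close> on the right everything rests on (X* -
  1)(X + 1) = - (X* + 1)(X - 1), where X* is \<open>adj X\<close>; both sides equal X* - X because
  X* X = 1.\<close>

lemma inv_cayley_lie_algebra:
  assumes X: "X \<in> pseudo_orthogonal" and d: "det (X + mat 1) \<noteq> 0"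
  shows "inv_cayley X \<in> lie_algebra"
proof -
  let ?N = "matrix_inv (X + mat 1)"
  have N: "(X + mat 1) ** ?N = mat 1" by (rule matrix_inv_right[OF d])
  have x: "adj X ** X = mat 1" using X by (simp add: pseudo_orthogonal_iff)
  have "adj (inv_cayley X) = adj ?N ** (adj X - mat 1)"
    by (simp add: inv_cayley_def adj_mult adj_diff)
  also have "\<dots> = adj ?N ** (adj X - mat 1) ** ((X + mat 1) ** ?N)" by (simp add: N)
  also have "\<dots> = adj ?N ** ((adj X - mat 1) ** (X + mat 1)) ** ?N" by (simp only: matrix_mul_assoc)
  also have "(adj X - mat 1) ** (X + mat 1) = - ((adj X + mat 1) ** (X - mat 1))"
    by (simp add: matrix_distribs x)
  also have "adj ?N ** (- ((adj X + mat 1) ** (X - mat 1))) ** ?N =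
      - (adj ((X + mat 1) ** ?N) ** ((X - mat 1) ** ?N))"
    by (simp add: adj_mult adj_add matrix_mul_assoc)
  also have "\<dots> = - inv_cayley X" by (simp add: N inv_cayley_def)
  finally show ?thesis by (simp add: lie_algebra_def)
qed

lemma smooth_on_cayley: "smooth_on {A. det (mat 1 - A) \<noteq> 0} cayley"
  unfolding cayley_def
  by (intro smooth_on_matrix_mult smooth_on_matrix_inv smooth_on_add smooth_on_diff smooth_on_const smooth_on_id) auto

lemma smooth_on_inv_cayley: "smooth_on {X. det (X + mat 1) \<noteq> 0} inv_cayley"
  unfolding inv_cayley_def
  by (intro smooth_on_matrix_mult smooth_on_matrix_inv smooth_on_add smooth_on_diff smooth_on_const smooth_on_id) auto

lemma O_up_chart_mat_1:
  "\<exists>U V f (g :: 'm pmat \<Rightarrow> 'm pmat). mat 1 \<in> U \<and> openin (top_of_set (O_up :: 'm::finite pmat set)) U \<and>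
    openin (top_of_set lie_algebra) V \<and> diffeomorphism U V f g"
proof -
  let ?D = "{A :: 'm pmat. det (mat 1 - A) \<noteq> 0}" and ?E = "{X :: 'm pmat. det (X + mat 1) \<noteq> 0}"
  have "continuous_on UNIV (\<lambda>A :: 'm pmat. det (mat 1 - A))" "continuous_on UNIV (\<lambda>X :: 'm pmat. det (X + mat 1))"
    by (intro continuous_intros)+
  then have o: "open ?D" "open ?E" by (auto intro: open_Collect_neq continuous_on_const)
  moreover have "0 \<in> ?D" by simp
  ultimately obtain e where e: "e > 0" "ball 0 e \<subseteq> ?D" using open_contains_ball by blast
  \<comment> \<open>Cutting with a ball keeps the parameter set convex. Its image under
    \<open>cayley\<close> is then connected and stays in the identity component, not only in the
    pseudo-orthogonal group.\<close>
  define V where "V = (lie_algebra :: 'm pmat set) \<inter> ball 0 e"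
  define U where "U = (O_up :: 'm pmat set) \<inter> (?E \<inter> inv_cayley -` ball 0 e)"
  have "open (?E \<inter> inv_cayley -` ball 0 e)"
    by (rule continuous_open_preimage[OF smooth_on_imp_continuous_on[OF smooth_on_inv_cayley] o(2)]) simp
  then have U: "openin (top_of_set O_up) U" unfolding U_def by (rule openin_open_Int)
  have V: "openin (top_of_set lie_algebra) V" unfolding V_def by (simp add: openin_open_Int)
  have V': "A \<in> lie_algebra" "det (mat 1 - A) \<noteq> 0" if "A \<in> V" for A
    using that e unfolding V_def by auto
  have c1: "cayley 0 = (mat 1 :: 'm pmat)"
    using matrix_inv_unique[of "mat 1 :: 'm pmat" "mat 1"] by (simp add: cayley_def)
  have V0: "0 \<in> V" using e subspace_0[OF subspace_lie_algebra] by (simp add: V_def)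
  have "connected V"
    unfolding V_def by (intro convex_connected convex_Int subspace_imp_convex subspace_lie_algebra convex_ball)
  moreover have sV: "smooth_on V cayley" by (rule smooth_on_subset[OF smooth_on_cayley]) (use V' in auto)
  ultimately have cO: "cayley A \<in> O_up" if "A \<in> V" for A
    by (rule connected_image_O_up[OF _ smooth_on_imp_continuous_on V0])
       (use that V' in \<open>auto simp: c1 intro: cayley_pseudo_orthogonal\<close>)
  have g: "cayley A \<in> U" if "A \<in> V" for A
    using cO[OF that] inv_cayley_cayley[OF V'(2)[OF that]] that unfolding U_def V_def by simp
  have f: "inv_cayley X \<in> V" if "X \<in> U" for X
    using that inv_cayley_lie_algebra O_up_subset unfolding U_def V_def by auto
  have gf: "cayley (inv_cayley X) = X" if "X \<in> U" for X
    using that cayley_inv_cayley unfolding U_def by auto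
  have fg: "inv_cayley (cayley A) = A" if "A \<in> V" for A
    using inv_cayley_cayley V'(2)[OF that] by blast
  have "smooth_on U inv_cayley" by (rule smooth_on_subset[OF smooth_on_inv_cayley]) (auto simp: U_def)
  then have "diffeomorphism U V inv_cayley cayley" by (rule diffeomorphismI[OF _ sV f g gf fg])
  moreover have "mat 1 \<in> U" using g[OF V0] c1 by simp
  ultimately show ?thesis
    using U V by - (rule exI[of _ U], rule exI[of _ V], rule exI[of _ inv_cayley], rule exI[of _ cayley], intro conjI)
qed

text \<open>The chart at the identity moved by left translation. The prescribed neighbourhood
  \<open>N\<close> will be the domain of a branch of the argument, so that charts of the covering
  group can be built on top.\<close>

lemma O_up_chart:
  fixes p :: "'m::finite pmat"
  assumes p: "p \<in> O_up" and N: "open N" "p \<in> N"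
  shows "\<exists>U V f (g :: 'm pmat \<Rightarrow> 'm pmat). p \<in> U \<and> U \<subseteq> N \<and> openin (top_of_set O_up) U \<and>
    openin (top_of_set lie_algebra) V \<and> diffeomorphism U V f g"
proof -
  obtain U V f and g :: "'m pmat \<Rightarrow> 'm pmat" where U: "mat 1 \<in> U" "openin (top_of_set (O_up :: 'm pmat set)) U"
    and V: "openin (top_of_set (lie_algebra :: 'm pmat set)) V" and d: "diffeomorphism U V f g"
    using O_up_chart_mat_1 by blast
  have UO: "U \<subseteq> O_up" using U openin_imp_subset by blast
  have l: "p ** (adj p ** X) = X" "adj p ** (p ** X) = X" for X :: "'m pmat"
    using O_up_adj_left[OF p] O_up_adj_right[OF p] by (simp_all add: matrix_mul_assoc)
  define U' where "U' = O_up \<inter> (\<lambda>X. adj p ** X) -` U"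
  have "openin (top_of_set O_up) U'"
    unfolding U'_def
  proof (rule continuous_openin_preimage[OF _ _ U(2)])
    show "continuous_on O_up (\<lambda>X. adj p ** X)" by (intro continuous_intros)
    show "(\<lambda>X. adj p ** X) \<in> O_up \<rightarrow> O_up" using p by (auto intro: O_up_mult O_up_adj)
  qed
  moreover have d': "diffeomorphism U' V (\<lambda>X. f (adj p ** X)) (\<lambda>A. p ** g A)"
  proof -
    have d0: "smooth_on U f" "smooth_on V g" "f ` U = V" "g ` V = U" "\<forall>x\<in>U. g (f x) = x" "\<forall>y\<in>V. f (g y) = y"
      using diffeomorphismD[OF d] by auto
    have gV: "g A \<in> U" "p ** g A \<in> U'" if "A \<in> V" for A
      using that d0(4) UO l p unfolding U'_def by (auto intro: O_up_mult)
    show ?thesis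
    proof (rule diffeomorphismI)
      show "smooth_on U' (\<lambda>X. f (adj p ** X))"
        by (rule smooth_on_compose[OF d0(1) smooth_on_matrix_mult[OF smooth_on_const smooth_on_id]]) (auto simp: U'_def)
      show "smooth_on V (\<lambda>A. p ** g A)"
        by (intro smooth_on_matrix_mult smooth_on_const d0)
      show "f (adj p ** X) \<in> V" "p ** g (f (adj p ** X)) = X" if "X \<in> U'" for X
        using that d0(3,5) l by (auto simp: U'_def)
      show "f (adj p ** (p ** g A)) = A" if "A \<in> V" for A
        using that d0(6) l by auto
    qed (rule gV)
  qed
  ultimately have "openin (top_of_set U') (U' \<inter> N)" "openin (top_of_set O_up) (U' \<inter> N)"
    using N by (auto intro: openin_open_Int openin_Int_open)
  moreover have "p \<in> U' \<inter> N" using p N U O_up_adj_left[OF p] by (simp add: U'_def)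
  moreover have "openin (top_of_set lie_algebra) ((\<lambda>X. f (adj p ** X)) ` (U' \<inter> N))"
    using diffeomorphism_openin_image[OF d' \<open>openin (top_of_set U') (U' \<inter> N)\<close>] V openin_trans by blast
  moreover have "diffeomorphism (U' \<inter> N) ((\<lambda>X. f (adj p ** X)) ` (U' \<inter> N)) (\<lambda>X. f (adj p ** X)) (\<lambda>A. p ** g A)"
    by (rule diffeomorphism_subset[OF d']) auto
  ultimately show ?thesis
    by - (rule exI[of _ "U' \<inter> N"], rule exI[of _ "(\<lambda>X. f (adj p ** X)) ` (U' \<inter> N)"],
        rule exI[of _ "\<lambda>X. f (adj p ** X)"], rule exI[of _ "\<lambda>A. p ** g A"], intro conjI Int_lower2)
qed

lemma smooth_manifoldI:
  fixes M :: "'a::euclidean_space set"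
  assumes W: "subspace W"
    and ch: "\<And>p. p \<in> M \<Longrightarrow> \<exists>U V f (g :: 'a \<Rightarrow> 'a). p \<in> U \<and> openin (top_of_set M) U \<and>
      openin (top_of_set W) V \<and> diffeomorphism U V f g"
  shows "smooth_manifold M"
  unfolding smooth_manifold_def
proof (rule exI[of _ "dim W"], rule ballI)
  fix p assume "p \<in> M"
  then obtain U V f and g :: "'a \<Rightarrow> 'a" where "p \<in> U" "openin (top_of_set M) U"
    "openin (top_of_set W) V" "diffeomorphism U V f g"
    using ch by blast
  then show "\<exists>U W' V f g. p \<in> U \<and> openin (top_of_set M) U \<and> subspace (W' :: 'a set) \<and> dim W' = dim W \<and>
      openin (top_of_set W') V \<and> diffeomorphism U V f g"
    using W by - (rule exI[of _ U], rule exI[of _ W], rule exI[of _ V], rule exI[of _ f], rule exI[of _ g], simp)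
qed

lemma smooth_manifold_O_up: "smooth_manifold (O_up :: 'm::finite pmat set)"
proof (rule smooth_manifoldI[OF subspace_lie_algebra])
  fix p :: "'m pmat" assume "p \<in> O_up"
  from O_up_chart[OF this open_UNIV UNIV_I]
  show "\<exists>U V f (g :: 'm pmat \<Rightarrow> 'm pmat). p \<in> U \<and> openin (top_of_set O_up) U \<and>
      openin (top_of_set lie_algebra) V \<and> diffeomorphism U V f g" by blast
qed

lemma lie_group_O_up: "lie_group (O_up_group :: 'm::finite pmat monoid)"
  unfolding lie_group_def O_up_group_simps(1)
  by (intro conjI group_O_up smooth_manifold_O_up smooth_on_O_up_mult smooth_on_O_up_inv)

text \<open>The branch of the argument of \<open>lam\<close> around \<open>p\<close>, normalized to
  take the value \<open>t\<close> at \<open>p\<close>; \<open>lift_domain p\<close> is where the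
  quotient avoids the branch cut.\<close>

definition local_lift :: "'m::finite pmat \<Rightarrow> real \<Rightarrow> 'm pmat \<Rightarrow> real" where
  "local_lift p t X = t + Im (Ln (lam X / lam p))"

definition lift_domain :: "'m::finite pmat \<Rightarrow> 'm pmat set" where
  "lift_domain p = {X. lam X / lam p \<notin> \<real>\<^sub>\<le>\<^sub>0}"

lemma open_lift_domain: "open (lift_domain (p :: 'm::finite pmat))"
proof -
  have "continuous_on UNIV (\<lambda>X :: 'm pmat. lam X / lam p)"
    by (rule bounded_linear.continuous_on[OF bounded_linear_divide linear_continuous_on[OF bounded_linear_lam]])
  then have "open ((\<lambda>X :: 'm pmat. lam X / lam p) -` (- \<real>\<^sub>\<le>\<^sub>0))"
    by (rule open_vimage[OF open_Compl[OF closed_nonpos_Reals_complex]])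
  moreover have "(\<lambda>X. lam X / lam p) -` (- \<real>\<^sub>\<le>\<^sub>0) = lift_domain p" by (auto simp: lift_domain_def)
  ultimately show ?thesis by simp
qed

lemma lift_domain_self:
  fixes p :: "'m::{finite,linorder} pmat"
  assumes "p \<in> O_up"
  shows "p \<in> lift_domain p" "local_lift p t p = t"
  using lam_nonzero[OF assms] by (simp_all add: lift_domain_def local_lift_def)

lemma smooth_on_local_lift: "smooth_on (lift_domain p) (local_lift p t)"
proof -
  have "smooth_on (lift_domain p) (\<lambda>X. lam X / lam p)"
    by (rule smooth_on_linear_compose[OF bounded_linear_divide smooth_on_bounded_linear[OF bounded_linear_lam]])
  then have "smooth_on (lift_domain p) (\<lambda>X. Im (Ln (lam X / lam p)))"
    by (rule smooth_on_arg) (simp add: lift_domain_def)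
  then show ?thesis unfolding local_lift_def[abs_def] by (rule smooth_on_add[OF smooth_on_const])
qed

lemma psi_local_lift:
  fixes p :: "'m::{finite,linorder} pmat"
  assumes p: "p \<in> O_up" "psi p = rho t" and X: "X \<in> O_up"
  shows "psi X = rho (local_lift p t X)"
proof -
  have "cis (local_lift p t X) = cis t * cis (Im (Ln (lam X / lam p)))"
    by (simp add: local_lift_def cis_mult)
  also have "\<dots> = sgn (lam p) * sgn (lam X / lam p)"
    using lam_nonzero[OF p(1)] lam_nonzero[OF X] p by (simp add: psi_eq_rho_iff[OF p(1)] cis_Im_Ln)
  also have "\<dots> = sgn (lam p * (lam X / lam p))" by (simp only: sgn_mult)
  also have "lam p * (lam X / lam p) = lam X" using lam_nonzero[OF p(1)] by simp
  finally show ?thesis by (simp add: psi_eq_rho_iff[OF X])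
qed

text \<open>One lift of the angle is known, and two lifts differ by a multiple of 2 pi. On
  \<open>O_up\<close> this holds even where the branch is not continuous, since any value of the
  argument will do.\<close>

lemma O_hat_local_lift:
  fixes p :: "'m::{finite,linorder} pmat"
  assumes p: "p \<in> O_up" "psi p = rho t" and X: "X \<in> O_up"
  shows "(X, s) \<in> O_hat \<longleftrightarrow> (\<exists>k::int. s = local_lift p t X + 2 * pi * of_int k)"
proof -
  have "(X, s) \<in> O_hat \<longleftrightarrow> cis s = cis (local_lift p t X)"
    using psi_local_lift[OF assms] lam2_inject[OF rho_SO[of "local_lift p t X"] rho_SO[of s]] X
    by (auto simp: mem_O_hat_iff dest: arg_cong[of _ _ lam2])
  also have "\<dots> \<longleftrightarrow> (\<exists>k::int. s = local_lift p t X + 2 * pi * of_int k)"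
  proof
    assume "cis s = cis (local_lift p t X)"
    then have "cis (s - local_lift p t X) = 1" by (simp flip: cis_divide)
    then obtain k :: int where "s - local_lift p t X = 2 * pi * of_int k" by (rule cis_eq_1D)
    then have "s = local_lift p t X + 2 * pi * of_int k" by simp
    then show "\<exists>k::int. s = local_lift p t X + 2 * pi * of_int k" ..
  next
    assume "\<exists>k::int. s = local_lift p t X + 2 * pi * of_int k"
    then obtain k :: int where "s = local_lift p t X + 2 * pi * of_int k" ..
    then have "cis s = cis (local_lift p t X) * cis (2 * pi * of_int k)" by (simp only: cis_mult)
    then show "cis s = cis (local_lift p t X)" by (simp only: cis_multiple_2pi Ints_of_int mult_1_right)
  qed
  finally show ?thesis .
qed

text \<open>Half the spacing 2 pi: in the open strip of half-width pi around the branch no other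
  lift fits.\<close>

lemma O_hat_local_lift_near:
  fixes p :: "'m::{finite,linorder} pmat"
  assumes "p \<in> O_up" "psi p = rho t" "X \<in> O_up" "\<bar>s - local_lift p t X\<bar> < pi"
  shows "(X, s) \<in> O_hat \<longleftrightarrow> s = local_lift p t X"
proof
  assume "(X, s) \<in> O_hat"
  then obtain k :: int where k: "s = local_lift p t X + 2 * pi * of_int k"
    using O_hat_local_lift[OF assms(1-3)] by blast
  then have "pi * (2 * \<bar>of_int k\<bar>) < pi * 1" using assms(4) by (simp add: abs_mult)
  then have "2 * \<bar>real_of_int k\<bar> < 1" by (subst (asm) mult_less_cancel_left_pos) simp_all
  then have "k = 0" by linarith
  then show "s = local_lift p t X" using k by simp
next
  assume s: "s = local_lift p t X"
  show "(X, s) \<in> O_hat"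
    unfolding O_hat_local_lift[OF assms(1-3)] by (rule exI[of _ 0]) (simp add: s)
qed

text \<open>An open strip around the graph of the branch. Subtracting the branch from the second
  coordinate flattens the strip to a product, in which \<open>O_hat\<close> becomes the slice of
  height zero.\<close>

definition straight :: "'m::finite pmat set \<Rightarrow> 'm pmat \<Rightarrow> real \<Rightarrow> ('m pmat \<times> real) set" where
  "straight U p t = {x \<in> U \<times> UNIV. \<bar>snd x - local_lift p t (fst x)\<bar> < pi}"

lemma straight_chart:
  fixes p :: "'m::{finite,linorder} pmat" and g :: "'m pmat \<Rightarrow> 'm pmat"
  assumes p: "p \<in> O_up"
    and U: "p \<in> U" "U \<subseteq> lift_domain p" "openin (top_of_set O_up) U"
    and V: "openin (top_of_set lie_algebra) V" and d: "diffeomorphism U V f g"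
  shows "(p, t) \<in> straight U p t"
    and "openin (top_of_set (O_up \<times> UNIV)) (straight U p t)"
    and "openin (top_of_set (lie_algebra \<times> UNIV)) (V \<times> {- pi<..<pi})"
    and "diffeomorphism (straight U p t) (V \<times> {- pi<..<pi})
      (\<lambda>x. (f (fst x), snd x - local_lift p t (fst x))) (\<lambda>y. (g (fst y), snd y + local_lift p t (g (fst y))))"
proof -
  let ?h = "local_lift p t" and ?M = "straight U p t" and ?N = "V \<times> {- pi<..<pi}"
  let ?F = "\<lambda>x. (f (fst x), snd x - ?h (fst x))" and ?G = "\<lambda>y. (g (fst y), snd y + ?h (g (fst y)))"
  note d' = diffeomorphismD[OF d]
  show "(p, t) \<in> ?M" using U(1) lift_domain_self(2)[OF p] by (simp add: straight_def)
  have h: "smooth_on U ?h" by (rule smooth_on_subset[OF smooth_on_local_lift U(2)])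
  have f1: "smooth_on (U \<times> UNIV) (\<lambda>x. ?h (fst x))"
    by (rule smooth_on_compose[OF h smooth_on_fst[OF smooth_on_id]]) auto
  have "openin (top_of_set (U \<times> UNIV)) ((U \<times> UNIV) \<inter> (\<lambda>x. \<bar>snd x - ?h (fst x)\<bar>) -` {..<pi})"
    by (intro continuous_openin_preimage_gen continuous_on_rabs continuous_on_diff continuous_on_snd
        continuous_on_id smooth_on_imp_continuous_on[OF f1] open_lessThan)
  moreover have "(U \<times> UNIV) \<inter> (\<lambda>x. \<bar>snd x - ?h (fst x)\<bar>) -` {..<pi} = ?M"
    by (auto simp: straight_def)
  ultimately have M: "openin (top_of_set (U \<times> UNIV)) ?M" by simp
  show "openin (top_of_set (O_up \<times> UNIV)) ?M"
    by (rule openin_trans[OF M openin_Times[OF U(3) openin_subtopology_self]])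
  have "openin (top_of_set UNIV) {- pi<..<pi}" by simp
  then show "openin (top_of_set (lie_algebra \<times> UNIV)) ?N" by (rule openin_Times[OF V])
  show "diffeomorphism ?M ?N ?F ?G"
  proof (rule diffeomorphismI)
    have MU: "fst x \<in> U" if "x \<in> ?M" for x using that by (auto simp: straight_def)
    show "smooth_on ?M ?F"
      by (intro smooth_on_Pair smooth_on_diff smooth_on_snd smooth_on_id
          smooth_on_compose[OF d'(1) smooth_on_fst[OF smooth_on_id] MU]
          smooth_on_compose[OF h smooth_on_fst[OF smooth_on_id] MU])
    have gV: "smooth_on ?N (\<lambda>y. g (fst y))"
      by (rule smooth_on_compose[OF d'(2) smooth_on_fst[OF smooth_on_id]]) auto
    show "smooth_on ?N ?G"
      by (intro smooth_on_Pair smooth_on_add smooth_on_snd smooth_on_id gV smooth_on_compose[OF h gV]) (auto intro: d'(4))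
    show "?F x \<in> ?N" if "x \<in> ?M" for x
      using that d'(3) by (auto simp: straight_def abs_less_iff)
    show "?G y \<in> ?M" if "y \<in> ?N" for y
      using that d'(4) by (auto simp: straight_def abs_less_iff)
    show "?G (?F x) = x" if "x \<in> ?M" for x
      using d'(5)[OF MU[OF that]] by simp
    show "?F (?G y) = y" if "y \<in> ?N" for y
      using that d'(6) by auto
  qed
qed

lemma straight_chart_O_hat:
  fixes p :: "'m::{finite,linorder} pmat" and g :: "'m pmat \<Rightarrow> 'm pmat"
  assumes p: "p \<in> O_up" and U: "p \<in> U" "U \<subseteq> lift_domain p" "openin (top_of_set O_up) U"
    and V: "openin (top_of_set lie_algebra) V" and d: "diffeomorphism U V f g"
    and psi: "psi p = rho t"
  shows "(\<lambda>x. (f (fst x), snd x - local_lift p t (fst x))) ` (O_hat \<inter> straight U p t) =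
    (lie_algebra \<times> {0}) \<inter> (V \<times> {- pi<..<pi})"
proof -
  let ?h = "local_lift p t" and ?M = "straight U p t" and ?N = "V \<times> {- pi<..<pi}"
  let ?F = "\<lambda>x. (f (fst x), snd x - ?h (fst x))" and ?G = "\<lambda>y. (g (fst y), snd y + ?h (g (fst y)))"
  have UO: "U \<subseteq> O_up" using U(3) openin_imp_subset by blast
  have VW: "V \<subseteq> lie_algebra" using V openin_imp_subset by blast
  note D' = diffeomorphismD[OF straight_chart(4)[OF p U V d]]
  have key: "x \<in> O_hat \<longleftrightarrow> snd x = ?h (fst x)" if "x \<in> ?M" for x
    using O_hat_local_lift_near[OF p psi, of "fst x" "snd x"] that UO by (auto simp: straight_def)
  show ?thesis
  proof
    show "?F ` (O_hat \<inter> ?M) \<subseteq> (lie_algebra \<times> {0}) \<inter> ?N"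
      using key D'(3) VW by fastforce
    show "(lie_algebra \<times> {0}) \<inter> ?N \<subseteq> ?F ` (O_hat \<inter> ?M)"
    proof
      fix y assume y: "y \<in> (lie_algebra \<times> {0}) \<inter> ?N"
      then have "?G y \<in> ?M" "?F (?G y) = y" using D'(4,6) by blast+
      moreover from this have "?G y \<in> O_hat" using key y by auto
      ultimately show "y \<in> ?F ` (O_hat \<inter> ?M)" by (intro image_eqI[of _ _ "?G y"]) auto
    qed
  qed
qed

lemma O_hat_chart:
  fixes x :: "'m::{finite,linorder} pmat \<times> real"
  assumes "x \<in> O_hat"
  obtains p t U V f and g :: "'m pmat \<Rightarrow> 'm pmat"
  where "x = (p, t)" "psi p = rho t" "p \<in> O_up" "p \<in> U" "U \<subseteq> lift_domain p" "openin (top_of_set O_up) U"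
    "openin (top_of_set lie_algebra) V" "diffeomorphism U V f g"
proof -
  obtain p t where x: "x = (p, t)" by (rule prod.exhaust)
  then have p: "p \<in> O_up" "psi p = rho t" using assms by (auto simp: mem_O_hat_iff)
  from O_up_chart[OF p(1) open_lift_domain lift_domain_self(1)[OF p(1)]]
  obtain U V f and g :: "'m pmat \<Rightarrow> 'm pmat" where "p \<in> U" "U \<subseteq> lift_domain p" "openin (top_of_set O_up) U"
    "openin (top_of_set (lie_algebra :: 'm pmat set)) V" "diffeomorphism U V f g" by blast
  with x p(2) p(1) show thesis by (rule that)
qed

lemma subspace_lie_algebra_Times:
  "subspace (lie_algebra \<times> (UNIV :: real set))" "subspace (lie_algebra \<times> {0 :: real})"
  by (intro subspace_Times subspace_lie_algebra subspace_UNIV subspace_single_0)+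

lemma smooth_manifold_O_up_Times:
  "smooth_manifold (O_up \<times> UNIV :: ('m::{finite,linorder} pmat \<times> real) set)"
proof (rule smooth_manifoldI[OF subspace_lie_algebra_Times(1)])
  fix x :: "'m pmat \<times> real" assume "x \<in> O_up \<times> UNIV"
  then obtain p t where x: "x = (p, t)" "p \<in> O_up" by auto
  from O_up_chart[OF x(2) open_lift_domain lift_domain_self(1)[OF x(2)]]
  obtain U V f and g :: "'m pmat \<Rightarrow> 'm pmat" where c: "p \<in> U" "U \<subseteq> lift_domain p" "openin (top_of_set O_up) U"
    "openin (top_of_set (lie_algebra :: 'm pmat set)) V" "diffeomorphism U V f g" by blast
  note s = straight_chart(1,2)[OF x(2) c, of t, folded x(1)] straight_chart(3)[OF x(2) c] straight_chart(4)[OF x(2) c, of t]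
  show "\<exists>U V f (g :: 'm pmat \<times> real \<Rightarrow> 'm pmat \<times> real). x \<in> U \<and> openin (top_of_set (O_up \<times> UNIV)) U \<and>
      openin (top_of_set (lie_algebra \<times> UNIV)) V \<and> diffeomorphism U V f g"
    by (rule exI, rule exI, rule exI, rule exI, intro conjI) (rule s)+
qed

lemma O_hat_subset: "O_hat \<subseteq> O_up \<times> UNIV"
  by (auto simp: mem_O_hat_iff)

lemma embedded_submanifold_O_hat:
  "embedded_submanifold (O_hat :: ('m::{finite,linorder} pmat \<times> real) set) (O_up \<times> UNIV)"
  unfolding embedded_submanifold_def
proof (intro conjI smooth_manifold_O_up_Times O_hat_subset, rule exI[of _ "dim (lie_algebra \<times> {0} :: ('m pmat \<times> real) set)"], rule ballI)
  fix x :: "'m pmat \<times> real" assume "x \<in> O_hat"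
  then obtain p t U V f and g :: "'m pmat \<Rightarrow> 'm pmat"
  where x: "x = (p, t)" and psi: "psi p = rho t" and c: "p \<in> O_up" "p \<in> U" "U \<subseteq> lift_domain p" "openin (top_of_set O_up) U"
    "openin (top_of_set lie_algebra) V" "diffeomorphism U V f g"
    by (rule O_hat_chart)
  note s = straight_chart(1,2)[OF c, of t] straight_chart(3)[OF c] straight_chart(4)[OF c, of t]
    straight_chart_O_hat[OF c psi]
  show "\<exists>U W V L f g.
      x \<in> U \<and> openin (top_of_set (O_up \<times> UNIV)) U \<and> subspace (W :: ('m pmat \<times> real) set) \<and>
      openin (top_of_set W) V \<and> diffeomorphism U V f g \<and> subspace L \<and> L \<subseteq> W \<and>
      dim L = dim (lie_algebra \<times> {0} :: ('m pmat \<times> real) set) \<and> f ` (O_hat \<inter> U) = L \<inter> V"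
    by (rule exI[of _ "straight U p t"], rule exI[of _ "lie_algebra \<times> UNIV"], rule exI[of _ "V \<times> {- pi<..<pi}"],
        rule exI[of _ "lie_algebra \<times> {0}"], rule exI, rule exI, intro conjI)
       (use s(1) x in simp, rule s(2), rule subspace_lie_algebra_Times, rule s(3), rule s(4),
        rule subspace_lie_algebra_Times, force, rule refl, rule s(5))
qed

lemma openin_straight_O_hat:
  assumes "openin (top_of_set (O_up \<times> UNIV)) (straight U p t)"
  shows "openin (top_of_set O_hat) (O_hat \<inter> straight U p t)"
  using openin_subtopology_Int_subset[of "O_up \<times> UNIV" "straight U p t" O_hat] assms O_hat_subset
    openin_imp_subset[OF assms] by (simp add: Int_absorb1)

text \<open>The slice charts of the ambient product, restricted to \<open>O_hat\<close>, become
  charts with model space \<open>lie_algebra \<times> {0}\<close>.\<close>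

lemma smooth_manifold_O_hat: "smooth_manifold (O_hat :: ('m::{finite,linorder} pmat \<times> real) set)"
proof (rule smooth_manifoldI[OF subspace_lie_algebra_Times(2)])
  fix x :: "'m pmat \<times> real" assume x0: "x \<in> O_hat"
  then obtain p t U V f and g :: "'m pmat \<Rightarrow> 'm pmat"
  where x: "x = (p, t)" and psi: "psi p = rho t" and c: "p \<in> O_up" "p \<in> U" "U \<subseteq> lift_domain p" "openin (top_of_set O_up) U"
    "openin (top_of_set lie_algebra) V" "diffeomorphism U V f g"
    by (rule O_hat_chart)
  note s = straight_chart(1,2)[OF c, of t] straight_chart(3)[OF c] straight_chart(4)[OF c, of t]
    straight_chart_O_hat[OF c psi]
  have "openin (top_of_set O_hat) (O_hat \<inter> straight U p t)" by (rule openin_straight_O_hat[OF s(2)])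
  moreover have "openin (top_of_set (lie_algebra \<times> {0})) ((lie_algebra \<times> {0}) \<inter> (V \<times> {- pi<..<pi}))"
    using openin_subtopology_Int_subset[of "lie_algebra \<times> UNIV" "V \<times> {- pi<..<pi}" "lie_algebra \<times> {0}"] s(3)
      openin_imp_subset[OF s(3)] by (simp add: Int_absorb1 Sigma_mono)
  moreover note diffeomorphism_subset[OF s(4), of "O_hat \<inter> straight U p t", unfolded s(5), OF Int_lower2]
  moreover have "x \<in> O_hat \<inter> straight U p t" using s(1) x x0 by simp
  ultimately show "\<exists>U V f (g :: 'm pmat \<times> real \<Rightarrow> 'm pmat \<times> real). x \<in> U \<and> openin (top_of_set O_hat) U \<and>
      openin (top_of_set (lie_algebra \<times> {0})) V \<and> diffeomorphism U V f g"
    by - (rule exI, rule exI, rule exI, rule exI, intro conjI)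
qed

lemma lie_group_O_hat:
  assumes card: "2 \<le> CARD('m)"
  shows "lie_group (O_hat_group :: ('m::{finite,linorder} pmat \<times> real) monoid)"
  unfolding lie_group_def O_hat_group_simps(1)
  by (intro conjI group_O_hat smooth_manifold_O_hat smooth_on_O_hat_mult smooth_on_O_hat_inv card)

section \<open>The covering\<close>

lemma sigma_cov_eq: "sigma_cov = fst"
  by (auto simp: sigma_cov_def fun_eq_iff)

lemma O_hat_fiber:
  fixes X :: "'m::{finite,linorder} pmat"
  assumes "X \<in> O_up"
  obtains t where "psi X = rho t" "(X, t) \<in> O_hat"
proof -
  obtain t where "psi X = rho t" using SO_two_rho[OF psi_Psi(1)[OF assms]] by blast
  then show thesis using assms by (intro that[of t]) (auto simp: mem_O_hat_iff)
qed

lemma covering_sigma: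
  "covering_space (O_hat :: ('m::{finite,linorder} pmat \<times> real) set) sigma_cov O_up"
  unfolding covering_space_def sigma_cov_eq
proof (intro conjI ballI)
  show "continuous_on O_hat fst" by (intro continuous_intros)
  show "fst ` O_hat = (O_up :: 'm pmat set)"
  proof
    show "O_up \<subseteq> fst ` (O_hat :: ('m pmat \<times> real) set)"
    proof
      fix X :: "'m pmat" assume "X \<in> O_up"
      then obtain t where "(X, t) \<in> O_hat" by (rule O_hat_fiber)
      then show "X \<in> fst ` O_hat" by (rule image_eqI[rotated]) simp
    qed
  qed (auto simp: mem_O_hat_iff)
next
  fix p :: "'m pmat" assume p: "p \<in> O_up"
  then obtain t where t: "psi p = rho t" by (rule O_hat_fiber)
  define h where "h = local_lift p t"
  define T where "T = O_up \<inter> lift_domain p"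
  have T: "openin (top_of_set O_up) T" unfolding T_def by (rule openin_open_Int[OF open_lift_domain])
  have hT: "continuous_on T h"
    unfolding h_def T_def
    by (rule continuous_on_subset[OF smooth_on_imp_continuous_on[OF smooth_on_local_lift]]) auto
  have O: "(X, s) \<in> O_hat \<longleftrightarrow> (\<exists>k::int. s = h X + 2 * pi * of_int k)" if "X \<in> O_up" for X s
    unfolding h_def by (rule O_hat_local_lift[OF p t that])
  \<comment> \<open>The candidate sheets: the graph of the branch shifted vertically by all
    multiples of 2 pi.\<close>
  define u where "u k = (\<lambda>X. (X, h X + 2 * pi * of_int k)) ` T" for k :: int
  let ?S = "O_hat \<inter> fst -` T"
  have S: "openin (top_of_set O_hat) ?S"
    by (rule continuous_openin_preimage[OF _ _ T]) (auto intro!: continuous_intros simp: mem_O_hat_iff)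
  \<comment> \<open>Each sheet is also cut out of \<open>O_hat\<close> by an open condition, namely
    distance below pi from the shifted branch. This description yields openness, whereas the graph
    description yields the homeomorphism onto \<open>T\<close>.\<close>
  have uS: "x \<in> u k \<longleftrightarrow> x \<in> ?S \<and> \<bar>snd x - h (fst x) - 2 * pi * of_int k\<bar> < pi" for x k
  proof -
    obtain X s where x: "x = (X, s)" by (rule prod.exhaust)
    show ?thesis
    proof (cases "X \<in> T")
      case True
      then have X: "X \<in> O_up" by (simp add: T_def)
      have "s = h X + 2 * pi * of_int k"
        if "s = h X + 2 * pi * of_int l" "\<bar>s - h X - 2 * pi * of_int k\<bar> < pi" for l :: int
      proof -
        define m where "m = l - k"
        have "s - h X - 2 * pi * of_int k = 2 * pi * of_int m" using that(1) by (simp add: m_def algebra_simps)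
        then have "pi * (2 * \<bar>of_int m\<bar>) < pi * 1" using that(2) by (simp add: abs_mult)
        then have "2 * \<bar>real_of_int m\<bar> < 1" by (subst (asm) mult_less_cancel_left_pos) simp_all
        then have "m = 0" by linarith
        then show ?thesis using that(1) by (simp add: m_def)
      qed
      then show ?thesis using True O[OF X] by (auto simp: x u_def)
    qed (auto simp: x u_def)
  qed
  have uo: "openin (top_of_set O_hat) (u k)" for k
  proof -
    have "continuous_on ?S (\<lambda>x. h (fst x))"
      by (rule continuous_on_compose2[OF hT]) (auto intro: continuous_intros)
    then have "openin (top_of_set ?S) (?S \<inter> (\<lambda>x. \<bar>snd x - h (fst x) - 2 * pi * of_int k\<bar>) -` {..<pi})"
      by (intro continuous_openin_preimage_gen continuous_on_rabs continuous_on_diff continuous_on_snd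
          continuous_on_id continuous_on_const open_lessThan)
    moreover have "?S \<inter> (\<lambda>x. \<bar>snd x - h (fst x) - 2 * pi * of_int k\<bar>) -` {..<pi} = u k"
      using uS by auto
    ultimately have "openin (top_of_set ?S) (u k)" by simp
    then show ?thesis using S by (rule openin_trans)
  qed
  have "\<Union>(range u) = ?S"
  proof
    show "\<Union>(range u) \<subseteq> ?S" using uS by blast
    show "?S \<subseteq> \<Union>(range u)"
    proof
      fix x assume x: "x \<in> ?S"
      then have "fst x \<in> O_up" by (simp add: T_def)
      from O[OF this, of "snd x"] x obtain k :: int where "snd x = h (fst x) + 2 * pi * of_int k" by auto
      then have "x \<in> u k" using x unfolding u_def by (intro image_eqI[of _ _ "fst x"]) (auto simp: prod_eq_iff)
      then show "x \<in> \<Union>(range u)" by blast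
    qed
  qed
  moreover have "pairwise disjnt (range u)"
    unfolding pairwise_def disjnt_def u_def by auto
  moreover have "\<exists>q. homeomorphism (u k) T fst q" for k
  proof
    show "homeomorphism (u k) T fst (\<lambda>X. (X, h X + 2 * pi * of_int k))"
      unfolding homeomorphism_def u_def
      by (auto intro!: continuous_intros hT simp: image_image)
  qed
  ultimately have "\<Union>(range u) = O_hat \<inter> fst -` T \<and> (\<forall>w\<in>range u. openin (top_of_set O_hat) w) \<and>
      pairwise disjnt (range u) \<and> (\<forall>w\<in>range u. \<exists>q. homeomorphism w T fst q)"
    using uo by auto
  moreover have "p \<in> T" using p lift_domain_self(1)[OF p] by (simp add: T_def)
  ultimately show "\<exists>T. p \<in> T \<and> openin (top_of_set O_up) T \<and>
      (\<exists>v. \<Union>v = O_hat \<inter> fst -` T \<and> (\<forall>u\<in>v. openin (top_of_set O_hat) u) \<and>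
        pairwise disjnt v \<and> (\<forall>u\<in>v. \<exists>q. homeomorphism u T fst q))"
    using T by - (rule exI[of _ T], intro conjI, assumption, assumption, rule exI[of _ "range u"])
qed

text \<open>Inside a strip the covering group is the graph of a smooth function, and projecting a
  graph to its domain is inverted by that function.\<close>

lemma local_diffeomorphism_sigma:
  "local_diffeomorphism (O_hat :: ('m::{finite,linorder} pmat \<times> real) set) O_up sigma_cov"
  unfolding local_diffeomorphism_def sigma_cov_eq
proof
  fix x :: "'m pmat \<times> real" assume x0: "x \<in> O_hat"
  then obtain p t T V f and g :: "'m pmat \<Rightarrow> 'm pmat"
  where x: "x = (p, t)" and psi: "psi p = rho t" and c: "p \<in> O_up" "p \<in> T" "T \<subseteq> lift_domain p"
    "openin (top_of_set O_up) T" "openin (top_of_set lie_algebra) V" "diffeomorphism T V f g"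
    by (rule O_hat_chart)
  let ?h = "local_lift p t" and ?U = "O_hat \<inter> straight T p t"
  have TO: "T \<subseteq> O_up" using c(4) openin_imp_subset by blast
  have near: "(X, s) \<in> ?U \<longleftrightarrow> X \<in> T \<and> s = ?h X" for X s
    using O_hat_local_lift_near[OF c(1) psi, of X s] TO by (auto simp: straight_def)
  have "diffeomorphism ?U T fst (\<lambda>X. (X, ?h X))"
  proof (rule diffeomorphismI)
    show "smooth_on T (\<lambda>X. (X, ?h X))"
      by (rule smooth_on_Pair[OF smooth_on_id smooth_on_subset[OF smooth_on_local_lift c(3)]])
    show "smooth_on ?U fst" by (rule smooth_on_bounded_linear[OF bounded_linear_fst])
    show "fst y \<in> T" "(fst y, ?h (fst y)) = y" if "y \<in> ?U" for y
      using that near[of "fst y" "snd y"] by (auto simp: prod_eq_iff)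
  qed (use near in auto)
  moreover have "x \<in> ?U" using x0 straight_chart(1)[OF c, of t] by (simp add: x)
  moreover have "openin (top_of_set O_hat) ?U" by (rule openin_straight_O_hat[OF straight_chart(2)[OF c]])
  ultimately show "\<exists>U V g. x \<in> U \<and> openin (top_of_set O_hat) U \<and> openin (top_of_set O_up) V \<and>
      diffeomorphism U V fst g"
    using c(4) by blast
qed

lemma lie_covering_hom_sigma:
  assumes card: "2 \<le> CARD('m)"
  shows "lie_covering_hom (O_hat_group :: ('m::{finite,linorder} pmat \<times> real) monoid) O_up_group sigma_cov"
  unfolding lie_covering_hom_def O_hat_group_simps(1) O_up_group_simps(1)
proof (intro conjI lie_group_O_hat lie_group_O_up card covering_sigma local_diffeomorphism_sigma)
  show "sigma_cov \<in> hom (O_hat_group :: ('m pmat \<times> real) monoid) O_up_group"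
    by (auto simp: hom_def sigma_cov_eq mem_O_hat_iff)
  show "smooth_on O_hat (sigma_cov :: 'm pmat \<times> real \<Rightarrow> _)"
    unfolding sigma_cov_eq by (rule smooth_on_bounded_linear[OF bounded_linear_fst])
qed

section \<open>The center\<close>

text \<open>For distinct indices the half-turn in the plane of coordinates \<open>i\<close> and
  \<open>j\<close>. Two signs are changed so that the determinant is 1.\<close>

definition sign_matrix :: "'k::finite \<Rightarrow> 'k \<Rightarrow> real^'k^'k" where
  "sign_matrix i j = (\<chi> p q. if p = q then if p = i \<or> p = j then -1 else 1 else 0)"

lemma sign_matrix_SO:
  assumes "i \<noteq> j"
  shows "sign_matrix i j \<in> SO"
proof -
  have "transpose (sign_matrix i j) ** sign_matrix i j = mat 1"
    by (auto simp: sign_matrix_def vec_eq_iff matrix_matrix_mult_def transpose_def mat_def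
        if_distrib[of "\<lambda>z. z * _"] if_distrib[of "\<lambda>z. _ * z"] sum.delta cong: if_cong)
  moreover have "det (sign_matrix i j) = 1"
  proof -
    have "det (sign_matrix i j) = (\<Prod>p\<in>UNIV. if p = i \<or> p = j then -1 else 1)"
      by (subst det_diagonal) (simp_all add: sign_matrix_def)
    also have "\<dots> = (\<Prod>p\<in>UNIV. (if p = i then -1 else 1) * (if p = j then -1 else 1))"
      by (rule prod.cong) (use assms in auto)
    also have "\<dots> = 1" by (simp add: prod.distrib prod.delta)
    finally show ?thesis .
  qed
  ultimately show ?thesis by (simp add: rotation_matrix_def orthogonal_matrix)
qed

lemma sign_matrix_mult:
  "(sign_matrix i j ** c) $ p $ q = (if p = i \<or> p = j then - c $ p $ q else c $ p $ q)"
  "(b ** sign_matrix i j) $ q' $ p = (if p = i \<or> p = j then - b $ q' $ p else b $ q' $ p)"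
  for c :: "real^'n^'k::finite" and b :: "real^'k^'l"
  by (auto simp: sign_matrix_def matrix_matrix_mult_def
      if_distrib[of "\<lambda>z. z * _"] if_distrib[of "\<lambda>z. _ * z"] sum.delta' sum.delta cong: if_cong)

lemma exists_other:
  assumes "2 \<le> CARD('m::finite)"
  shows "\<exists>j. (i :: 'm) \<noteq> j"
proof (rule ccontr)
  assume "\<nexists>j. i \<noteq> j"
  then have "(UNIV :: 'm set) = {i}" by auto
  from arg_cong[OF this, of card] show False using assms by simp
qed

lemma norm_axis_real: "norm (axis j c :: real^'k) = \<bar>c\<bar>"
  by (simp add: norm_eq_sqrt_inner inner_axis_axis)

text \<open>A matrix unit scaled into the domain. The factor 1/2 is one choice of a number in (0,
  1), as the matrix unit itself has norm 1.\<close>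

lemma half_axis_Omega:
  "(\<chi> i. if i = j then axis q (1/2) else 0) \<in> (Omega :: 'm::finite colpair set)"
proof -
  let ?\<beta> = "(\<chi> i. if i = j then axis q (1/2) else 0) :: 'm colpair"
  have "norm (?\<beta> *v x) < norm x" if "x \<noteq> 0" for x
  proof -
    have "?\<beta> *v x = axis j (x $ q / 2)"
      by (auto simp: vec_eq_iff matrix_vector_mult_def axis_def if_distrib[of "\<lambda>z. z * _"]
          if_distrib[of "\<lambda>z. z $ _"] sum.delta cong: if_cong)
    then have "norm (?\<beta> *v x) = \<bar>x $ q\<bar> / 2" by (simp add: norm_axis_real)
    also have "\<dots> \<le> norm x / 2" using component_le_norm_cart[of x q] by simp
    also have "\<dots> < norm x" using that by simp
    finally show ?thesis .
  qed
  then show ?thesis by (simp add: Omega_iff)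
qed

text \<open>Commuting with half-turns kills the off-diagonal blocks. Commuting with section values
  then gives d \<beta> = \<beta> a for all \<beta>, which forces both diagonal blocks to be the same
  scalar, and pseudo-orthogonality makes its square 1.\<close>

lemma O_up_center:
  fixes Z :: "'m::{finite,linorder} pmat"
  assumes card: "2 \<le> CARD('m)" and Z: "Z \<in> O_up"
    and comm: "\<And>X. X \<in> O_up \<Longrightarrow> Z ** X = X ** Z"
  shows "Z = mat 1 \<or> Z = - mat 1"
proof -
  have b: "block_b Z $ q $ i = 0" and c: "block_c Z $ i $ q' = 0" for q q' i
  proof -
    obtain j where j: "i \<noteq> j" using exists_other[OF card] by blast
    \<comment> \<open>Only the lower rotation is nontrivial, so it negates column \<open>i\<close>
      of the upper right block and row \<open>i\<close> of the lower left block while the other side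
      of the equation leaves them unchanged.\<close>
    have "Z ** S_mat (mat 1) (sign_matrix i j) = S_mat (mat 1) (sign_matrix i j) ** Z"
      by (intro comm S_mat_O_up card mat_1_SO sign_matrix_SO j)
    from arg_cong[OF this, of block_b] arg_cong[OF this, of block_c]
    have "block_b Z ** sign_matrix i j = block_b Z" "sign_matrix i j ** block_c Z = block_c Z"
      by (simp_all add: block_mult)
    then have "(block_b Z ** sign_matrix i j) $ q $ i = block_b Z $ q $ i"
      "(sign_matrix i j ** block_c Z) $ i $ q' = block_c Z $ i $ q'" by simp_all
    then show "block_b Z $ q $ i = 0" "block_c Z $ i $ q' = 0" by (simp_all add: sign_matrix_mult)
  qed
  then have b0: "block_b Z = 0" and c0: "block_c Z = 0" by (simp_all add: vec_eq_iff)
  have e: "block_d Z ** \<beta> = \<beta> ** block_a Z" if \<beta>: "\<beta> \<in> Omega" for \<beta> :: "'m colpair"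
  proof -
    have "Z ** P_sec \<beta> = P_sec \<beta> ** Z" by (intro comm P_sec_O_up \<beta>)
    from arg_cong[OF this, of block_a] arg_cong[OF this, of block_c]
    have a: "block_a Z ** chol_a \<beta> = chol_a \<beta> ** block_a Z"
      and "block_d Z ** (\<beta> ** chol_a \<beta>) = \<beta> ** chol_a \<beta> ** block_a Z"
      by (simp_all add: block_mult block_P_sec[OF \<beta>] b0 c0)
    \<comment> \<open>The upper left blocks show that \<open>block_a Z\<close> commutes with
      \<open>chol_a \<beta>\<close>. This brings the Cholesky factor to the right end of both sides,
      where it cancels.\<close>
    then have "block_d Z ** \<beta> ** chol_a \<beta> = \<beta> ** (block_a Z ** chol_a \<beta>)"
      unfolding a by (simp add: matrix_mul_assoc)
    then have "block_d Z ** \<beta> ** chol_a \<beta> ** matrix_inv (chol_a \<beta>) = \<beta> ** block_a Z ** chol_a \<beta> ** matrix_inv (chol_a \<beta>)"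
      by (simp only: matrix_mul_assoc)
    then show ?thesis
      by (simp add: matrix_inv_right[OF det_chol_a[OF \<beta>]] matrix_mul_assoc[symmetric])
  qed
  \<comment> \<open>The relation d \<beta> = \<beta> a tested on half of the matrix unit with row
    \<open>j\<close> and column \<open>q\<close>.\<close>
  have e': "block_d Z $ i $ j * (if q = p then 1 else 0) = (if i = j then block_a Z $ q $ p else 0)" for i j q p
  proof -
    let ?\<beta> = "(\<chi> i. if i = j then axis q (1/2) else 0) :: 'm colpair"
    have "(block_d Z ** ?\<beta>) $ i $ p = block_d Z $ i $ j * (if q = p then 1/2 else 0)"
      by (simp add: matrix_matrix_mult_def axis_def if_distrib[of "\<lambda>z. _ * z"] if_distrib[of "\<lambda>z. z $ _"]
          sum.delta cong: if_cong)
    moreover have "(?\<beta> ** block_a Z) $ i $ p = (if i = j then block_a Z $ q $ p / 2 else 0)"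
      by (simp add: matrix_matrix_mult_def axis_def if_distrib[of "\<lambda>z. z * _"] if_distrib[of "\<lambda>z. z $ _"]
          sum.delta cong: if_cong)
    ultimately show ?thesis using arg_cong[OF e[OF half_axis_Omega[of j q]], of "\<lambda>M. M $ i $ p"]
      by (auto split: if_splits)
  qed
  define s where "s = block_a Z $ 0 $ 0"
  have d: "block_d Z $ i $ j = (if i = j then s else 0)" for i j
    using e'[of i j 0 0] by (simp add: s_def)
  \<comment> \<open>The index \<open>undefined\<close> is an arbitrary row of the lower block, whose
    diagonal entry is already known to be \<open>s\<close>.\<close>
  have a: "block_a Z $ q $ p = (if q = p then s else 0)" for q p
    using e'[of undefined undefined q p] d[of undefined undefined] by (auto split: if_splits)
  have ZS: "Z = s *\<^sub>R mat 1"
  proof (rule block_eqI)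
    show "block_a Z = block_a (s *\<^sub>R mat 1)" by (simp add: block_scaleR) (simp add: vec_eq_iff a mat_def)
    show "block_d Z = block_d (s *\<^sub>R mat 1)" by (simp add: block_scaleR) (simp add: vec_eq_iff d mat_def)
  qed (simp_all add: block_scaleR b0 c0)
  have "adj Z ** Z = mat 1" by (rule O_up_adj_left[OF Z])
  then have "(s * s) *\<^sub>R (mat 1 :: 'm pmat) = mat 1"
    unfolding ZS by (simp add: adj_scaleR matrix_distribs(5,6))
  from arg_cong[OF this, of "\<lambda>M. M $ Inl 0 $ Inl 0"] have "s * s = 1" by (simp add: mat_def)
  then have "(s - 1) * (s + 1) = 0" by (simp add: algebra_simps)
  then have "s = 1 \<or> s = -1" by auto
  then show ?thesis using ZS by auto
qed

section \<open>Angles of the central elements\<close>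

lemma rho_eq_iff: "rho s = rho t \<longleftrightarrow> cis s = cis t"
proof
  assume e: "rho s = rho t"
  from arg_cong[OF e, of lam2] show "cis s = cis t" by simp
qed (intro lam2_inject rho_SO, simp)

lemma rho_eq_mat_1_iff: "rho t = mat 1 \<longleftrightarrow> (\<exists>k::int. t = 2 * pi * of_int k)"
proof
  assume "rho t = mat 1"
  then have "cis t = 1" unfolding rho_0[symmetric] rho_eq_iff by simp
  then obtain k :: int where "t = 2 * pi * of_int k" by (rule cis_eq_1D)
  then show "\<exists>k::int. t = 2 * pi * of_int k" ..
next
  assume "\<exists>k::int. t = 2 * pi * of_int k"
  then obtain k :: int where "t = 2 * pi * of_int k" ..
  then have "cis t = 1" by (simp only: cis_multiple_2pi Ints_of_int)
  then show "rho t = mat 1" by (intro lam2_inject rho_SO mat_1_SO) simp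
qed

lemma rho_pi: "rho pi = - mat 1"
  by (simp add: vec_eq_iff forall_two mat_def)

lemma rho_eq_rho_pi_iff: "rho t = rho pi \<longleftrightarrow> (\<exists>k::int. t = pi + 2 * pi * of_int k)"
proof -
  have "rho t = rho pi \<longleftrightarrow> rho (t - pi) = mat 1"
  proof
    assume "rho t = rho pi"
    then have "cis t = cis pi" by (simp only: rho_eq_iff)
    then have "cis (t - pi) = 1" by (simp flip: cis_divide)
    then show "rho (t - pi) = mat 1" by (intro lam2_inject rho_SO mat_1_SO) simp
  next
    assume "rho (t - pi) = mat 1"
    then have "rho (t - pi) ** rho pi = mat 1 ** rho pi" by simp
    then show "rho t = rho pi" by (simp add: rho_add)
  qed
  also have "\<dots> \<longleftrightarrow> (\<exists>k::int. t = pi + 2 * pi * of_int k)"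
    unfolding rho_eq_mat_1_iff by (intro ex_cong1) auto
  finally show ?thesis .
qed

lemma psi_S_mat:
  fixes R :: "'m::{finite,linorder} sqmat"
  assumes "r \<in> SO" "R \<in> SO"
  shows "psi (S_mat r R) = r"
proof -
  have "S_mat r R = P_sec 0 ** S_mat r R" by simp
  from psi_Psi_unique(2)[OF zero_in_Omega assms this] show ?thesis .
qed

text \<open>This is where the angle pi of the central elements over -1 comes from: the upper block
  of -1 is a half-turn of the plane.\<close>

lemma minus_mat_1_S_mat: "(- mat 1 :: 'm::finite pmat) = S_mat (rho pi) (- mat 1)"
  by (rule block_eqI) (simp_all add: rho_pi block_scaleR[of "- 1" "mat 1", simplified])

lemma det_minus_mat_1: "det (- mat 1 :: real^'k^'k) = (-1) ^ CARD('k)"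
  by (subst det_diagonal) (simp_all add: mat_def)

text \<open>Determinants of lower blocks are positive on \<open>O_up\<close>, which excludes odd
  sizes; for even sizes -1 is an isotropy matrix with both blocks rotations.\<close>

lemma minus_mat_1_O_up:
  assumes card: "2 \<le> CARD('m::{finite,linorder})"
  shows "(- mat 1 :: 'm pmat) \<in> O_up \<longleftrightarrow> even CARD('m)"
proof
  assume "(- mat 1 :: 'm pmat) \<in> O_up"
  from O_up_det_pos(2)[OF this] have "0 < (-1 :: real) ^ CARD('m)"
    by (simp add: minus_mat_1_S_mat det_minus_mat_1)
  then show "even CARD('m)" by (cases "even CARD('m)") simp_all
next
  assume e: "even CARD('m)"
  have "(- mat 1 :: 'm sqmat) \<in> SO"
    using e by (simp add: rotation_matrix_def orthogonal_matrix det_minus_mat_1)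
  then show "(- mat 1 :: 'm pmat) \<in> O_up"
    unfolding minus_mat_1_S_mat by (intro S_mat_O_up card rho_SO)
qed

lemma zeta_commute_center:
  fixes Z X :: "'m::{finite,linorder} pmat"
  assumes card: "2 \<le> CARD('m)" and Z: "Z \<in> O_up" and comm: "\<And>X. X \<in> O_up \<Longrightarrow> Z ** X = X ** Z"
    and X: "X \<in> O_up"
  shows "zeta Z X = zeta X Z"
proof -
  have "zeta Z X - zeta X Z = 0"
  proof (rule connected_angle_zero[OF connected_O_up, where a = "mat 1" and d = "\<lambda>X. zeta Z X - zeta X Z"])
    show "continuous_on O_up (\<lambda>X. zeta Z X - zeta X Z)"
      by (intro continuous_on_diff continuous_on_zeta card continuous_on_const continuous_on_id Z)
    show "cis (zeta Z Y - zeta Y Z) = 1" if Y: "Y \<in> O_up" for Y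
    proof -
      have "lam2 (psi (Z ** Y)) = lam2 (psi (Y ** Z))" by (simp add: comm[OF Y])
      then have "cis (zeta Z Y) = cis (zeta Y Z)"
        using lam2_SO_nonzero[OF psi_Psi(1)[OF Z]] lam2_SO_nonzero[OF psi_Psi(1)[OF Y]]
        by (simp add: lam2_psi_mult[OF card Z Y] lam2_psi_mult[OF card Y Z] mult_ac)
      then show ?thesis by (simp flip: cis_divide)
    qed
    show "zeta Z (mat 1) - zeta (mat 1) Z = 0" by (simp add: zeta_mat_1[OF card Z])
  qed (use X in auto)
  then show ?thesis by simp
qed

text \<open>The center is the full preimage of the scalars in \<open>O_up\<close>. Every element of
  \<open>O_up\<close> lifts, so a central element projects to a central one; conversely
  \<open>zeta_commute_center\<close> makes the second components agree as well.\<close>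

lemma group_center_O_hat:
  assumes card: "2 \<le> CARD('m)"
  shows "group_center (O_hat_group :: ('m::{finite,linorder} pmat \<times> real) monoid) =
    {(Z, t). (Z, t) \<in> O_hat \<and> (Z = mat 1 \<or> Z = - mat 1)}"
proof -
  have "(Z = mat 1 \<or> Z = - mat 1) \<longleftrightarrow> (\<forall>y\<in>O_hat. (Z, t) \<otimes>\<^bsub>O_hat_group\<^esub> y = y \<otimes>\<^bsub>O_hat_group\<^esub> (Z, t))"
    if Zt: "(Z, t) \<in> O_hat" for Z :: "'m pmat" and t
  proof
    have Z: "Z \<in> O_up" using Zt by (simp add: mem_O_hat_iff)
    assume "Z = mat 1 \<or> Z = - mat 1"
    then have comm: "Z ** X = X ** Z" for X by auto
    show "\<forall>y\<in>O_hat. (Z, t) \<otimes>\<^bsub>O_hat_group\<^esub> y = y \<otimes>\<^bsub>O_hat_group\<^esub> (Z, t)"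
      using zeta_commute_center[OF card Z comm] comm by (auto simp: mem_O_hat_iff)
  next
    have Z: "Z \<in> O_up" using Zt by (simp add: mem_O_hat_iff)
    assume *: "\<forall>y\<in>O_hat. (Z, t) \<otimes>\<^bsub>O_hat_group\<^esub> y = y \<otimes>\<^bsub>O_hat_group\<^esub> (Z, t)"
    show "Z = mat 1 \<or> Z = - mat 1"
    proof (rule O_up_center[OF card Z])
      fix X :: "'m pmat" assume "X \<in> O_up"
      then obtain s where "(X, s) \<in> O_hat" by (rule O_hat_fiber)
      with * have "(Z, t) \<otimes>\<^bsub>O_hat_group\<^esub> (X, s) = (X, s) \<otimes>\<^bsub>O_hat_group\<^esub> (Z, t)" by blast
      then show "Z ** X = X ** Z" by simp
    qed
  qed
  then show ?thesis unfolding group_center_def O_hat_group_simps(1) by auto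
qed

text \<open>\<open>CARD('m)\<close> is n + 1, so this is the case of even n. Since -1 lies outside
  \<open>O_up\<close>, only the fibre over the identity remains.\<close>

lemma group_center_O_hat_odd:
  assumes card: "2 \<le> CARD('m)" and m: "odd CARD('m::{finite,linorder})"
  shows "group_center O_hat_group = {(mat 1 :: 'm pmat, 2 * pi * of_int k) |k::int. True}"
proof -
  have "(mat 1 :: 'm pmat, t) \<in> O_hat \<longleftrightarrow> (\<exists>k::int. t = 2 * pi * of_int k)" for t
    using rho_eq_mat_1_iff[of t] by (auto simp: mem_O_hat_iff)
  moreover have "(- mat 1 :: 'm pmat, t) \<notin> O_hat" for t
    using minus_mat_1_O_up[OF card] m by (simp add: mem_O_hat_iff)
  ultimately show ?thesis unfolding group_center_O_hat[OF card] by auto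
qed

text \<open>The case of odd n. The fibres over 1 and -1 supply the even and the odd multiples of pi,
  which combine into a single family indexed by the integers.\<close>

lemma group_center_O_hat_even:
  assumes card: "2 \<le> CARD('m)" and m: "even CARD('m::{finite,linorder})"
  shows "group_center O_hat_group = {(((- 1) powi k) *\<^sub>R (mat 1 :: 'm pmat), pi * of_int k) |k::int. True}"
proof -
  have p: "(mat 1 :: 'm pmat, t) \<in> O_hat \<longleftrightarrow> (\<exists>k::int. t = 2 * pi * of_int k)" for t
    using rho_eq_mat_1_iff[of t] by (auto simp: mem_O_hat_iff)
  have "(- mat 1 :: 'm sqmat) \<in> SO"
    using m by (simp add: rotation_matrix_def orthogonal_matrix det_minus_mat_1)
  then have "psi (- mat 1 :: 'm pmat) = rho pi" unfolding minus_mat_1_S_mat by (intro psi_S_mat rho_SO)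
  then have q: "(- mat 1 :: 'm pmat, t) \<in> O_hat \<longleftrightarrow> (\<exists>k::int. t = pi + 2 * pi * of_int k)" for t
    using rho_eq_rho_pi_iff[of t] minus_mat_1_O_up[OF card] m by (auto simp: mem_O_hat_iff)
  show ?thesis
    unfolding group_center_O_hat[OF card]
  proof (rule subset_antisym; rule subsetI)
    fix x :: "'m pmat \<times> real" assume "x \<in> {(Z, t). (Z, t) \<in> O_hat \<and> (Z = mat 1 \<or> Z = - mat 1)}"
    then obtain k :: int where "x = (mat 1, 2 * pi * of_int k) \<or> x = (- mat 1, pi + 2 * pi * of_int k)"
      using p q by auto
    then show "x \<in> {(((- 1) powi k) *\<^sub>R (mat 1 :: 'm pmat), pi * of_int k) |k::int. True}"
    proof
      assume "x = (mat 1, 2 * pi * of_int k)"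
      then have "x = (((- 1) powi (2 * k)) *\<^sub>R mat 1, pi * of_int (2 * k))" by simp
      then show ?thesis by blast
    next
      assume "x = (- mat 1, pi + 2 * pi * of_int k)"
      then have "x = (((- 1) powi (2 * k + 1)) *\<^sub>R mat 1, pi * of_int (2 * k + 1))"
        by (simp add: power_int_minus_left algebra_simps)
      then show ?thesis by blast
    qed
  next
    fix x :: "'m pmat \<times> real" assume "x \<in> {(((- 1) powi k) *\<^sub>R (mat 1 :: 'm pmat), pi * of_int k) |k::int. True}"
    then obtain k :: int where x: "x = (((- 1) powi k) *\<^sub>R mat 1, pi * of_int k)" by blast
    show "x \<in> {(Z, t). (Z, t) \<in> O_hat \<and> (Z = mat 1 \<or> Z = - mat 1)}"
    proof (cases "even k")
      case True
      then obtain l where l: "k = 2 * l" by (rule evenE)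
      then have "x = (mat 1, 2 * pi * of_int l)" by (simp add: x)
      then show ?thesis using p by auto
    next
      case False
      then obtain l where l: "k = 2 * l + 1" by (rule oddE)
      then have "x = (- mat 1, pi + 2 * pi * of_int l)" by (simp add: x power_int_minus_left algebra_simps)
      then show ?thesis using q by auto
    qed
  qed
qed

section \<open>The center as an abstract group\<close>

lemma Z_hat_iso_integers:
  fixes h :: "int \<Rightarrow> 'm::{finite,linorder} pmat \<times> real"
  assumes "group_center O_hat_group = range h" "inj h"
    and "\<And>k l. h k \<otimes>\<^bsub>O_hat_group\<^esub> h l = h (k + l)"
  shows "(Z_hat_group :: ('m pmat \<times> real) monoid) \<cong> integer_group"
proof -
  have "h \<in> iso integer_group Z_hat_group"
    using assms by (auto simp: iso_def hom_def bij_betw_def Z_hat_group_def integer_group_def)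
  then have "integer_group \<cong> (Z_hat_group :: ('m pmat \<times> real) monoid)" by (rule is_isoI)
  then show ?thesis using group.iso_sym[OF group_integer_group] by blast
qed

lemma Z_hat_iso_odd:
  assumes card: "2 \<le> CARD('m)" and m: "odd CARD('m::{finite,linorder})"
  shows "(Z_hat_group :: ('m pmat \<times> real) monoid) \<cong> integer_group"
proof (rule Z_hat_iso_integers[of "\<lambda>k. (mat 1, 2 * pi * of_int k)"])
  show "group_center O_hat_group = range (\<lambda>k::int. (mat 1 :: 'm pmat, 2 * pi * of_int k))"
    unfolding group_center_O_hat_odd[OF card m] by auto
qed (auto simp: inj_on_def zeta_mat_1[OF card] algebra_simps)

text \<open>The second component alone makes the parametrization injective, and all integer
  multiples of pi occur, so the center is infinite cyclic. Additivity holds because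
  \<open>zeta\<close> vanishes on the central elements.\<close>

lemma Z_hat_iso_even:
  assumes card: "2 \<le> CARD('m)" and m: "even CARD('m::{finite,linorder})"
  shows "(Z_hat_group :: ('m pmat \<times> real) monoid) \<cong> integer_group"
proof (rule Z_hat_iso_integers[of "\<lambda>k. (((- 1) powi k) *\<^sub>R mat 1, pi * of_int k)"])
  show "group_center O_hat_group = range (\<lambda>k::int. (((- 1) powi k) *\<^sub>R (mat 1 :: 'm pmat), pi * of_int k))"
    unfolding group_center_O_hat_even[OF card m] by auto
  show "(((- 1) powi k) *\<^sub>R (mat 1 :: 'm pmat), pi * of_int k) \<otimes>\<^bsub>O_hat_group\<^esub> (((- 1) powi l) *\<^sub>R mat 1, pi * of_int l) =
      (((- 1) powi (k + l)) *\<^sub>R mat 1, pi * of_int (k + l))" for k l :: int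
  proof -
    have R: "(- mat 1 :: 'm sqmat) \<in> SO"
      using m by (simp add: rotation_matrix_def orthogonal_matrix det_minus_mat_1)
    \<comment> \<open>The scalars 1 and -1 are isotropy matrices, so \<open>zeta_S_mat\<close>
      removes the cocycle term from their products.\<close>
    have S: "\<exists>r\<in>SO. \<exists>R\<in>SO. ((- 1) powi j) *\<^sub>R (mat 1 :: 'm pmat) = S_mat r R" for j :: int
    proof (cases "even j")
      case True
      then have "((- 1) powi j) *\<^sub>R (mat 1 :: 'm pmat) = S_mat (mat 1) (mat 1)"
        by (simp add: power_int_minus_left S_mat_def flip: mat_1_block)
      then show ?thesis by (rule bexI[OF bexI[OF _ mat_1_SO] mat_1_SO])
    next
      case False
      then have "((- 1) powi j) *\<^sub>R (mat 1 :: 'm pmat) = S_mat (rho pi) (- mat 1)"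
        by (simp add: power_int_minus_left flip: minus_mat_1_S_mat)
      then show ?thesis by (rule bexI[OF bexI[OF _ R] rho_SO])
    qed
    obtain r R r' R' where "r \<in> SO" "R \<in> SO" "((- 1) powi k) *\<^sub>R (mat 1 :: 'm pmat) = S_mat r R"
      "r' \<in> SO" "R' \<in> SO" "((- 1) powi l) *\<^sub>R (mat 1 :: 'm pmat) = S_mat r' R'"
      using S[of k] S[of l] by (elim bexE)
    then have "zeta (((- 1) powi k) *\<^sub>R (mat 1 :: 'm pmat)) (((- 1) powi l) *\<^sub>R mat 1) = 0"
      using zeta_S_mat[OF card] by (simp only:)
    then show ?thesis
      by (simp add: matrix_distribs(5,6) power_int_add algebra_simps)
  qed
qed (auto simp: inj_on_def)

theorem theoremA:
  fixes n :: nat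
  assumes "n \<ge> 2" and "CARD('m::{finite,linorder}) = n + 1"
  shows
    "connected (O_hat :: ('m pmat \<times> real) set) \<and>
     embedded_submanifold (O_hat :: ('m pmat \<times> real) set) (O_up \<times> UNIV) \<and>
     (O_hat :: ('m pmat \<times> real) set) diffeomorphic
       ((Omega :: ('m colpair) set) \<times> (UNIV :: real set) \<times> (SO :: ('m sqmat) set)) \<and>
     lie_group (O_hat_group :: ('m pmat \<times> real) monoid) \<and>
     (\<forall>(X :: 'm pmat, \<tau>) \<in> O_hat.
        inv\<^bsub>O_hat_group\<^esub> (X, \<tau>) = (matrix_inv X, - \<tau> - zeta X (matrix_inv X))) \<and>
     lie_covering_hom (O_hat_group :: ('m pmat \<times> real) monoid) O_up_group sigma_cov \<and>
     (even n \<longrightarrow>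
        group_center O_hat_group = {(mat 1 :: 'm pmat, 2 * pi * of_int k) |k::int. True} \<and>
        (Z_hat_group :: ('m pmat \<times> real) monoid) \<cong> integer_group) \<and>
     (odd n \<longrightarrow>
        group_center O_hat_group =
          {(((- 1) powi k) *\<^sub>R (mat 1 :: 'm pmat), pi * of_int k) |k::int. True} \<and>
        (Z_hat_group :: ('m pmat \<times> real) monoid) \<cong> integer_group)"
proof -
  have card: "2 \<le> CARD('m)" using assms by simp
  have parity: "even CARD('m) \<longleftrightarrow> odd n" using assms(2) by simp
  have "\<forall>(X :: 'm pmat, \<tau>) \<in> O_hat.
      inv\<^bsub>O_hat_group\<^esub> (X, \<tau>) = (matrix_inv X, - \<tau> - zeta X (matrix_inv X))"
    by (auto simp: inv_O_hat[OF card] mem_O_hat_iff O_up_matrix_inv)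
  then show ?thesis
    using connected_O_hat[OF card] embedded_submanifold_O_hat diffeomorphism_O_hat[OF card]
      lie_group_O_hat[OF card] lie_covering_hom_sigma[OF card]
      group_center_O_hat_odd[OF card] Z_hat_iso_odd[OF card]
      group_center_O_hat_even[OF card] Z_hat_iso_even[OF card] parity
    unfolding diffeomorphic_def by blast
qed

end
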